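(* Let $T>0$ and let $\alpha,\beta,\mu\in\mathbb{R}$ with $0\le\alpha<2$, $\alpha+\beta<1$ and $\mu<\mu(\alpha+\beta):=\frac{(1-\alpha-\beta)^2}{4}$. Let $\kappa_\alpha:=\frac{2-\alpha}{2}$, $\nu:=\sqrt{\mu(\alpha+\beta)-\mu}/\kappa_\alpha$ and $\gamma:=\sqrt{\mu(\alpha+\beta)}-\sqrt{\mu(\alpha+\beta)-\mu}$. Let $f\in L^2(0,T)$ and $u_0\in\mathcal{H}^{-s}$ with $s>\nu$. Then the formula $$\langle u(\tau),z^\tau\rangle_{\mathcal{H}^{-s},\mathcal{H}^s}=\int_0^\tau f(t)\,\mathcal{O}_{\alpha+\beta+\gamma}(S(\tau-t)z^\tau)\,dt+\langle u_0,S(\tau)z^\tau\rangle_{\mathcal{H}^{-s},\mathcal{H}^s}\qquad\text{for all }z^\tau\in\mathcal{H}^s \qquad(\ast)$$ defines for each $\tau\in[0,T]$ a unique element $u(\tau)\in\mathcal{H}^{-s}$, which can be written as $$u(\tau)=S(\tau)u_0+B(\tau)f,\quad\tau\in(0,T],$$ where $B(\tau)$ is the strongly continuous family of bounded operators $B(\tau):L^2(0,T)\to\mathcal{H}^{-s}$ given by $$\langle B(\tau)f,z^\tau\rangle_{\mathcal{H}^{-s},\mathcal{H}^s}=\int_0^\tau f(t)\,\mathcal{O}_{\alpha+\beta+\gamma}(S(\tau-t)z^\tau)\,dt\quad\text{for all }z^\tau\in\mathcal{H}^s.$$ Furthermore, the unique weak solution $u$ on $[0,T]$ of the system $$ \left\{\begin{aligned}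 u_t-(x^\alpha u_x)_x-\beta x^{\alpha -1}u_x-\frac{\mu}{x^{2-\alpha}} u&=0 & & \text{in }(0,1)\times(0,T), \\ (x^{-\gamma}u)(0, t) =f(t),\quad u(1, t)&=0 & & \text{on }(0, T), \\ u(x, 0) &=u_{0}(x) & & \text{in }(0, 1) \end{aligned}\right. $$ (in the sense of $(\ast)$) belongs to $C^0([0,T];\mathcal{H}^{-s})$ and fulfills $$\|u\|_{L^\infty([0,T];\mathcal{H}^{-s})}\le C\left(\|u_0\|_{\mathcal{H}^{-s}}+\|f\|_{L^2(0,T)}\right)$$ for a constant $C>0$ not depending on $u_0$ and $f$.
   Context: $L^2_\beta(0,1):=L^2((0,1);x^\beta dx)$ with inner product $\langle f,g\rangle_\beta=\int_0^1 fg\,x^\beta dx$. $J_\nu(x)=\sum_{m\ge0}\frac{(-1)^m}{m!\,\Gamma(m+\nu+1)}(x/2)^{2m+\nu}$ is the Bessel function of the first kind and $0<j_{\nu,1}<j_{\nu,2}<\cdots$ are its positive zeros. The functions $$\Phi_k(x):=\frac{(2\kappa_\alpha)^{1/2}}{|J'_\nu(j_{\nu,k})|}x^{(1-\alpha-\beta)/2}J_\nu(j_{\nu,k}x^{\kappa_\alpha}),\quad k\ge1,$$ form an orthonormal basis of $L^2_\beta(0,1)$, and $\lambda_k:=\kappa_\alpha^2j_{\nu,k}^2$. For $s\ge0$, $$\mathcal{H}^s:=\Big\{u=\sum_{k\ge1}a_k\Phi_k:\|u\|_{\mathcal{H}^s}^2=\sum_{k\ge1}|a_k|^2\lambda_k^s<\infty\Big\},$$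 and $\mathcal{H}^{-s}$ is the dual of $\mathcal{H}^s$ with respect to the pivot space $L^2_\beta(0,1)=\mathcal{H}^0$ (equivalently the completion of $L^2_\beta(0,1)$ for $\|u\|_{\mathcal{H}^{-s}}^2=\sum_k\lambda_k^{-s}|\langle u,\Phi_k\rangle_\beta|^2$). For every $s\in\mathbb{R}$ the semigroup $S(t)$, $t\ge0$, on $\mathcal{H}^s$ is $S(t)\sum_ka_k\Phi_k=\sum_ke^{-\lambda_kt}a_k\Phi_k$. For $\delta\in\mathbb{R}$ and a smooth function $z:(0,1)\to\mathbb{R}$, $\mathcal{O}_\delta(z):=\lim_{x\to0^+}x^\delta z'(x)$. A weak solution of the system is a function $u\in C^0([0,T];\mathcal{H}^{-s})$ satisfying $(\ast)$ for every $\tau\in(0,T]$ and every $z^\tau\in\mathcal{H}^s$. *)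

theory Defs
  imports "HOL-Probability.Essential_Supremum"
begin

section \<open>Square-integrable functions\<close>

text \<open>Elements of an L2 space are represented by square-integrable functions; two
  representatives are identified when their difference has norm zero.\<close>

definition L2 :: "'a measure \<Rightarrow> ('a \<Rightarrow> real) set" where
  "L2 M = {f \<in> borel_measurable M. integrable M (\<lambda>x. (f x)\<^sup>2)}"

definition L2_inner :: "'a measure \<Rightarrow> ('a \<Rightarrow> real) \<Rightarrow> ('a \<Rightarrow> real) \<Rightarrow> real" where
  "L2_inner M f g = (LINT x|M. f x * g x)"

definition L2_norm :: "'a measure \<Rightarrow> ('a \<Rightarrow> real) \<Rightarrow> real" where
  "L2_norm M f = sqrt (L2_inner M f f)"

definition L2_sums :: "'a measure \<Rightarrow> (nat \<Rightarrow> 'a \<Rightarrow> real) \<Rightarrow> ('a \<Rightarrow> real) \<Rightarrow> bool" where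
  "L2_sums M F u \<longleftrightarrow> u \<in> L2 M \<and>
     (\<lambda>n. L2_norm M (\<lambda>x. u x - (\<Sum>k<n. F k x))) \<longlonglongrightarrow> 0"

text \<open>The measure \<open>x\<^sup>\<beta> dx\<close> on the unit interval.\<close>

definition weighted :: "real \<Rightarrow> real measure" where
  "weighted \<beta> = density (lebesgue_on {0<..<1}) (\<lambda>x. ennreal (x powr \<beta>))"


section \<open>Bessel functions and the eigenfunctions\<close>

text \<open>Only used for \<open>x > 0\<close>: by the convention \<open>0 powr a = 0\<close> the value at
  \<open>x = 0\<close> is wrong for \<open>\<nu> \<le> 0\<close>.\<close>

definition bessel_J :: "real \<Rightarrow> real \<Rightarrow> real" where
  "bessel_J \<nu> x =
     (\<Sum>m. (-1) ^ m / (fact m * Gamma (real m + \<nu> + 1)) * (x / 2) powr (2 * real m + \<nu>))"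

text \<open>The increasing enumeration of the positive zeros. It starts at index 0, so
  \<open>bessel_zero \<nu> k\<close> is what is usually written \<open>j\<^bsub>\<nu>,k+1\<^esub>\<close>; the eigenfunctions and
  eigenvalues below are shifted in the same way.\<close>

definition bessel_zero :: "real \<Rightarrow> nat \<Rightarrow> real" where
  "bessel_zero \<nu> = (THE j. strict_mono j \<and> range j = {x. 0 < x \<and> bessel_J \<nu> x = 0})"

definition mu_crit :: "real \<Rightarrow> real" where
  "mu_crit \<delta> = (1 - \<delta>)\<^sup>2 / 4"

definition kappa :: "real \<Rightarrow> real" where
  "kappa \<alpha> = (2 - \<alpha>) / 2"

definition nu :: "real \<Rightarrow> real \<Rightarrow> real \<Rightarrow> real" where
  "nu \<alpha> \<beta> \<mu> = sqrt (mu_crit (\<alpha> + \<beta>) - \<mu>) / kappa \<alpha>"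

definition gam :: "real \<Rightarrow> real \<Rightarrow> real \<Rightarrow> real" where
  "gam \<alpha> \<beta> \<mu> = sqrt (mu_crit (\<alpha> + \<beta>)) - sqrt (mu_crit (\<alpha> + \<beta>) - \<mu>)"

definition Phi :: "real \<Rightarrow> real \<Rightarrow> real \<Rightarrow> nat \<Rightarrow> real \<Rightarrow> real" where
  "Phi \<alpha> \<beta> \<mu> k x =
     (let \<nu> = nu \<alpha> \<beta> \<mu>; j = bessel_zero \<nu> k in
       sqrt (2 * kappa \<alpha>) / \<bar>deriv (bessel_J \<nu>) j\<bar> * x powr ((1 - \<alpha> - \<beta>) / 2)
         * bessel_J \<nu> (j * x powr kappa \<alpha>))"

definition eigval :: "real \<Rightarrow> real \<Rightarrow> real \<Rightarrow> nat \<Rightarrow> real" where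
  "eigval \<alpha> \<beta> \<mu> k = (kappa \<alpha>)\<^sup>2 * (bessel_zero (nu \<alpha> \<beta> \<mu>) k)\<^sup>2"


section \<open>The scale of spaces and the semigroup\<close>

definition H_space :: "real \<Rightarrow> real \<Rightarrow> real \<Rightarrow> real \<Rightarrow> (real \<Rightarrow> real) set" where
  "H_space \<alpha> \<beta> \<mu> s = {u. \<exists>a.
      L2_sums (weighted \<beta>) (\<lambda>k x. a k * Phi \<alpha> \<beta> \<mu> k x) u \<and>
      summable (\<lambda>k. \<bar>a k\<bar>\<^sup>2 * eigval \<alpha> \<beta> \<mu> k powr s)}"

text \<open>By orthonormality, the coefficients of an expansion \<open>u = \<Sum>k. a k * \<Phi> k\<close> are
  the inner products with the \<open>\<Phi> k\<close>.\<close>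

definition coeff :: "real \<Rightarrow> real \<Rightarrow> real \<Rightarrow> (real \<Rightarrow> real) \<Rightarrow> nat \<Rightarrow> real" where
  "coeff \<alpha> \<beta> \<mu> u k = L2_inner (weighted \<beta>) u (Phi \<alpha> \<beta> \<mu> k)"

definition H_norm :: "real \<Rightarrow> real \<Rightarrow> real \<Rightarrow> real \<Rightarrow> (real \<Rightarrow> real) \<Rightarrow> real" where
  "H_norm \<alpha> \<beta> \<mu> s u = sqrt (\<Sum>k. \<bar>coeff \<alpha> \<beta> \<mu> u k\<bar>\<^sup>2 * eigval \<alpha> \<beta> \<mu> k powr s)"

text \<open>The dual space of \<open>H_space \<alpha> \<beta> \<mu> s\<close>: bounded linear functionals, extended by zero
  outside the space, so that equality of functionals is equality in HOL. Boundedness makes them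
  independent of the choice of representatives. The duality pairing is function application.\<close>

definition H_dual :: "real \<Rightarrow> real \<Rightarrow> real \<Rightarrow> real \<Rightarrow> ((real \<Rightarrow> real) \<Rightarrow> real) set" where
  "H_dual \<alpha> \<beta> \<mu> s = {\<phi>.
      (\<forall>z. z \<notin> H_space \<alpha> \<beta> \<mu> s \<longrightarrow> \<phi> z = 0) \<and>
      (\<forall>y\<in>H_space \<alpha> \<beta> \<mu> s. \<forall>z\<in>H_space \<alpha> \<beta> \<mu> s. \<forall>a b.
          \<phi> (\<lambda>x. a * y x + b * z x) = a * \<phi> y + b * \<phi> z) \<and>
      (\<exists>C. \<forall>z\<in>H_space \<alpha> \<beta> \<mu> s. \<bar>\<phi> z\<bar> \<le> C * H_norm \<alpha> \<beta> \<mu> s z)}"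

definition H_dual_norm ::
    "real \<Rightarrow> real \<Rightarrow> real \<Rightarrow> real \<Rightarrow> ((real \<Rightarrow> real) \<Rightarrow> real) \<Rightarrow> real" where
  "H_dual_norm \<alpha> \<beta> \<mu> s \<phi> =
     (SUP z\<in>{z \<in> H_space \<alpha> \<beta> \<mu> s. H_norm \<alpha> \<beta> \<mu> s z \<le> 1}. \<bar>\<phi> z\<bar>)"

text \<open>The result is a representative of the sum of the series in L2; it is determined only up
  to null sets, and everything below depends only on its equivalence class.\<close>

definition heat_semigroup :: "real \<Rightarrow> real \<Rightarrow> real \<Rightarrow> real \<Rightarrow> (real \<Rightarrow> real) \<Rightarrow> real \<Rightarrow> real" where
  "heat_semigroup \<alpha> \<beta> \<mu> t u = (SOME v. L2_sums (weighted \<beta>)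
      (\<lambda>k x. exp (- eigval \<alpha> \<beta> \<mu> k * t) * coeff \<alpha> \<beta> \<mu> u k * Phi \<alpha> \<beta> \<mu> k x) v)"

text \<open>The semigroup on the dual space. An element \<open>\<phi>\<close> of the dual is \<open>\<Sum>k. a k * \<Phi> k\<close>
  with \<open>a k = \<phi> (\<Phi> k)\<close>, where \<open>\<Phi> k\<close> is regarded as the functional
  \<open>z \<mapsto> \<langle>\<Phi> k, z\<rangle>\<^sub>\<beta>\<close> through the pivot space.\<close>

definition heat_semigroup_dual :: "real \<Rightarrow> real \<Rightarrow> real \<Rightarrow> real \<Rightarrow> real \<Rightarrow>
    ((real \<Rightarrow> real) \<Rightarrow> real) \<Rightarrow> (real \<Rightarrow> real) \<Rightarrow> real" where
  "heat_semigroup_dual \<alpha> \<beta> \<mu> s t \<phi> z =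
     (if z \<in> H_space \<alpha> \<beta> \<mu> s
      then \<Sum>k. exp (- eigval \<alpha> \<beta> \<mu> k * t) * \<phi> (Phi \<alpha> \<beta> \<mu> k)
                  * L2_inner (weighted \<beta>) (Phi \<alpha> \<beta> \<mu> k) z
      else 0)"


section \<open>The boundary trace\<close>

definition smooth_on_unit :: "(real \<Rightarrow> real) \<Rightarrow> bool" where
  "smooth_on_unit w \<longleftrightarrow> (\<forall>n. \<forall>x\<in>{0<..<1}. (deriv ^^ n) w differentiable (at x))"

text \<open>\<open>\<O>\<^sub>\<delta>\<close> is applied to equivalence classes that contain a smooth function; the
  smooth representative is unique on the unit interval, and the limit is taken along it.\<close>

definition has_trace :: "real \<Rightarrow> (real \<Rightarrow> real) \<Rightarrow> real \<Rightarrow> bool" where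
  "has_trace \<delta> z l \<longleftrightarrow> (\<exists>w. smooth_on_unit w \<and>
      (AE x in lebesgue_on {0<..<1}. w x = z x) \<and>
      ((\<lambda>x. x powr \<delta> * deriv w x) \<longlongrightarrow> l) (at_right 0))"

definition boundary_trace :: "real \<Rightarrow> (real \<Rightarrow> real) \<Rightarrow> real" where
  "boundary_trace \<delta> z = (THE l. has_trace \<delta> z l)"


section \<open>Weak solutions\<close>

definition control_integrand ::
    "real \<Rightarrow> real \<Rightarrow> real \<Rightarrow> real \<Rightarrow> (real \<Rightarrow> real) \<Rightarrow> (real \<Rightarrow> real) \<Rightarrow> real \<Rightarrow> real" where
  "control_integrand \<alpha> \<beta> \<mu> \<tau> f z t =
     f t * boundary_trace (\<alpha> + \<beta> + gam \<alpha> \<beta> \<mu>) (heat_semigroup \<alpha> \<beta> \<mu> (\<tau> - t) z)"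

definition control_op :: "real \<Rightarrow> real \<Rightarrow> real \<Rightarrow> real \<Rightarrow> real \<Rightarrow>
    (real \<Rightarrow> real) \<Rightarrow> (real \<Rightarrow> real) \<Rightarrow> real" where
  "control_op \<alpha> \<beta> \<mu> s \<tau> f z =
     (if z \<in> H_space \<alpha> \<beta> \<mu> s
      then LINT t|lebesgue_on {0<..<\<tau>}. control_integrand \<alpha> \<beta> \<mu> \<tau> f z t
      else 0)"

definition transposition_identity :: "real \<Rightarrow> real \<Rightarrow> real \<Rightarrow> real \<Rightarrow>
    (real \<Rightarrow> real) \<Rightarrow> ((real \<Rightarrow> real) \<Rightarrow> real) \<Rightarrow> real \<Rightarrow> ((real \<Rightarrow> real) \<Rightarrow> real) \<Rightarrow> bool" where
  "transposition_identity \<alpha> \<beta> \<mu> s f u0 \<tau> U \<longleftrightarrow> (\<forall>z\<in>H_space \<alpha> \<beta> \<mu> s.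
      U z = (LINT t|lebesgue_on {0<..<\<tau>}. control_integrand \<alpha> \<beta> \<mu> \<tau> f z t)
            + u0 (heat_semigroup \<alpha> \<beta> \<mu> \<tau> z))"

definition bounded_control :: "real \<Rightarrow> real \<Rightarrow> real \<Rightarrow> real \<Rightarrow> real \<Rightarrow>
    ((real \<Rightarrow> real) \<Rightarrow> (real \<Rightarrow> real) \<Rightarrow> real) \<Rightarrow> bool" where
  "bounded_control \<alpha> \<beta> \<mu> s T B \<longleftrightarrow>
     (\<forall>f\<in>L2 (lebesgue_on {0<..<T}). B f \<in> H_dual \<alpha> \<beta> \<mu> s) \<and>
     (\<forall>f\<in>L2 (lebesgue_on {0<..<T}). \<forall>g\<in>L2 (lebesgue_on {0<..<T}). \<forall>a b.
        B (\<lambda>t. a * f t + b * g t) = (\<lambda>z. a * B f z + b * B g z)) \<and>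
     (\<exists>C. \<forall>f\<in>L2 (lebesgue_on {0<..<T}).
        H_dual_norm \<alpha> \<beta> \<mu> s (B f) \<le> C * L2_norm (lebesgue_on {0<..<T}) f)"

definition continuous_in_dual :: "real \<Rightarrow> real \<Rightarrow> real \<Rightarrow> real \<Rightarrow> real \<Rightarrow>
    (real \<Rightarrow> (real \<Rightarrow> real) \<Rightarrow> real) \<Rightarrow> bool" where
  "continuous_in_dual \<alpha> \<beta> \<mu> s T u \<longleftrightarrow>
     (\<forall>t\<in>{0..T}. u t \<in> H_dual \<alpha> \<beta> \<mu> s) \<and>
     (\<forall>t\<in>{0..T}. ((\<lambda>r. H_dual_norm \<alpha> \<beta> \<mu> s (\<lambda>z. u r z - u t z)) \<longlongrightarrow> 0)
                    (at t within {0..T}))"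

text \<open>Weak solutions, in the sense of transposition, of
  \<open>u\<^sub>t - (x\<^sup>\<alpha> u\<^sub>x)\<^sub>x - \<beta> x\<^bsup>\<alpha>-1\<^esup> u\<^sub>x - \<mu> x\<^bsup>\<alpha>-2\<^esup> u = 0\<close> on
  \<open>(0,1) \<times> (0,T)\<close> with boundary data \<open>(x\<^bsup>-\<gamma>\<^esup> u)(0,t) = f t\<close>, \<open>u(1,t) = 0\<close> and
  initial value \<open>u0\<close>.\<close>

definition weak_solution :: "real \<Rightarrow> real \<Rightarrow> real \<Rightarrow> real \<Rightarrow> real \<Rightarrow> (real \<Rightarrow> real) \<Rightarrow>
    ((real \<Rightarrow> real) \<Rightarrow> real) \<Rightarrow> (real \<Rightarrow> (real \<Rightarrow> real) \<Rightarrow> real) \<Rightarrow> bool" where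
  "weak_solution \<alpha> \<beta> \<mu> s T f u0 u \<longleftrightarrow>
     continuous_in_dual \<alpha> \<beta> \<mu> s T u \<and>
     (\<forall>\<tau>\<in>{0<..T}. transposition_identity \<alpha> \<beta> \<mu> s f u0 \<tau> (u \<tau>))"

end

theory Submission
  imports Defs
begin

text \<open>The state space is diagonalised by the \<open>\<Phi>\<^sub>k\<close>, so everything reduces to weighted square-summable
  sequences once three facts on Bessel functions are available. Write
  \<open>J\<^sub>\<nu>(x) = (x/2)\<^bsup>\<nu>\<^esup> E\<^sub>\<nu>(x\<^sup>2/4)\<close> with \<open>E\<^sub>\<nu>\<close> entire of order \<open>1/2\<close>. Sturm comparison gives infinitely many
  zeros with gaps bounded below, explicit primitives give orthonormality and simple zeros, and a monotone energy
  gives \<open>j J'\<^sub>\<nu>(j)\<^sup>2 \<ge> c > 0\<close> at large zeros.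

  Since \<open>\<Phi>\<^sub>k(x) = D\<^sub>k x\<^bsup>p\<^esup> E\<^sub>\<nu>(\<rho>\<^sub>k x\<^bsup>2\<kappa>\<^esup>)\<close> and \<open>e\<^bsup>-\<lambda>\<^sub>k t\<^esup>\<close> beats the growth of \<open>E\<^sub>\<nu>(\<rho>\<^sub>k y)\<close>
  in \<open>k\<close>, \<open>S(t)z\<close> has the form \<open>x\<^bsup>p\<^esup> G(x\<^bsup>2\<kappa>\<^esup>)\<close> with \<open>G\<close> entire, and its trace is a multiple of \<open>G(0)\<close>,
  namely \<open>\<Sum>\<^sub>k \<theta>\<^sub>k e\<^bsup>-\<lambda>\<^sub>k t\<^esup> z\<^sub>k\<close> with \<open>\<theta>\<^sub>k\<close> proportional to \<open>D\<^sub>k\<close>. Bounding each mode of the control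
  integral by \<open>\<theta>\<^sub>k |z\<^sub>k| \<parallel>f\<parallel> (2\<lambda>\<^sub>k)\<^bsup>-1/2\<^esup>\<close>, all claims follow from the convergence of
  \<open>\<Sum>\<^sub>k \<theta>\<^sub>k\<^sup>2 \<lambda>\<^sub>k\<^bsup>-1-s\<^esup>\<close>, whose terms are of size \<open>k\<^bsup>-1-2(s-\<nu>)\<^esup>\<close>.\<close>

section \<open>The entire part of the Bessel function\<close>

text \<open>The trace is the delicate point: \<open>L2\<close> convergence of an eigenfunction
  series says nothing about a derivative at \<open>0\<close>. Rearranging the double series over
  modes and powers gives a representative that can be differentiated term by term. The exponents fit
  because \<open>pexp\<close> and \<open>gam \<alpha> \<beta> \<mu>\<close> are the two roots of the
  indicial equation \<open>r^2 - (1 - \<alpha> - \<beta>) r + \<mu> = 0\<close> at \<open>0\<close>;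
  their sum gives \<open>\<alpha> + \<beta> + gam \<alpha> \<beta> \<mu> = 1 - pexp\<close>.

  The threshold for \<open>s\<close> comes from one-sided bounds alone, without asymptotic
  expansions. With \<open>j\<close> the zero of index \<open>k\<close>, the energy bound makes
  \<open>(amp k)^2\<close> at most a multiple of \<open>j powr (2 * \<nu> + 1)\<close>, the factor
  \<open>lam k powr (- 1 - s)\<close> contributes \<open>j powr (- 2 - 2 * s)\<close>, and
  \<open>j\<close> grows at least linearly in \<open>k\<close>. The extra power
  \<open>lam k powr - 1\<close> has two sources: the squared time norm of
  \<open>exp (- lam k * t)\<close> in the control integral, and \<open>exp (- x) <= 1 / x\<close> at
  a fixed \<open>t > 0\<close>. Hence one series controls both the traces and the control operator.
  All its bounds are uniform in time, so continuity in time follows mode by mode.\<close>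

definition bessel_coeff :: "real \<Rightarrow> nat \<Rightarrow> real" where
  "bessel_coeff \<nu> m = (-1) ^ m / (fact m * Gamma (real m + \<nu> + 1))"

definition bessel_E :: "real \<Rightarrow> real \<Rightarrow> real" where
  "bessel_E \<nu> y = (\<Sum>m. bessel_coeff \<nu> m * y ^ m)"

lemma Gamma_shift:
  fixes x :: real
  assumes "0 < x"
  shows "Gamma (x + 1) = x * Gamma x"
proof (rule Gamma_plus1)
  show "x \<notin> \<int>\<^sub>\<le>\<^sub>0"
    using assms by (auto elim!: nonpos_Ints_cases)
qed

lemma summable_power_over_Gamma:
  fixes \<nu> x :: real
  assumes "-1 < \<nu>"
  shows "summable (\<lambda>m. x ^ m / Gamma (real m + \<nu> + 1))"
proof (rule summable_ratio_test)
  \<comment> \<open>This cutoff makes the denominator \<open>real m + \<nu> + 1\<close> at least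
    \<open>2 * \<bar>x\<bar>\<close>, so successive ratios are at most \<open>1 / 2\<close>.\<close>
  fix m assume m: "nat \<lceil>2 * \<bar>x\<bar> + 1\<rceil> \<le> m"
  have G: "Gamma (real (Suc m) + \<nu> + 1) = (real m + \<nu> + 1) * Gamma (real m + \<nu> + 1)"
    using Gamma_shift[of "real m + \<nu> + 1"] assms by (simp add: algebra_simps)
  have "2 * \<bar>x\<bar> \<le> real m + \<nu> + 1"
    using m assms by linarith
  moreover have pos: "0 < real m + \<nu> + 1"
    using assms by linarith
  ultimately have "\<bar>x\<bar> / (real m + \<nu> + 1) \<le> 1 / 2"
    by (simp add: field_simps)
  hence "\<bar>x\<bar> / (real m + \<nu> + 1) * \<bar>x ^ m / Gamma (real m + \<nu> + 1)\<bar>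
      \<le> 1 / 2 * \<bar>x ^ m / Gamma (real m + \<nu> + 1)\<bar>"
    by (rule mult_right_mono) simp
  thus "norm (x ^ Suc m / Gamma (real (Suc m) + \<nu> + 1)) \<le> 1 / 2 * norm (x ^ m / Gamma (real m + \<nu> + 1))"
    unfolding G using pos by (simp add: abs_mult mult.assoc)
qed simp

lemma abs_bessel_coeff:
  assumes "-1 < \<nu>"
  shows "\<bar>bessel_coeff \<nu> m\<bar> = 1 / (fact m * Gamma (real m + \<nu> + 1))"
proof -
  have "0 < Gamma (real m + \<nu> + 1)"
    using assms by (intro Gamma_real_pos) linarith
  thus ?thesis
    by (simp add: bessel_coeff_def abs_mult)
qed

text \<open>Decay of the coefficients like \<open>(m!)\<^sup>-\<^sup>2\<close> makes the series of order \<open>1/2\<close>; all that is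
  needed is that it grows more slowly than every exponential.\<close>

lemma bessel_coeff_majorant:
  fixes \<nu> Y \<epsilon> :: real
  assumes "-1 < \<nu>" "0 < \<epsilon>"
  shows "\<exists>K>0. \<forall>\<rho>\<ge>0. \<forall>m. \<bar>bessel_coeff \<nu> m * (\<rho> * Y) ^ m\<bar> \<le> K * ((\<epsilon> * \<rho>) ^ m / fact m)"
proof -
  \<comment> \<open>In absolute value the term splits into
    \<open>(Y / \<epsilon>) ^ m / Gamma (real m + \<nu> + 1)\<close>, free of \<open>\<rho>\<close>,
    and \<open>(\<epsilon> * \<rho>) ^ m / fact m\<close>; hence one \<open>K\<close> for all
    \<open>\<rho>\<close>.\<close>
  have "Bseq (\<lambda>m. (Y / \<epsilon>) ^ m / Gamma (real m + \<nu> + 1))"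
    using summable_power_over_Gamma[OF assms(1)] by (intro convergent_imp_Bseq)
      (metis summable_LIMSEQ_zero convergentI)
  then obtain K where K: "K > 0" "\<And>m. norm ((Y / \<epsilon>) ^ m / Gamma (real m + \<nu> + 1)) \<le> K"
    by (auto elim: BseqE)
  have "\<bar>bessel_coeff \<nu> m * (\<rho> * Y) ^ m\<bar> \<le> K * ((\<epsilon> * \<rho>) ^ m / fact m)" if "0 \<le> \<rho>" for \<rho> m
  proof -
    have "0 < Gamma (real m + \<nu> + 1)"
      using assms by (intro Gamma_real_pos) linarith
    hence "\<bar>bessel_coeff \<nu> m * (\<rho> * Y) ^ m\<bar>
        = norm ((Y / \<epsilon>) ^ m / Gamma (real m + \<nu> + 1)) * ((\<epsilon> * \<rho>) ^ m / fact m)"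
      using assms that
      by (simp add: abs_mult abs_bessel_coeff power_abs power_mult_distrib power_divide mult_ac)
    also have "\<dots> \<le> K * ((\<epsilon> * \<rho>) ^ m / fact m)"
      using K(2)[of m] assms that by (intro mult_right_mono) auto
    finally show ?thesis .
  qed
  thus ?thesis
    using K(1) by blast
qed

lemma bessel_series_summable:
  assumes "-1 < \<nu>"
  shows "summable (\<lambda>m. \<bar>bessel_coeff \<nu> m * y ^ m\<bar>)"
proof -
  obtain K where K: "\<And>\<rho> m. \<rho> \<ge> 0 \<Longrightarrow> \<bar>bessel_coeff \<nu> m * (\<rho> * y) ^ m\<bar> \<le> K * ((1 * \<rho>) ^ m / fact m)"
    using bessel_coeff_majorant[OF assms, of 1 y] by auto
  have "summable (\<lambda>m. K * ((1 * 1) ^ m / fact m))"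
    using summable_exp[of 1] by (intro summable_mult) (simp add: field_simps)
  thus ?thesis
    by (rule summable_comparison_test'[where N = 0]) (use K[of 1] in simp)
qed

lemma bessel_series_sums:
  assumes "-1 < \<nu>"
  shows "(\<lambda>m. bessel_coeff \<nu> m * y ^ m) sums bessel_E \<nu> y"
  unfolding bessel_E_def
  using summable_rabs_cancel[OF bessel_series_summable[OF assms]] by (rule summable_sums)

section \<open>Derivative and recurrence of the entire part\<close>

lemma diffs_bessel_coeff:
  "diffs (bessel_coeff \<nu>) m = - bessel_coeff (\<nu> + 1) m"
proof -
  have "real (Suc m) + \<nu> + 1 = real m + (\<nu> + 1) + 1"
    by simp
  thus ?thesis
    by (simp only: diffs_def bessel_coeff_def) (simp add: divide_simps del: of_nat_Suc)
qed

text \<open>Termwise differentiation raises the index. This is the classical rule that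
  \<open>x powr - \<nu>\<close> times the Bessel function of index \<open>\<nu>\<close> has as
  derivative minus \<open>x powr - \<nu>\<close> times the one of index
  \<open>\<nu> + 1\<close>.\<close>

lemma bessel_E_deriv:
  assumes "-1 < \<nu>"
  shows "(bessel_E \<nu> has_real_derivative - bessel_E (\<nu> + 1) y) (at y)"
proof -
  have "((\<lambda>x. \<Sum>m. bessel_coeff \<nu> m * x ^ m) has_real_derivative
      (\<Sum>m. diffs (bessel_coeff \<nu>) m * y ^ m)) (at y)"
    using bessel_series_sums[OF assms] by (intro termdiffs_strong_converges_everywhere)
      (auto simp: sums_iff)
  moreover have "(\<Sum>m. diffs (bessel_coeff \<nu>) m * y ^ m) = - bessel_E (\<nu> + 1) y"
    using sums_minus[OF bessel_series_sums[of "\<nu> + 1" y]] assms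
    by (simp add: diffs_bessel_coeff sums_iff)
  ultimately show ?thesis
    unfolding bessel_E_def[abs_def] by simp
qed

lemma bessel_E_chain [derivative_intros]:
  assumes "-1 < \<nu>" "(g has_real_derivative d) (at x within A)"
  shows "((\<lambda>x. bessel_E \<nu> (g x)) has_real_derivative - bessel_E (\<nu> + 1) (g x) * d) (at x within A)"
  using DERIV_chain2[OF bessel_E_deriv[OF assms(1)] assms(2)] by simp

text \<open>With \<open>bessel_E_deriv\<close> this is Bessel's equation for the entire part,
  \<open>y E'' + (\<nu> + 1) E' + E = 0\<close>; it removes every function of index
  \<open>\<nu> + 2\<close> from the derivative computations below.\<close>

lemma bessel_E_recurrence:
  assumes "-1 < \<nu>"
  shows "y * bessel_E (\<nu> + 2) y = (\<nu> + 1) * bessel_E (\<nu> + 1) y - bessel_E \<nu> y"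
proof -
  have "(\<lambda>m. (\<nu> + 1) * (bessel_coeff (\<nu> + 1) m * y ^ m) - bessel_coeff \<nu> m * y ^ m)
      sums ((\<nu> + 1) * bessel_E (\<nu> + 1) y - bessel_E \<nu> y)"
    using assms by (intro sums_diff sums_mult bessel_series_sums) auto
  moreover have "(\<lambda>m. (\<nu> + 1) * (bessel_coeff (\<nu> + 1) m * y ^ m) - bessel_coeff \<nu> m * y ^ m)
      sums (y * bessel_E (\<nu> + 2) y)"
  proof -
    have G0: "Gamma (\<nu> + 1 + 1) = (\<nu> + 1) * Gamma (\<nu> + 1)"
      using assms by (intro Gamma_shift) simp
    have "Gamma (\<nu> + 1) > 0"
      using assms by (intro Gamma_real_pos) simp
    \<comment> \<open>The constant terms cancel by the functional equation of \<open>Gamma\<close>,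
      which leaves room for the factor \<open>y\<close>.\<close>
    hence z: "(\<nu> + 1) * (bessel_coeff (\<nu> + 1) 0 * y ^ 0) - bessel_coeff \<nu> 0 * y ^ 0 = 0"
      using assms G0 by (simp add: bessel_coeff_def)
    have "(\<nu> + 1) * (bessel_coeff (\<nu> + 1) (Suc m) * y ^ Suc m) - bessel_coeff \<nu> (Suc m) * y ^ Suc m
       = y * (bessel_coeff (\<nu> + 2) m * y ^ m)" for m
    proof -
      have pos: "real m + \<nu> + 2 > 0" "Gamma (real m + \<nu> + 2) > 0"
        using assms by (auto intro!: Gamma_real_pos)
      have G: "Gamma (real m + \<nu> + 3) = (real m + \<nu> + 2) * Gamma (real m + \<nu> + 2)"
        using Gamma_shift[OF pos(1)] by (simp add: algebra_simps)
      have c: "bessel_coeff (\<nu> + 1) (Suc m) = - ((-1) ^ m / (fact m * real (Suc m) * Gamma (real m + \<nu> + 3)))"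
        "bessel_coeff \<nu> (Suc m) = - ((-1) ^ m / (fact m * real (Suc m) * Gamma (real m + \<nu> + 2)))"
        "bessel_coeff (\<nu> + 2) m = (-1) ^ m / (fact m * Gamma (real m + \<nu> + 3))"
        by (simp_all add: bessel_coeff_def algebra_simps)
      \<comment> \<open>Here \<open>F = fact m\<close>, \<open>S = m + 1\<close>,
        \<open>P = m + \<nu> + 2\<close> and \<open>X = Gamma P\<close>. Since
        \<open>P - (\<nu> + 1) = S\<close>, combining the two terms cancels the \<open>S\<close>
        contributed by \<open>fact (Suc m)\<close>.\<close>
      have alg: "(\<nu> + 1) * (- (w / (F * S * (P * X))) * (v * y)) - - (w / (F * S * X)) * (v * y)
          = y * (w / (F * (P * X)) * v)"
        if "F \<noteq> 0" "S \<noteq> 0" "P \<noteq> 0" "X \<noteq> 0" "P = \<nu> + 1 + S" for w F S P X v :: real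
      proof -
        have "- (\<nu> + 1) + P = S"
          using that by simp
        hence "(- (\<nu> + 1) + P) * (w * v * y / (F * S * P * X)) = S * (w * v * y / (F * S * P * X))"
          by simp
        thus ?thesis
          using that(1-4) by (simp add: field_simps)
      qed
      show ?thesis
        unfolding c G power_Suc2 using pos by (intro alg) (auto simp: less_imp_neq[THEN not_sym])
    qed
    hence "(\<lambda>m. (\<nu> + 1) * (bessel_coeff (\<nu> + 1) (Suc m) * y ^ Suc m) - bessel_coeff \<nu> (Suc m) * y ^ Suc m)
       sums (y * bessel_E (\<nu> + 2) y)"
      using sums_mult[OF bessel_series_sums[of "\<nu> + 2" y], of y] assms by simp
    from sums_Suc[OF this] show ?thesis
      using z by simp
  qed
  ultimately show ?thesis
    by (rule sums_unique2[symmetric])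
qed

lemma bessel_E_0: "bessel_E \<nu> 0 = 1 / Gamma (\<nu> + 1)"
  unfolding bessel_E_def powser_zero by (simp add: bessel_coeff_def)

lemma bessel_E_pos_near_0:
  assumes "-1 < \<nu>"
  shows "\<exists>\<delta>>0. \<forall>y. \<bar>y\<bar> < \<delta> \<longrightarrow> 0 < bessel_E \<nu> y"
proof -
  have "isCont (bessel_E \<nu>) 0"
    using bessel_E_deriv[OF assms] by (rule DERIV_isCont)
  moreover have "0 < bessel_E \<nu> 0"
    using assms by (simp add: bessel_E_0)
  ultimately have "eventually (\<lambda>y. 0 < bessel_E \<nu> y) (at 0)"
    using order_tendstoD(1)[of "bessel_E \<nu>" "bessel_E \<nu> 0" "at 0" 0] by (simp add: isCont_def)
  thus ?thesis
    using \<open>0 < bessel_E \<nu> 0\<close> unfolding eventually_at by (metis dist_0_norm real_norm_def dist_commute UNIV_I)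
qed

lemma bessel_J_eq:
  assumes "-1 < \<nu>" "0 < x"
  shows "bessel_J \<nu> x = (x / 2) powr \<nu> * bessel_E \<nu> (x\<^sup>2 / 4)"
proof -
  have "(-1) ^ m / (fact m * Gamma (real m + \<nu> + 1)) * (x / 2) powr (2 * real m + \<nu>)
      = (x / 2) powr \<nu> * (bessel_coeff \<nu> m * (x\<^sup>2 / 4) ^ m)" for m
  proof -
    have "(x / 2) powr (2 * real m + \<nu>) = (x / 2) ^ (2 * m) * (x / 2) powr \<nu>"
      using assms by (simp add: powr_add powr_realpow[symmetric])
    also have "(x / 2) ^ (2 * m) = (x\<^sup>2 / 4) ^ m"
      by (simp add: power_mult power_divide)
    finally show ?thesis
      by (simp add: bessel_coeff_def)
  qed
  thus ?thesis
    unfolding bessel_J_def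
    using sums_mult[OF bessel_series_sums[OF assms(1)], of "(x / 2) powr \<nu>"] by (simp add: sums_iff)
qed

lemma bessel_J_eq_0_iff:
  assumes "-1 < \<nu>" "0 < x"
  shows "bessel_J \<nu> x = 0 \<longleftrightarrow> bessel_E \<nu> (x\<^sup>2 / 4) = 0"
  using assms by (simp add: bessel_J_eq)

text \<open>Differentiating the power prefactor leaves a multiple of \<open>bessel_E \<nu>\<close>,
  which vanishes at a zero; so the constant in \<open>Phi\<close> is governed by
  \<open>bessel_E (\<nu> + 1)\<close>.\<close>

lemma deriv_bessel_J_at_zero:
  assumes "-1 < \<nu>" "0 < x" "bessel_J \<nu> x = 0"
  shows "deriv (bessel_J \<nu>) x = - ((x / 2) powr (\<nu> + 1) * bessel_E (\<nu> + 1) (x\<^sup>2 / 4))"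
proof (rule DERIV_imp_deriv)
  have z: "bessel_E \<nu> (x\<^sup>2 / 4) = 0"
    using assms by (simp add: bessel_J_eq_0_iff)
  have "((\<lambda>x. (x / 2) powr \<nu> * bessel_E \<nu> (x\<^sup>2 / 4)) has_real_derivative
      - ((x / 2) powr (\<nu> + 1) * bessel_E (\<nu> + 1) (x\<^sup>2 / 4))) (at x)"
    using assms z by (auto intro!: derivative_eq_intros simp: powr_add)
  thus "(bessel_J \<nu> has_real_derivative - ((x / 2) powr (\<nu> + 1) * bessel_E (\<nu> + 1) (x\<^sup>2 / 4))) (at x)"
    by (rule has_field_derivative_transform_within_open[where S = "{0<..}"])
      (use assms bessel_J_eq in auto)
qed

section \<open>Zeros of Bessel functions\<close>

text \<open>Comparison with \<open>sin (\<omega> * (x - a))\<close>: over one half period the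
  Wronskian \<open>W\<close> cannot increase because \<open>q\<close> is at least
  \<open>\<omega>^2\<close>, yet positivity of \<open>u\<close> makes \<open>W a\<close> negative
  and \<open>W b\<close> positive.\<close>

lemma sturm_no_positive_solution:
  fixes u u' q :: "real \<Rightarrow> real"
  assumes u: "\<And>x. a \<le> x \<Longrightarrow> (u has_real_derivative u' x) (at x)"
    and u': "\<And>x. a \<le> x \<Longrightarrow> (u' has_real_derivative - q x * u x) (at x)"
    and q: "\<And>x. a \<le> x \<Longrightarrow> \<omega>\<^sup>2 \<le> q x" and \<omega>: "0 < \<omega>"
    and pos: "\<And>x. a \<le> x \<Longrightarrow> x \<le> a + pi / \<omega> \<Longrightarrow> 0 < u x"
  shows False
proof -
  define b where "b = a + pi / \<omega>"
  have b: "a \<le> b" "\<omega> * (b - a) = pi"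
    using \<omega> by (auto simp: b_def)
  define W where "W x = u' x * sin (\<omega> * (x - a)) - u x * (\<omega> * cos (\<omega> * (x - a)))" for x
  have "W b \<le> W a"
  proof (rule DERIV_nonpos_imp_nonincreasing[OF b(1)])
    fix x assume x: "a \<le> x" "x \<le> b"
    have "(W has_real_derivative (\<omega>\<^sup>2 - q x) * u x * sin (\<omega> * (x - a))) (at x)"
      unfolding W_def using x(1)
      by (auto intro!: derivative_eq_intros u u' simp: algebra_simps power2_eq_square)
    moreover have "0 \<le> sin (\<omega> * (x - a))"
    proof (rule sin_ge_zero)
      have "\<omega> * (x - a) \<le> \<omega> * (b - a)"
        using x \<omega> by (intro mult_left_mono) auto
      thus "\<omega> * (x - a) \<le> pi"
        using b by simp
    qed (use x \<omega> in auto)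
    hence "(\<omega>\<^sup>2 - q x) * u x * sin (\<omega> * (x - a)) \<le> 0"
      using q[of x] pos[of x] x b_def by (intro mult_nonpos_nonneg) auto
    ultimately show "\<exists>y. (W has_real_derivative y) (at x) \<and> y \<le> 0"
      by blast
  qed
  moreover have "W b = \<omega> * u b" "W a = - \<omega> * u a"
    unfolding W_def b(2) by simp_all
  moreover have "0 < u b" "0 < u a"
    using b(1) by (auto intro!: pos simp: b_def)
  hence "0 < \<omega> * u b" "0 < \<omega> * u a"
    using \<omega> by simp_all
  ultimately show False
    by simp
qed

lemma sturm_zero_exists:
  fixes u u' q :: "real \<Rightarrow> real"
  assumes u: "\<And>x. a \<le> x \<Longrightarrow> (u has_real_derivative u' x) (at x)"
    and u': "\<And>x. a \<le> x \<Longrightarrow> (u' has_real_derivative - q x * u x) (at x)"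
    and q: "\<And>x. a \<le> x \<Longrightarrow> \<omega>\<^sup>2 \<le> q x" and \<omega>: "0 < \<omega>"
  shows "\<exists>x\<ge>a. u x = 0"
proof (rule ccontr)
  assume "\<not> ?thesis"
  hence nz: "\<And>x. a \<le> x \<Longrightarrow> u x \<noteq> 0"
    by simp
  have cont: "continuous_on {a..x} u" for x
    by (rule DERIV_continuous_on[where D = u'], rule has_field_derivative_at_within, rule u) simp
  have same: "sgn (u x) = sgn (u a)" if "a \<le> x" for x
  proof (rule ccontr)
    assume "sgn (u x) \<noteq> sgn (u a)"
    hence "(u a \<le> 0 \<and> 0 \<le> u x) \<or> (u x \<le> 0 \<and> 0 \<le> u a)"
      by (auto simp: sgn_if split: if_splits)
    hence "\<exists>y\<ge>a. y \<le> x \<and> u y = 0"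
      using IVT'[of u a 0 x, OF _ _ that cont] IVT2'[of u x 0 a, OF _ _ that cont] by auto
    thus False
      using nz by auto
  qed
  have sgn: "0 < sgn (u a) * u x" if "a \<le> x" for x
    unfolding same[OF that, symmetric] using nz[OF that] by (simp add: sgn_if)
  \<comment> \<open>Without zeros \<open>u\<close> keeps its sign, and by linearity of the equation
    \<open>sgn (u a) * u\<close> is a positive solution.\<close>
  show False
  proof (rule sturm_no_positive_solution[where a = a and u = "\<lambda>x. sgn (u a) * u x"
        and u' = "\<lambda>x. sgn (u a) * u' x" and q = q, OF _ _ q \<omega> sgn])
    show "((\<lambda>x. sgn (u a) * u' x) has_real_derivative - q x * (sgn (u a) * u x)) (at x)"
      if "a \<le> x" for x
      using DERIV_cmult[OF u'[OF that], of "sgn (u a)"] by (simp add: mult_ac)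
  qed (auto intro!: DERIV_cmult u)
qed

text \<open>At a maximum \<open>c\<close> of \<open>\<bar>u\<bar>\<close> the slope vanishes.
  Integrating the equation twice from \<open>c\<close> to \<open>b\<close> gives
  \<open>\<bar>u c\<bar> \<le> Q * \<bar>u c\<bar> * (b - a)^2\<close>, and
  \<open>\<bar>u c\<bar>\<close> cancels. The nonzero slope at \<open>a\<close> excludes
  \<open>u = 0\<close> throughout.\<close>

lemma sturm_zero_gap:
  fixes u u' q :: "real \<Rightarrow> real"
  assumes ab: "a < b" "u a = 0" "u b = 0" "u' a \<noteq> 0"
    and u: "\<And>x. a \<le> x \<Longrightarrow> x \<le> b \<Longrightarrow> (u has_real_derivative u' x) (at x)"
    and u': "\<And>x. a \<le> x \<Longrightarrow> x \<le> b \<Longrightarrow> (u' has_real_derivative - q x * u x) (at x)"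
    and q: "\<And>x. a \<le> x \<Longrightarrow> x \<le> b \<Longrightarrow> \<bar>q x\<bar> \<le> Q"
  shows "1 \<le> Q * (b - a)\<^sup>2"
proof -
  have "continuous_on {a..b} (\<lambda>x. \<bar>u x\<bar>)"
    by (rule continuous_on_rabs, rule DERIV_continuous_on[where D = u'],
        rule has_field_derivative_at_within, rule u) simp_all
  then obtain c where c: "c \<in> {a..b}" "\<And>x. x \<in> {a..b} \<Longrightarrow> \<bar>u x\<bar> \<le> \<bar>u c\<bar>"
    using continuous_attains_sup[of "{a..b}" "\<lambda>x. \<bar>u x\<bar>"] ab by auto
  have "u c \<noteq> 0"
  proof
    assume "u c = 0"
    hence z: "u x = 0" if "x \<in> {a..b}" for x
      using c(2)[OF that] by simp
    have "\<exists>d>0. \<forall>h>0. h < d \<longrightarrow> u (a + h) \<noteq> 0"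
    proof (cases "0 < u' a")
      case True
      thus ?thesis
        using DERIV_pos_inc_right[OF u[of a] True] ab by force
    next
      case False
      thus ?thesis
        using DERIV_neg_dec_right[OF u[of a]] ab by force
    qed
    then obtain d where d: "d > 0" "\<And>h. 0 < h \<Longrightarrow> h < d \<Longrightarrow> u (a + h) \<noteq> 0"
      by blast
    have "u (a + min (d / 2) (b - a)) = 0"
      using d(1) ab by (intro z) auto
    thus False
      using d(2)[of "min (d / 2) (b - a)"] d(1) ab by auto
  qed
  hence ac: "a < c" "c < b"
    using c(1) ab by (auto simp: order_less_le)
  hence uc': "u' c = 0"
  proof -
    \<comment> \<open>The factor \<open>sgn (u c)\<close> turns the extremum of \<open>u\<close>
      into a local maximum, the form \<open>DERIV_local_max\<close> expects.\<close>
    have "u y * sgn (u c) \<le> u c * sgn (u c)" if "\<bar>c - y\<bar> < min (c - a) (b - c)" for y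
    proof -
      have "y \<in> {a..b}"
        using that by auto
      moreover have "u y * sgn (u c) \<le> \<bar>u y\<bar>" "u c * sgn (u c) = \<bar>u c\<bar>"
        by (auto simp: sgn_if)
      ultimately show ?thesis
        using c(2)[of y] by linarith
    qed
    moreover have "((\<lambda>x. u x * sgn (u c)) has_real_derivative u' c * sgn (u c)) (at c)"
      using u[of c] ac by (intro DERIV_cmult_right) auto
    moreover have "0 < min (c - a) (b - c)"
      using ac by simp
    ultimately have "u' c * sgn (u c) = 0"
      by (intro DERIV_local_max[where f = "\<lambda>x. u x * sgn (u c)"
          and d = "min (c - a) (b - c)" and x = c]) auto
    thus ?thesis
      using \<open>u c \<noteq> 0\<close> by (simp add: sgn_zero_iff)
  qed
  have Q: "0 \<le> Q"
    by (rule order_trans[OF abs_ge_zero q[of a]]) (use ab(1) in simp_all)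
  have u'_bound: "\<bar>u' x\<bar> \<le> Q * \<bar>u c\<bar> * (b - a)" if "c \<le> x" "x \<le> b" for x
  proof -
    have "norm (u' x - u' c) \<le> Q * \<bar>u c\<bar> * norm (x - c)"
    proof (rule field_differentiable_bound[where S = "{c..b}" and f = u' and f' = "\<lambda>x. - q x * u x"])
      fix z assume z: "z \<in> {c..b}"
      show "(u' has_real_derivative - q z * u z) (at z within {c..b})"
        by (rule has_field_derivative_at_within, rule u') (use z ac in simp_all)
      show "norm (- q z * u z) \<le> Q * \<bar>u c\<bar>"
        unfolding real_norm_def abs_mult abs_minus_cancel
        by (intro mult_mono q c(2) Q abs_ge_zero) (use z ac in simp_all)
    qed (use that in auto)
    also have "\<dots> \<le> Q * \<bar>u c\<bar> * (b - a)"
      using that ac Q by (intro mult_left_mono) auto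
    finally show ?thesis
      using uc' by simp
  qed
  have "norm (u b - u c) \<le> Q * \<bar>u c\<bar> * (b - a) * norm (b - c)"
  proof (rule field_differentiable_bound[where S = "{c..b}" and f = u and f' = u'])
    fix z assume z: "z \<in> {c..b}"
    show "(u has_real_derivative u' z) (at z within {c..b})"
      by (rule has_field_derivative_at_within, rule u) (use z ac in simp_all)
    show "norm (u' z) \<le> Q * \<bar>u c\<bar> * (b - a)"
      using u'_bound[of z] z by simp
  qed (use ac in auto)
  also have "\<dots> \<le> Q * \<bar>u c\<bar> * (b - a) * (b - a)"
    using ac Q ab by (intro mult_left_mono) auto
  finally have "\<bar>u c\<bar> * 1 \<le> \<bar>u c\<bar> * (Q * (b - a)\<^sup>2)"
    using ab by (simp add: power2_eq_square mult_ac)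
  thus ?thesis
    using \<open>u c \<noteq> 0\<close> mult_le_cancel_left_pos[of "\<bar>u c\<bar>" 1 "Q * (b - a)\<^sup>2"] by simp
qed

text \<open>Lommel's integral of \<open>t J(t)^2\<close> in the variable \<open>y = t^2 / 4\<close>,
  where \<open>J(t)^2 t dt\<close> becomes \<open>2 y^\<nu> E(y)^2 dy\<close>, rescaled by
  \<open>a\<close>. At \<open>y = 1\<close> with \<open>a\<close> a zero of
  \<open>bessel_E \<nu>\<close>, only the first summand survives.\<close>

lemma bessel_E_norm_primitive:
  assumes "-1 < \<nu>" "0 < y"
  shows "((\<lambda>y. y powr (\<nu> + 1) * (a * y * (bessel_E (\<nu> + 1) (a * y))\<^sup>2 + (bessel_E \<nu> (a * y))\<^sup>2
            - \<nu> * bessel_E \<nu> (a * y) * bessel_E (\<nu> + 1) (a * y)))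
    has_real_derivative y powr \<nu> * (bessel_E \<nu> (a * y))\<^sup>2) (at y)"
proof -
  have rec: "a * y * bessel_E (\<nu> + 1 + 1) (a * y) = (\<nu> + 1) * bessel_E (\<nu> + 1) (a * y) - bessel_E \<nu> (a * y)"
    using bessel_E_recurrence[OF assms(1), of "a * y"] by (simp add: algebra_simps)
  \<comment> \<open>\<open>A\<close>, \<open>B\<close>, \<open>C\<close> stand for the functions of
    index \<open>\<nu>\<close>, \<open>\<nu> + 1\<close>, \<open>\<nu> + 2\<close> at
    \<open>a * y\<close>, and \<open>R\<close> for \<open>y powr \<nu>\<close>; the recurrence
    removes \<open>C\<close>.\<close>
  have alg: "(\<nu> + 1) * R * (a * y * B\<^sup>2 + A\<^sup>2 - \<nu> * A * B)
      + (R * y) * (a * B\<^sup>2 + a * y * (2 * B * (- C * a)) + 2 * A * (- B * a)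
          - \<nu> * ((- B * a) * B + A * (- C * a))) = R * A\<^sup>2"
    if "a * y * C = (\<nu> + 1) * B - A" for A B C R
  proof -
    have "(\<nu> + 1) * R * (a * y * B\<^sup>2 + A\<^sup>2 - \<nu> * A * B)
      + (R * y) * (a * B\<^sup>2 + a * y * (2 * B * (- C * a)) + 2 * A * (- B * a)
          - \<nu> * ((- B * a) * B + A * (- C * a)))
      = (\<nu> + 1) * R * (a * y * B\<^sup>2 + A\<^sup>2 - \<nu> * A * B)
      + R * (a * y * B\<^sup>2 - 2 * B * (a * y * (a * y * C)) - 2 * a * y * A * B
          + \<nu> * a * y * B\<^sup>2 + \<nu> * A * (a * y * C))"
      by (simp add: algebra_simps power2_eq_square)
    also have "\<dots> = R * A\<^sup>2"
      unfolding that by (simp add: algebra_simps power2_eq_square)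
    finally show ?thesis .
  qed
  show ?thesis
    by (rule derivative_eq_intros refl assms | (use assms in simp; fail))+
      (use alg[OF rec, of "y powr \<nu>"] assms in \<open>simp add: powr_add algebra_simps power2_eq_square\<close>)
qed

text \<open>The primitive is \<open>y powr (\<nu> + 1)\<close> times the Wronskian of
  \<open>E(a y)\<close> and \<open>E(b y)\<close>, which solve
  \<open>(y^(\<nu>+1) u')' + a y^\<nu> u = 0\<close> and the same equation with
  \<open>b\<close>.\<close>

lemma bessel_E_orthogonality_primitive:
  assumes "-1 < \<nu>" "0 < y"
  shows "((\<lambda>y. y powr (\<nu> + 1) * (b * bessel_E \<nu> (a * y) * bessel_E (\<nu> + 1) (b * y)
            - a * bessel_E (\<nu> + 1) (a * y) * bessel_E \<nu> (b * y)))
    has_real_derivative (b - a) * (y powr \<nu> * (bessel_E \<nu> (a * y) * bessel_E \<nu> (b * y)))) (at y)"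
proof -
  have rec: "a * y * bessel_E (\<nu> + 1 + 1) (a * y) = (\<nu> + 1) * bessel_E (\<nu> + 1) (a * y) - bessel_E \<nu> (a * y)" for a
    using bessel_E_recurrence[OF assms(1), of "a * y"] by (simp add: algebra_simps)
  have alg: "(\<nu> + 1) * R * (b * A * B' - a * A' * B)
      + (R * y) * (b * ((- A' * a) * B' + A * (- B'' * b)) - a * ((- A'' * a) * B + A' * (- B' * b)))
      = (b - a) * (R * (A * B))"
    if "a * y * A'' = (\<nu> + 1) * A' - A" "b * y * B'' = (\<nu> + 1) * B' - B" for A A' A'' B B' B'' R
  proof -
    have "(\<nu> + 1) * R * (b * A * B' - a * A' * B)
      + (R * y) * (b * ((- A' * a) * B' + A * (- B'' * b)) - a * ((- A'' * a) * B + A' * (- B' * b)))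
      = (\<nu> + 1) * R * (b * A * B' - a * A' * B) + R * (a * B * (a * y * A'') - b * A * (b * y * B''))"
      by (simp add: algebra_simps)
    also have "\<dots> = (b - a) * (R * (A * B))"
      unfolding that by (simp add: algebra_simps)
    finally show ?thesis .
  qed
  show ?thesis
    by (rule derivative_eq_intros refl assms | (use assms in simp; fail))+
      (use alg[OF rec rec, of "y powr \<nu>"] assms in \<open>simp add: powr_add algebra_simps\<close>)
qed

lemma bessel_E_continuous [continuous_intros]:
  assumes "-1 < \<nu>" "continuous_on A g"
  shows "continuous_on A (\<lambda>x. bessel_E \<nu> (g x))"
proof -
  have "continuous_on UNIV (bessel_E \<nu>)"
    by (rule DERIV_continuous_on, rule has_field_derivative_at_within, rule bessel_E_deriv[OF assms(1)])
  thus ?thesis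
    using continuous_on_compose2 assms(2) by blast
qed

text \<open>The primitive vanishes at \<open>0\<close>, is strictly larger at \<open>1\<close>, and at a zero of \<open>E\<^sub>\<nu>\<close> its value
  at \<open>1\<close> is a multiple of the squared derivative.\<close>

lemma bessel_E_zeros_simple:
  assumes "-1 < \<nu>" "0 < a" "bessel_E \<nu> a = 0"
  shows "bessel_E (\<nu> + 1) a \<noteq> 0"
proof
  assume z: "bessel_E (\<nu> + 1) a = 0"
  define P where "P y = y powr (\<nu> + 1) * (a * y * (bessel_E (\<nu> + 1) (a * y))\<^sup>2 + (bessel_E \<nu> (a * y))\<^sup>2
            - \<nu> * bessel_E \<nu> (a * y) * bessel_E (\<nu> + 1) (a * y))" for y
  have cont: "continuous_on {0..1} P"
    unfolding P_def using assms by (intro continuous_intros continuous_on_powr') auto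
  have D: "(P has_real_derivative y powr \<nu> * (bessel_E \<nu> (a * y))\<^sup>2) (at y)" if "0 < y" for y
    unfolding P_def using bessel_E_norm_primitive[OF assms(1) that] .
  obtain \<delta> where \<delta>: "0 < \<delta>" "\<And>y. \<bar>y\<bar> < \<delta> \<Longrightarrow> 0 < bessel_E \<nu> y"
    using bessel_E_pos_near_0[OF assms(1)] by blast
  \<comment> \<open>On \<open>(0, d)\<close> the argument \<open>a * y\<close> stays below
    \<open>\<delta>\<close>, so \<open>P\<close> has strictly positive derivative there; beyond
    \<open>d\<close> the derivative is merely nonnegative.\<close>
  define d where "d = min 1 (\<delta> / a)"
  have d: "0 < d" "d \<le> 1"
    using \<delta> assms by (auto simp: d_def)
  have "P 0 < P d"
  proof (rule DERIV_pos_imp_increasing_open[OF d(1)])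
    fix y assume y: "0 < y" "y < d"
    have "a * y < \<delta>"
      using y assms by (auto simp: d_def field_simps)
    hence "0 < bessel_E \<nu> (a * y)"
      using y assms \<delta>(2)[of "a * y"] by simp
    thus "\<exists>z. (P has_real_derivative z) (at y) \<and> 0 < z"
      using D[OF y(1)] y by (intro exI[of _ "y powr \<nu> * (bessel_E \<nu> (a * y))\<^sup>2"]) auto
  qed (use continuous_on_subset[OF cont] d in auto)
  moreover have "P d \<le> P 1"
  proof (rule DERIV_nonneg_imp_nondecreasing[OF d(2)])
    fix y assume y: "d \<le> y" "y \<le> 1"
    show "\<exists>z. (P has_real_derivative z) (at y) \<and> 0 \<le> z"
      using D[of y] y d by (intro exI[of _ "y powr \<nu> * (bessel_E \<nu> (a * y))\<^sup>2"]) auto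
  qed
  moreover have "P 0 = 0" "P 1 = 0"
    using assms z by (auto simp: P_def)
  ultimately show False
    by simp
qed

section \<open>Liouville normal form: oscillation and spacing of the zeros\<close>

text \<open>\<open>u(x) = 2\<^bsup>\<nu>\<^esup> x\<^bsup>1/2\<^esup> J\<^sub>\<nu>(x)\<close> satisfies \<open>u'' + q u = 0\<close> with \<open>q \<rightarrow> 1\<close> at infinity.\<close>

definition liouville_u :: "real \<Rightarrow> real \<Rightarrow> real" where
  "liouville_u \<nu> x = x powr (\<nu> + 1 / 2) * bessel_E \<nu> (x\<^sup>2 / 4)"

definition liouville_u' :: "real \<Rightarrow> real \<Rightarrow> real" where
  "liouville_u' \<nu> x = x powr (\<nu> + 1 / 2) *
     ((\<nu> + 1 / 2) / x * bessel_E \<nu> (x\<^sup>2 / 4) - x / 2 * bessel_E (\<nu> + 1) (x\<^sup>2 / 4))"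

definition liouville_q :: "real \<Rightarrow> real \<Rightarrow> real" where
  "liouville_q \<nu> x = 1 - (\<nu>\<^sup>2 - 1 / 4) / x\<^sup>2"

lemma liouville_u_deriv:
  assumes "-1 < \<nu>" "0 < x"
  shows "(liouville_u \<nu> has_real_derivative liouville_u' \<nu> x) (at x)"
proof -
  have R: "x powr (\<nu> - 1 / 2) = x powr (\<nu> + 1 / 2) / x"
    using assms powr_diff[of x "\<nu> + 1 / 2" 1] by simp
  have "(liouville_u \<nu> has_real_derivative
      (\<nu> + 1 / 2) * (x powr (\<nu> + 1 / 2) / x) * bessel_E \<nu> (x\<^sup>2 / 4)
      + x powr (\<nu> + 1 / 2) * (- bessel_E (\<nu> + 1) (x\<^sup>2 / 4) * (x / 2))) (at x)"
    unfolding liouville_u_def[abs_def] using assms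
    by (auto intro!: derivative_eq_intros simp: R power2_eq_square)
  thus ?thesis
    by (simp add: liouville_u'_def algebra_simps)
qed

lemma liouville_u'_deriv:
  assumes "-1 < \<nu>" "0 < x"
  shows "(liouville_u' \<nu> has_real_derivative - liouville_q \<nu> x * liouville_u \<nu> x) (at x)"
proof -
  have R: "x powr (\<nu> - 1 / 2) = x powr (\<nu> + 1 / 2) / x"
    using assms powr_diff[of x "\<nu> + 1 / 2" 1] by simp
  have rec: "x\<^sup>2 * bessel_E (\<nu> + 1 + 1) (x\<^sup>2 / 4)
      = 4 * ((\<nu> + 1) * bessel_E (\<nu> + 1) (x\<^sup>2 / 4) - bessel_E \<nu> (x\<^sup>2 / 4))"
    using bessel_E_recurrence[OF assms(1), of "x\<^sup>2 / 4"] by (simp add: algebra_simps)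
  \<comment> \<open>\<open>A\<close>, \<open>B\<close>, \<open>C\<close> stand for the functions of
    index \<open>\<nu>\<close>, \<open>\<nu> + 1\<close>, \<open>\<nu> + 2\<close> at
    \<open>x^2 / 4\<close>, and \<open>R\<close> for the power of \<open>x\<close>; eliminating
    \<open>C\<close> also cancels the terms in \<open>B\<close>.\<close>
  have alg: "(\<nu> + 1 / 2) * (R / x) * ((\<nu> + 1 / 2) / x * A - x / 2 * B)
      + R * (- (\<nu> + 1 / 2) / x\<^sup>2 * A + (\<nu> + 1 / 2) / x * (- B * (x / 2)) - 1 / 2 * B - x / 2 * (- C * (x / 2)))
      = - (1 - (\<nu>\<^sup>2 - 1 / 4) / x\<^sup>2) * (R * A)"
    if "x\<^sup>2 * C = 4 * ((\<nu> + 1) * B - A)" for A B C R :: real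
  proof -
    have "(\<nu> + 1 / 2) * (R / x) * ((\<nu> + 1 / 2) / x * A - x / 2 * B)
      + R * (- (\<nu> + 1 / 2) / x\<^sup>2 * A + (\<nu> + 1 / 2) / x * (- B * (x / 2)) - 1 / 2 * B - x / 2 * (- C * (x / 2)))
      = R * ((\<nu>\<^sup>2 - 1 / 4) / x\<^sup>2 * A - (\<nu> + 1) * B + (x\<^sup>2 * C) / 4)"
      using assms by (simp add: field_simps power2_eq_square)
    also have "\<dots> = - (1 - (\<nu>\<^sup>2 - 1 / 4) / x\<^sup>2) * (R * A)"
      unfolding that by (simp add: diff_divide_distrib algebra_simps)
    finally show ?thesis .
  qed
  have D: "((\<lambda>x. (\<nu> + 1 / 2) / x * bessel_E \<nu> (x\<^sup>2 / 4) - x / 2 * bessel_E (\<nu> + 1) (x\<^sup>2 / 4)) has_real_derivative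
      - (\<nu> + 1 / 2) / x\<^sup>2 * bessel_E \<nu> (x\<^sup>2 / 4)
          + (\<nu> + 1 / 2) / x * (- bessel_E (\<nu> + 1) (x\<^sup>2 / 4) * (x / 2))
          - 1 / 2 * bessel_E (\<nu> + 1) (x\<^sup>2 / 4) - x / 2 * (- bessel_E (\<nu> + 1 + 1) (x\<^sup>2 / 4) * (x / 2))) (at x)"
    using assms by (auto intro!: derivative_eq_intros simp: field_simps power2_eq_square)
  have "((\<lambda>x. x powr (\<nu> + 1 / 2)) has_real_derivative (\<nu> + 1 / 2) * (x powr (\<nu> + 1 / 2) / x)) (at x)"
    using assms by (auto intro!: derivative_eq_intros simp: R)
  from DERIV_mult[OF this D] have "(liouville_u' \<nu> has_real_derivative
      (\<nu> + 1 / 2) * (x powr (\<nu> + 1 / 2) / x) * ((\<nu> + 1 / 2) / x * bessel_E \<nu> (x\<^sup>2 / 4) - x / 2 * bessel_E (\<nu> + 1) (x\<^sup>2 / 4))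
      + x powr (\<nu> + 1 / 2) * (- (\<nu> + 1 / 2) / x\<^sup>2 * bessel_E \<nu> (x\<^sup>2 / 4)
          + (\<nu> + 1 / 2) / x * (- bessel_E (\<nu> + 1) (x\<^sup>2 / 4) * (x / 2))
          - 1 / 2 * bessel_E (\<nu> + 1) (x\<^sup>2 / 4) - x / 2 * (- bessel_E (\<nu> + 1 + 1) (x\<^sup>2 / 4) * (x / 2)))) (at x)"
    unfolding liouville_u'_def[abs_def] by (simp add: mult.commute add.commute)
  thus ?thesis
    unfolding alg[OF rec] liouville_q_def liouville_u_def .
qed

lemma liouville_u_eq_0_iff:
  assumes "-1 < \<nu>" "0 < x"
  shows "liouville_u \<nu> x = 0 \<longleftrightarrow> bessel_J \<nu> x = 0"
  using assms by (simp add: liouville_u_def bessel_J_eq_0_iff)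

text \<open>Only the term of index \<open>\<nu> + 1\<close> survives, so the slope of
  \<open>liouville_u\<close> carries the same information as the normalising constant of
  \<open>Phi\<close>; it is nonzero because the zeros are simple.\<close>

lemma liouville_u'_at_zero:
  assumes "-1 < \<nu>" "0 < x" "bessel_J \<nu> x = 0"
  shows "liouville_u' \<nu> x = - (x powr (\<nu> + 3 / 2) / 2 * bessel_E (\<nu> + 1) (x\<^sup>2 / 4))"
    and "liouville_u' \<nu> x \<noteq> 0"
proof -
  have E: "bessel_E \<nu> (x\<^sup>2 / 4) = 0"
    using assms by (simp add: bessel_J_eq_0_iff)
  have "x powr (\<nu> + 3 / 2) = x powr (\<nu> + 1 / 2) * x"
    using assms powr_add[of x "\<nu> + 1 / 2" 1] by (simp add: add.commute)
  with E show *: "liouville_u' \<nu> x = - (x powr (\<nu> + 3 / 2) / 2 * bessel_E (\<nu> + 1) (x\<^sup>2 / 4))"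
    by (simp add: liouville_u'_def)
  show "liouville_u' \<nu> x \<noteq> 0"
    unfolding * using bessel_E_zeros_simple[OF assms(1) _ E] assms by simp
qed

lemma bessel_J_zero_beyond:
  assumes "-1 < \<nu>"
  shows "\<exists>x\<ge>a. 0 < x \<and> bessel_J \<nu> x = 0"
proof -
  \<comment> \<open>Beyond \<open>b\<close> one has
    \<open>2 * (\<nu>^2 - 1 / 4) \<le> x \<le> x^2\<close>, hence \<open>liouville_q \<nu> x\<close>
    is at least \<open>1 / 2\<close>, which exceeds the square of the comparison frequency
    \<open>1 / 2\<close>.\<close>
  define b where "b = max 1 (max a (2 * \<bar>\<nu>\<^sup>2 - 1 / 4\<bar>))"
  have b: "1 \<le> b" "a \<le> b" "2 * \<bar>\<nu>\<^sup>2 - 1 / 4\<bar> \<le> b"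
    by (auto simp: b_def)
  have q: "(1 / 2)\<^sup>2 \<le> liouville_q \<nu> x" if "b \<le> x" for x
  proof -
    define m where "m = \<nu>\<^sup>2 - 1 / 4"
    have "x \<le> x\<^sup>2"
      using b that by (auto intro: self_le_power)
    hence "2 * m \<le> x\<^sup>2"
      using b that unfolding m_def[symmetric] by linarith
    hence "m / x\<^sup>2 \<le> 1 / 2"
      using b that by (subst pos_divide_le_eq) auto
    moreover have "(1 / 2)\<^sup>2 = (1 / 4 :: real)"
      by (simp add: power2_eq_square)
    ultimately show ?thesis
      unfolding liouville_q_def m_def[symmetric] by linarith
  qed
  have "\<exists>x\<ge>b. liouville_u \<nu> x = 0"
  proof (rule sturm_zero_exists)
    fix x assume "b \<le> x"
    hence "0 < x"
      using b by simp
    thus "(liouville_u \<nu> has_real_derivative liouville_u' \<nu> x) (at x)"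
      "(liouville_u' \<nu> has_real_derivative - liouville_q \<nu> x * liouville_u \<nu> x) (at x)"
      using liouville_u_deriv[OF assms] liouville_u'_deriv[OF assms] by blast+
  qed (use q in auto)
  then obtain x where "b \<le> x" "liouville_u \<nu> x = 0"
    by blast
  moreover from this have "0 < x" "a \<le> x"
    using b by auto
  ultimately show ?thesis
    using liouville_u_eq_0_iff[OF assms] by blast
qed

lemma bessel_J_no_zeros_near_0:
  assumes "-1 < \<nu>"
  shows "\<exists>\<delta>>0. \<forall>x. 0 < x \<and> bessel_J \<nu> x = 0 \<longrightarrow> \<delta> \<le> x"
proof -
  obtain \<delta> where \<delta>: "0 < \<delta>" "\<And>y. \<bar>y\<bar> < \<delta> \<Longrightarrow> 0 < bessel_E \<nu> y"
    using bessel_E_pos_near_0[OF assms(1)] by blast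
  have "min 1 \<delta> \<le> x" if x: "0 < x" "bessel_J \<nu> x = 0" for x
  proof (rule ccontr)
    assume "\<not> min 1 \<delta> \<le> x"
    hence "x * x < 1 * \<delta>"
      using x by (intro mult_strict_mono) auto
    hence "0 < bessel_E \<nu> (x\<^sup>2 / 4)"
      using x \<delta>(1) by (intro \<delta>(2)) (auto simp: power2_eq_square)
    thus False
      using x assms by (simp add: bessel_J_eq_0_iff)
  qed
  thus ?thesis
    using \<delta>(1) by (intro exI[of _ "min 1 \<delta>"]) auto
qed

text \<open>The potential \<open>liouville_q\<close> may blow up at \<open>0\<close>, but all zeros
  stay above some \<open>\<delta>\<close>, and on that range one constant \<open>Q\<close> bounds
  it; \<open>sturm_zero_gap\<close> turns \<open>Q\<close> into the spacing
  \<open>1 / sqrt Q\<close>.\<close>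

lemma bessel_J_zero_gap:
  assumes "-1 < \<nu>"
  shows "\<exists>d>0. \<forall>x y. 0 < x \<and> x < y \<and> bessel_J \<nu> x = 0 \<and> bessel_J \<nu> y = 0 \<longrightarrow> d \<le> y - x"
proof -
  obtain \<delta> where \<delta>: "0 < \<delta>" "\<And>x. 0 < x \<Longrightarrow> bessel_J \<nu> x = 0 \<Longrightarrow> \<delta> \<le> x"
    using bessel_J_no_zeros_near_0[OF assms] by blast
  define Q where "Q = 1 + \<bar>\<nu>\<^sup>2 - 1 / 4\<bar> / \<delta>\<^sup>2"
  have Q: "0 < Q"
    by (auto simp: Q_def add_pos_nonneg)
  have "1 / sqrt Q \<le> y - x" if xy: "0 < x" "x < y" "bessel_J \<nu> x = 0" "bessel_J \<nu> y = 0" for x y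
  proof -
    have "1 \<le> Q * (y - x)\<^sup>2"
    proof (rule sturm_zero_gap)
      show "liouville_u \<nu> x = 0" "liouville_u \<nu> y = 0" "liouville_u' \<nu> x \<noteq> 0"
        using xy assms liouville_u'_at_zero by (auto simp: liouville_u_eq_0_iff)
      show "\<bar>liouville_q \<nu> t\<bar> \<le> Q" if t: "x \<le> t" "t \<le> y" for t
      proof -
        have "\<bar>\<nu>\<^sup>2 - 1 / 4\<bar> / t\<^sup>2 \<le> \<bar>\<nu>\<^sup>2 - 1 / 4\<bar> / \<delta>\<^sup>2"
          using \<delta>(2)[of x] \<delta>(1) xy t by (intro divide_left_mono power_mono) auto
        moreover have "\<bar>liouville_q \<nu> t\<bar> \<le> 1 + \<bar>(\<nu>\<^sup>2 - 1 / 4) / t\<^sup>2\<bar>"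
          unfolding liouville_q_def by linarith
        ultimately show ?thesis
          unfolding Q_def abs_divide by simp
      qed
    next
      fix t assume "x \<le> t"
      hence "0 < t"
        using xy by simp
      thus "(liouville_u \<nu> has_real_derivative liouville_u' \<nu> t) (at t)"
        "(liouville_u' \<nu> has_real_derivative - liouville_q \<nu> t * liouville_u \<nu> t) (at t)"
        using liouville_u_deriv[OF assms] liouville_u'_deriv[OF assms] by blast+
    qed (use xy in auto)
    hence "(1 / sqrt Q)\<^sup>2 \<le> (y - x)\<^sup>2"
      using Q by (simp add: power_divide field_simps)
    thus ?thesis
      using xy Q by (simp add: power2_le_iff_abs_le)
  qed
  thus ?thesis
    using Q by (intro exI[of _ "1 / sqrt Q"]) auto
qed

text \<open>Zeros with gaps of at least \<open>d\<close> lie in different cells of the grid \<open>d\<int>\<close>, so they are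
  enumerated by the natural numbers.\<close>

lemma strict_mono_enumeration:
  fixes Z :: "real set"
  assumes inf: "\<And>a. \<exists>x\<in>Z. a \<le> x" and d: "0 < d"
    and gap: "\<And>x y. x \<in> Z \<Longrightarrow> y \<in> Z \<Longrightarrow> x < y \<Longrightarrow> d \<le> y - x" and pos: "\<And>x. x \<in> Z \<Longrightarrow> 0 < x"
  shows "\<exists>!j :: nat \<Rightarrow> real. strict_mono j \<and> range j = Z"
proof -
  define g where "g x = nat \<lfloor>x / d\<rfloor>" for x
  have g_less: "g x < g y" if "x \<in> Z" "y \<in> Z" "x < y" for x y
  proof -
    have "(x + d) / d \<le> y / d"
      using gap[OF that] d by (intro divide_right_mono) auto
    hence "x / d + 1 \<le> y / d"
      using d by (simp add: add_divide_distrib)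
    hence "\<lfloor>x / d\<rfloor> + 1 \<le> \<lfloor>y / d\<rfloor>"
      by linarith
    moreover have "0 \<le> \<lfloor>x / d\<rfloor>"
      using pos[OF that(1)] d by simp
    ultimately show ?thesis
      unfolding g_def by linarith
  qed
  hence inj: "inj_on g Z"
    unfolding inj_on_def by (metis less_irrefl linorder_neqE_linordered_idom)
  have "infinite Z"
  proof
    assume "finite Z"
    then obtain b where "\<And>x. x \<in> Z \<Longrightarrow> x \<le> b"
      by (meson bdd_above_finite bdd_above_def)
    thus False
      using inf[of "b + 1"] by force
  qed
  hence infg: "infinite (g ` Z)"
    using inj finite_imageD by blast
  define j where "j n = the_inv_into Z g (enumerate (g ` Z) n)" for n
  have jZ: "j n \<in> Z" "g (j n) = enumerate (g ` Z) n" for n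
    unfolding j_def using enumerate_in_set[OF infg, of n] inj
    by (auto intro: the_inv_into_into f_the_inv_into_f)
  have "strict_mono j"
  proof (rule strict_monoI)
    fix m n :: nat assume "m < n"
    hence "g (j m) < g (j n)"
      using enumerate_mono[OF _ infg] by (simp add: jZ)
    thus "j m < j n"
      using g_less[of "j n" "j m"] jZ by (metis less_asym linorder_neqE_linordered_idom less_irrefl)
  qed
  moreover have "range j = Z"
  proof
    show "Z \<subseteq> range j"
    proof
      fix x assume x: "x \<in> Z"
      then obtain n where "enumerate (g ` Z) n = g x"
        using enumerate_Ex[of "g ` Z" "g x"] infg by auto
      hence "j n = x"
        using jZ[of n] x inj by (auto dest: inj_onD)
      thus "x \<in> range j"
        by auto
    qed
  qed (use jZ in auto)
  moreover have "i = j" if i: "strict_mono i" "range i = range j" and j: "strict_mono j" for i j :: "nat \<Rightarrow> real"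
  proof -
    \<comment> \<open>The value \<open>j n\<close> equals some \<open>i m\<close>; agreement below
      \<open>n\<close> and injectivity exclude \<open>m < n\<close>, so
      \<open>i n \<le> i m = j n\<close>. The claim is for arbitrary pairs so that the roles can be
      swapped.\<close>
    have le: "i n \<le> j n" if IH: "\<And>m. m < n \<Longrightarrow> i m = j m" and i: "strict_mono i" "range i = range j"
      and j: "strict_mono j" for n and i j :: "nat \<Rightarrow> real"
    proof -
      obtain m where m: "j n = i m"
        using i(2) by (metis rangeE rangeI)
      have "\<not> m < n"
        using IH[of m] m j by (metis less_irrefl strict_mono_eq)
      thus ?thesis
        using i(1) m by (simp add: strict_mono_less_eq)
    qed
    have "i n = j n" for n
    proof (induction n rule: less_induct)
      case (less n)
      have "i n \<le> j n"
        by (rule le) (use less i j in auto)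
      moreover have "j n \<le> i n"
        by (rule le) (use less i j in auto)
      ultimately show ?case
        by simp
    qed
    thus ?thesis
      by auto
  qed
  ultimately show ?thesis
    by (intro ex1I[of _ j]) auto
qed

text \<open>Unique existence of the enumeration is what gives the \<open>THE\<close> in
  \<open>bessel_zero\<close> its meaning.\<close>

lemma bessel_zero:
  assumes "-1 < \<nu>"
  shows "strict_mono (bessel_zero \<nu>)" "range (bessel_zero \<nu>) = {x. 0 < x \<and> bessel_J \<nu> x = 0}"
proof -
  obtain d where d: "0 < d"
    "\<And>x y. 0 < x \<Longrightarrow> x < y \<Longrightarrow> bessel_J \<nu> x = 0 \<Longrightarrow> bessel_J \<nu> y = 0 \<Longrightarrow> d \<le> y - x"
    using bessel_J_zero_gap[OF assms] by blast
  have "\<exists>!j :: nat \<Rightarrow> real. strict_mono j \<and> range j = {x. 0 < x \<and> bessel_J \<nu> x = 0}"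
  proof (rule strict_mono_enumeration[OF _ d(1)])
    show "\<exists>x\<in>{x. 0 < x \<and> bessel_J \<nu> x = 0}. a \<le> x" for a
      using bessel_J_zero_beyond[OF assms, of a] by blast
  qed (use d(2) in auto)
  from theI'[OF this] show "strict_mono (bessel_zero \<nu>)"
    "range (bessel_zero \<nu>) = {x. 0 < x \<and> bessel_J \<nu> x = 0}"
    unfolding bessel_zero_def by auto
qed

lemma bessel_zero_pos:
  assumes "-1 < \<nu>"
  shows "0 < bessel_zero \<nu> k"
  using bessel_zero(2)[OF assms] by blast

lemma bessel_J_bessel_zero:
  assumes "-1 < \<nu>"
  shows "bessel_J \<nu> (bessel_zero \<nu> k) = 0"
  using bessel_zero(2)[OF assms] by blast

text \<open>The uniform gap accumulates; \<open>Suc k\<close> appears because the enumeration starts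
  at \<open>0\<close>, and the first zero itself supplies the base case.\<close>

lemma bessel_zero_growth:
  assumes "-1 < \<nu>"
  shows "\<exists>c>0. \<forall>k. c * real (Suc k) \<le> bessel_zero \<nu> k"
proof -
  let ?j = "bessel_zero \<nu>"
  obtain d where d: "0 < d"
    "\<And>x y. 0 < x \<Longrightarrow> x < y \<Longrightarrow> bessel_J \<nu> x = 0 \<Longrightarrow> bessel_J \<nu> y = 0 \<Longrightarrow> d \<le> y - x"
    using bessel_J_zero_gap[OF assms] by blast
  define c where "c = min d (?j 0)"
  have "c * real (Suc k) \<le> ?j k" for k
  proof (induction k)
    case (Suc k)
    have "d \<le> ?j (Suc k) - ?j k"
      using bessel_zero(1)[OF assms] bessel_zero_pos[OF assms] bessel_J_bessel_zero[OF assms]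
      by (intro d(2)) (auto simp: strict_mono_less)
    moreover have "c \<le> d"
      by (simp add: c_def)
    moreover have "c * real (Suc (Suc k)) = c * real (Suc k) + c"
      by (simp add: algebra_simps)
    ultimately show ?case
      using Suc by linarith
  qed (simp add: c_def)
  moreover have "0 < c"
    using d(1) bessel_zero_pos[OF assms, of 0] by (simp add: c_def)
  ultimately show ?thesis
    by blast
qed

text \<open>The energy \<open>u'\<^sup>2 + q u\<^sup>2\<close> equals \<open>u'\<^sup>2\<close> at the zeros of \<open>u\<close>; the exponential factor makes it
  monotone.\<close>

lemma liouville_u'_lower_bound:
  assumes "-1 < \<nu>"
  shows "\<exists>c>0. \<exists>X>0. \<forall>x\<ge>X. bessel_J \<nu> x = 0 \<longrightarrow> c \<le> (liouville_u' \<nu> x)\<^sup>2"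
proof -
  define m where "m = \<nu>\<^sup>2 - 1 / 4"
  \<comment> \<open>The starting point is itself a zero, so \<open>F X\<close> is positive by the
    nonzero slope; its size keeps \<open>liouville_q\<close> at least \<open>1 / 2\<close> from
    there on.\<close>
  obtain X where X: "max 1 (2 * \<bar>m\<bar>) \<le> X" "0 < X" "bessel_J \<nu> X = 0"
    using bessel_J_zero_beyond[OF assms] by blast
  define F where "F x = ((liouville_u' \<nu> x)\<^sup>2 + liouville_q \<nu> x * (liouville_u \<nu> x)\<^sup>2) * exp (- 2 * \<bar>m\<bar> / x\<^sup>2)" for x
  have F_mono: "F X \<le> F x" if "X \<le> x" for x
  proof (rule DERIV_nonneg_imp_nondecreasing[OF that])
    fix t assume "X \<le> t" "t \<le> x"
    hence t: "0 < t" "1 \<le> t" "2 * \<bar>m\<bar> \<le> t"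
      using X by auto
    have Dq: "(liouville_q \<nu> has_real_derivative 2 * m / t ^ 3) (at t)"
      unfolding liouville_q_def[abs_def] m_def[symmetric] using t
      by (auto intro!: derivative_eq_intros simp: field_simps power2_eq_square power3_eq_cube)
    have De: "((\<lambda>x. exp (- 2 * \<bar>m\<bar> / x\<^sup>2)) has_real_derivative exp (- 2 * \<bar>m\<bar> / t\<^sup>2) * (4 * \<bar>m\<bar> / t ^ 3)) (at t)"
      using t by (auto intro!: derivative_eq_intros simp: field_simps power2_eq_square power3_eq_cube)
    let ?u = "liouville_u \<nu> t" and ?v = "liouville_u' \<nu> t" and ?q = "liouville_q \<nu> t"
    \<comment> \<open>The energy alone has derivative \<open>2 * m * u^2 / t^3\<close>, of either
      sign. The exponential adds \<open>4 * \<bar>m\<bar> / t^3\<close> times the energy, which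
      outweighs it since the energy is at least \<open>u^2 / 2\<close>.\<close>
    let ?D = "exp (- 2 * \<bar>m\<bar> / t\<^sup>2) * ((2 * m * ?u\<^sup>2 + 4 * \<bar>m\<bar> * (?v\<^sup>2 + ?q * ?u\<^sup>2)) / t ^ 3)"
    have "(F has_real_derivative ?D) (at t)"
      unfolding F_def[abs_def]
      by (rule derivative_eq_intros liouville_u'_deriv liouville_u_deriv Dq De assms t refl)+
        (simp add: algebra_simps add_divide_distrib power2_eq_square)
    moreover have "0 \<le> ?D"
    proof -
      have "t \<le> t\<^sup>2"
        using t by (auto intro: self_le_power)
      hence "2 * m \<le> t\<^sup>2"
        using t by linarith
      hence "m / t\<^sup>2 \<le> 1 / 2"
        using t by (subst pos_divide_le_eq) auto
      hence "1 / 2 * ?u\<^sup>2 \<le> ?q * ?u\<^sup>2"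
        unfolding liouville_q_def m_def[symmetric] by (intro mult_right_mono) auto
      hence "4 * \<bar>m\<bar> * (1 / 2 * ?u\<^sup>2) \<le> 4 * \<bar>m\<bar> * (?v\<^sup>2 + ?q * ?u\<^sup>2)"
        by (intro mult_left_mono) (auto intro: add_increasing)
      moreover have "- (m * ?u\<^sup>2) \<le> \<bar>m\<bar> * ?u\<^sup>2"
        using mult_right_mono[of "- m" "\<bar>m\<bar>" "?u\<^sup>2"] by simp
      ultimately have "0 \<le> 2 * m * ?u\<^sup>2 + 4 * \<bar>m\<bar> * (?v\<^sup>2 + ?q * ?u\<^sup>2)"
        by (simp add: algebra_simps)
      thus ?thesis
        using t by simp
    qed
    ultimately show "\<exists>y. (F has_real_derivative y) (at t) \<and> 0 \<le> y"
      by blast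
  qed
  have "F X \<le> (liouville_u' \<nu> x)\<^sup>2" if x: "X \<le> x" "bessel_J \<nu> x = 0" for x
  proof -
    have "liouville_u \<nu> x = 0"
      using x X assms by (simp add: liouville_u_eq_0_iff)
    hence "F x = (liouville_u' \<nu> x)\<^sup>2 * exp (- 2 * \<bar>m\<bar> / x\<^sup>2)"
      by (simp add: F_def)
    also have "\<dots> \<le> (liouville_u' \<nu> x)\<^sup>2 * 1"
      by (intro mult_left_mono) auto
    finally show ?thesis
      using F_mono[OF x(1)] by simp
  qed
  moreover have "liouville_u \<nu> X = 0" "liouville_u' \<nu> X \<noteq> 0"
    using X(2,3) assms liouville_u'_at_zero(2) by (simp_all add: liouville_u_eq_0_iff)
  hence "0 < F X"
    by (simp add: F_def)
  ultimately show ?thesis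
    using X(2) by blast
qed

text \<open>At a zero \<open>j\<close> beyond \<open>X\<close> the slope bound reads
  \<open>j^2 E^2 \<ge> 4 * c / j powr (2 * \<nu> + 1)\<close>, so the term is at most a multiple of
  \<open>j powr - r\<close> with \<open>r = 1 + 2 * (\<sigma> - \<nu>)\<close>; linear growth of the
  zeros reduces this to a convergent p-series.\<close>

lemma bessel_norming_summable:
  assumes "-1 < \<nu>" "\<nu> < \<sigma>"
  defines "j \<equiv> bessel_zero \<nu>"
  shows "summable (\<lambda>k. j k powr (- 2 - 2 * \<sigma>) / ((j k)\<^sup>2 * (bessel_E (\<nu> + 1) ((j k)\<^sup>2 / 4))\<^sup>2))"
proof -
  obtain c X where c: "0 < c" "0 < X" "\<And>x. X \<le> x \<Longrightarrow> bessel_J \<nu> x = 0 \<Longrightarrow> c \<le> (liouville_u' \<nu> x)\<^sup>2"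
    using liouville_u'_lower_bound[OF assms(1)] by blast
  obtain d where d: "0 < d" "\<And>k. d * real (Suc k) \<le> j k"
    using bessel_zero_growth[OF assms(1)] unfolding j_def by blast
  have j: "0 < j k" "bessel_J \<nu> (j k) = 0" for k
    unfolding j_def using assms(1) by (auto simp: bessel_zero_pos bessel_J_bessel_zero)
  define r where "r = 1 + 2 * (\<sigma> - \<nu>)"
  have r: "1 < r"
    using assms by (simp add: r_def)
  \<comment> \<open>From this index on \<open>d * real (Suc k)\<close>, and with it
    \<open>j k\<close>, is at least \<open>X\<close>.\<close>
  have "norm (j k powr (- 2 - 2 * \<sigma>) / ((j k)\<^sup>2 * (bessel_E (\<nu> + 1) ((j k)\<^sup>2 / 4))\<^sup>2))
      \<le> 1 / (4 * c) * (d powr - r * real (Suc k) powr - r)" if "nat \<lceil>X / d\<rceil> \<le> k" for k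
  proof -
    have "X / d \<le> real k"
      using that by linarith
    hence "X \<le> d * real (Suc k)"
      using d(1) by (simp add: field_simps)
    hence "X \<le> j k"
      using d(2)[of k] by linarith
    hence "c \<le> (liouville_u' \<nu> (j k))\<^sup>2"
      using c(3) j by blast
    also have "\<dots> = (j k powr (\<nu> + 3 / 2))\<^sup>2 / 4 * (bessel_E (\<nu> + 1) ((j k)\<^sup>2 / 4))\<^sup>2"
      using assms(1) j[of k] by (simp add: liouville_u'_at_zero power_mult_distrib power_divide)
    also have "(j k powr (\<nu> + 3 / 2))\<^sup>2 = j k powr (2 * \<nu> + 1) * (j k)\<^sup>2"
    proof -
      have "(j k powr (\<nu> + 3 / 2))\<^sup>2 = j k powr ((2 * \<nu> + 1) + 2)"
        by (simp add: power2_eq_square add.commute flip: powr_add)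
      also have "\<dots> = j k powr (2 * \<nu> + 1) * (j k)\<^sup>2"
        using j[of k] by (subst powr_add) simp
      finally show ?thesis .
    qed
    finally have le: "4 * c / j k powr (2 * \<nu> + 1) \<le> (j k)\<^sup>2 * (bessel_E (\<nu> + 1) ((j k)\<^sup>2 / 4))\<^sup>2"
      using j[of k] by (simp add: field_simps)
    have "j k powr (- 2 - 2 * \<sigma>) / ((j k)\<^sup>2 * (bessel_E (\<nu> + 1) ((j k)\<^sup>2 / 4))\<^sup>2)
        \<le> j k powr (- 2 - 2 * \<sigma>) / (4 * c / j k powr (2 * \<nu> + 1))"
    proof (rule divide_left_mono[OF le])
      have "0 < 4 * c / j k powr (2 * \<nu> + 1)"
        using c j[of k] by simp
      thus "0 < (j k)\<^sup>2 * (bessel_E (\<nu> + 1) ((j k)\<^sup>2 / 4))\<^sup>2 * (4 * c / j k powr (2 * \<nu> + 1))"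
        using less_le_trans[OF _ le] by (simp only: mult_pos_pos)
    qed simp
    also have "\<dots> = 1 / (4 * c) * j k powr - r"
      using j[of k] c by (simp add: r_def flip: powr_add)
    also have "\<dots> \<le> 1 / (4 * c) * (d * real (Suc k)) powr - r"
      using d r c j by (intro mult_left_mono powr_mono2') auto
    also have "\<dots> = 1 / (4 * c) * (d powr - r * real (Suc k) powr - r)"
      using d by (simp add: powr_mult)
    finally show ?thesis
      using j[of k] by simp
  qed
  moreover have "summable (\<lambda>k. 1 / (4 * c) * (d powr - r * real (Suc k) powr - r))"
    using r summable_Suc_iff[of "\<lambda>k. real k powr - r"] by (intro summable_mult) (simp add: summable_real_powr_iff)
  ultimately show ?thesis
    by (rule summable_comparison_test'[rotated])
qed

section \<open>Square-integrable functions and orthonormal expansions\<close>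

lemma L2_measurable [measurable_dest]: "f \<in> L2 M \<Longrightarrow> f \<in> borel_measurable M"
  by (simp add: L2_def)

lemma L2_square_integrable: "f \<in> L2 M \<Longrightarrow> integrable M (\<lambda>x. (f x)\<^sup>2)"
  by (simp add: L2_def)

lemma L2_mult_integrable:
  assumes "f \<in> L2 M" "g \<in> L2 M"
  shows "integrable M (\<lambda>x. f x * g x)"
proof (rule Bochner_Integration.integrable_bound)
  show "integrable M (\<lambda>x. (f x)\<^sup>2 + (g x)\<^sup>2)"
    using assms by (intro Bochner_Integration.integrable_add L2_square_integrable)
  show "(\<lambda>x. f x * g x) \<in> borel_measurable M"
    using assms by (intro borel_measurable_times L2_measurable)
  show "AE x in M. norm (f x * g x) \<le> norm ((f x)\<^sup>2 + (g x)\<^sup>2)"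
  proof (rule AE_I2)
    fix x
    have "0 \<le> (\<bar>f x\<bar> - \<bar>g x\<bar>)\<^sup>2"
      by simp
    hence "2 * (\<bar>f x\<bar> * \<bar>g x\<bar>) \<le> (f x)\<^sup>2 + (g x)\<^sup>2"
      by (simp add: power2_diff)
    moreover have "0 \<le> \<bar>f x\<bar> * \<bar>g x\<bar>"
      by simp
    ultimately have "\<bar>f x\<bar> * \<bar>g x\<bar> \<le> (f x)\<^sup>2 + (g x)\<^sup>2"
      by linarith
    thus "norm (f x * g x) \<le> norm ((f x)\<^sup>2 + (g x)\<^sup>2)"
      by (simp add: abs_mult)
  qed
qed

lemma L2_lincomb:
  assumes "f \<in> L2 M" "g \<in> L2 M"
  shows "(\<lambda>x. a * f x + b * g x) \<in> L2 M"
proof -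
  have "integrable M (\<lambda>x. a\<^sup>2 * (f x)\<^sup>2 + b\<^sup>2 * (g x)\<^sup>2 + 2 * a * b * (f x * g x))"
    using assms by (intro Bochner_Integration.integrable_add integrable_mult_right
        L2_square_integrable L2_mult_integrable)
  moreover have "(\<lambda>x. (a * f x + b * g x)\<^sup>2) = (\<lambda>x. a\<^sup>2 * (f x)\<^sup>2 + b\<^sup>2 * (g x)\<^sup>2 + 2 * a * b * (f x * g x))"
    by (simp add: power2_eq_square algebra_simps)
  moreover have "(\<lambda>x. a * f x + b * g x) \<in> borel_measurable M"
    using assms by (intro borel_measurable_add borel_measurable_times borel_measurable_const L2_measurable)
  ultimately show ?thesis
    by (simp add: L2_def)
qed

lemma L2_zero [simp]: "(\<lambda>_. 0) \<in> L2 M"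
  by (simp add: L2_def)

lemma L2_scale: "f \<in> L2 M \<Longrightarrow> (\<lambda>x. a * f x) \<in> L2 M"
  using L2_lincomb[of f M f a 0] by simp

lemma L2_add: "f \<in> L2 M \<Longrightarrow> g \<in> L2 M \<Longrightarrow> (\<lambda>x. f x + g x) \<in> L2 M"
  using L2_lincomb[of f M g 1 1] by simp

lemma L2_diff: "f \<in> L2 M \<Longrightarrow> g \<in> L2 M \<Longrightarrow> (\<lambda>x. f x - g x) \<in> L2 M"
  using L2_lincomb[of f M g 1 "-1"] by simp

lemma L2_sum:
  assumes "\<And>k. k \<in> A \<Longrightarrow> F k \<in> L2 M"
  shows "(\<lambda>x. \<Sum>k\<in>A. F k x) \<in> L2 M"
  using assms by (induction A rule: infinite_finite_induct) (auto intro: L2_add)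

lemma L2_inner_commute: "L2_inner M f g = L2_inner M g f"
  by (simp add: L2_inner_def mult.commute)

lemma L2_inner_lincomb:
  assumes "f \<in> L2 M" "g \<in> L2 M" "h \<in> L2 M"
  shows "L2_inner M (\<lambda>x. a * f x + b * g x) h = a * L2_inner M f h + b * L2_inner M g h"
proof -
  have "L2_inner M (\<lambda>x. a * f x + b * g x) h = (LINT x|M. a * (f x * h x) + b * (g x * h x))"
    unfolding L2_inner_def by (rule arg_cong[of _ _ "integral\<^sup>L M"]) (simp add: algebra_simps)
  also have "\<dots> = a * L2_inner M f h + b * L2_inner M g h"
    unfolding L2_inner_def using assms
    by (subst Bochner_Integration.integral_add) (simp_all add: L2_mult_integrable)
  finally show ?thesis .
qed

lemma L2_inner_scale:
  "f \<in> L2 M \<Longrightarrow> h \<in> L2 M \<Longrightarrow> L2_inner M (\<lambda>x. a * f x) h = a * L2_inner M f h"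
  using L2_inner_lincomb[of f M f h a 0] by simp

lemma L2_inner_diff:
  "f \<in> L2 M \<Longrightarrow> g \<in> L2 M \<Longrightarrow> h \<in> L2 M \<Longrightarrow>
    L2_inner M (\<lambda>x. f x - g x) h = L2_inner M f h - L2_inner M g h"
  using L2_inner_lincomb[of f M g h 1 "-1"] by simp

lemma L2_inner_sum:
  assumes "\<And>k. k \<in> A \<Longrightarrow> F k \<in> L2 M" "h \<in> L2 M"
  shows "L2_inner M (\<lambda>x. \<Sum>k\<in>A. F k x) h = (\<Sum>k\<in>A. L2_inner M (F k) h)"
  unfolding L2_inner_def sum_distrib_right
  using assms by (intro Bochner_Integration.integral_sum L2_mult_integrable)

lemma L2_inner_self_nonneg: "0 \<le> L2_inner M f f"
  unfolding L2_inner_def by (rule Bochner_Integration.integral_nonneg) simp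

lemma L2_norm_nonneg [simp]: "0 \<le> L2_norm M f"
  by (simp add: L2_norm_def L2_inner_self_nonneg)

lemma L2_norm_square: "(L2_norm M f)\<^sup>2 = L2_inner M f f"
  by (simp add: L2_norm_def L2_inner_self_nonneg)

lemma L2_Cauchy_Schwarz:
  assumes "f \<in> L2 M" "g \<in> L2 M"
  shows "\<bar>L2_inner M f g\<bar> \<le> L2_norm M f * L2_norm M g"
proof -
  let ?A = "L2_inner M f f" and ?B = "L2_inner M f g" and ?C = "L2_inner M g g"
  have quad: "0 \<le> a\<^sup>2 * ?A + 2 * a * b * ?B + b\<^sup>2 * ?C" for a b
  proof -
    have h: "(\<lambda>x. a * f x + b * g x) \<in> L2 M"
      using assms by (rule L2_lincomb)
    have "L2_inner M (\<lambda>x. a * f x + b * g x) (\<lambda>x. a * f x + b * g x)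
        = a * L2_inner M (\<lambda>x. a * f x + b * g x) f + b * L2_inner M (\<lambda>x. a * f x + b * g x) g"
      using L2_inner_lincomb[OF assms h, of a b] by (simp add: L2_inner_commute)
    also have "\<dots> = a\<^sup>2 * ?A + 2 * a * b * ?B + b\<^sup>2 * ?C"
      using assms by (simp add: L2_inner_lincomb L2_inner_commute[of M g f] power2_eq_square algebra_simps)
    finally show ?thesis
      using L2_inner_self_nonneg[of M "\<lambda>x. a * f x + b * g x"] by simp
  qed
  have "?B\<^sup>2 \<le> ?A * ?C"
  proof (cases "?C = 0")
    case True
    have "?B = 0"
    proof (rule ccontr)
      \<comment> \<open>With \<open>?C = 0\<close>, the choice \<open>a = 1\<close>,
        \<open>b = - (?A + 1) / ?B\<close> gives the quadratic form the negative value
        \<open>- ?A - 2\<close>.\<close>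
      assume "?B \<noteq> 0"
      hence "2 * 1 * (- (?A + 1) / ?B) * ?B = - 2 * (?A + 1)"
        by simp
      thus False
        using quad[of 1 "- (?A + 1) / ?B"] True L2_inner_self_nonneg[of M f] by simp
    qed
    thus ?thesis
      using True by simp
  next
    case False
    hence C: "0 < ?C"
      using L2_inner_self_nonneg[of M g] by linarith
    \<comment> \<open>The choice \<open>a = ?C\<close>, \<open>b = - ?B\<close> minimises the
      quadratic form up to scaling.\<close>
    have "0 \<le> ?C * (?A * ?C - ?B\<^sup>2)"
      using quad[of ?C "- ?B"] by (simp add: power2_eq_square algebra_simps)
    thus ?thesis
      using C by (simp add: zero_le_mult_iff)
  qed
  hence "sqrt (?B\<^sup>2) \<le> sqrt (?A * ?C)"
    by (rule real_sqrt_le_mono)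
  thus ?thesis
    by (simp add: L2_norm_def real_sqrt_mult)
qed

lemma L2_norm_add_le:
  assumes "f \<in> L2 M" "g \<in> L2 M"
  shows "L2_norm M (\<lambda>x. f x + g x) \<le> L2_norm M f + L2_norm M g"
proof (rule power2_le_imp_le)
  have h: "(\<lambda>x. f x + g x) \<in> L2 M"
    using assms by (rule L2_add)
  have "(L2_norm M (\<lambda>x. f x + g x))\<^sup>2
      = L2_inner M f (\<lambda>x. f x + g x) + L2_inner M g (\<lambda>x. f x + g x)"
    using L2_inner_lincomb[OF assms h, of 1 1] by (simp add: L2_norm_square)
  also have "\<dots> = (L2_norm M f)\<^sup>2 + 2 * L2_inner M f g + (L2_norm M g)\<^sup>2"
    using L2_inner_lincomb[OF assms assms(1), of 1 1] L2_inner_lincomb[OF assms assms(2), of 1 1]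
    by (simp add: L2_inner_commute[of M _ "\<lambda>x. f x + g x"] L2_inner_commute[of M g f] L2_norm_square)
  also have "\<dots> \<le> (L2_norm M f + L2_norm M g)\<^sup>2"
    using L2_Cauchy_Schwarz[OF assms] by (simp add: power2_sum)
  finally show "(L2_norm M (\<lambda>x. f x + g x))\<^sup>2 \<le> (L2_norm M f + L2_norm M g)\<^sup>2" .
qed simp

lemma L2_norm_scale: "L2_norm M (\<lambda>x. a * f x) = \<bar>a\<bar> * L2_norm M f"
proof -
  have "L2_inner M (\<lambda>x. a * f x) (\<lambda>x. a * f x) = a\<^sup>2 * L2_inner M f f"
    unfolding L2_inner_def by (simp add: power2_eq_square mult_ac flip: integral_mult_right_zero)
  thus ?thesis
    by (simp add: L2_norm_def real_sqrt_mult)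
qed

lemma L2_norm_zero_imp_AE:
  assumes "f \<in> L2 M" "L2_norm M f = 0"
  shows "AE x in M. f x = 0"
proof -
  have "integral\<^sup>L M (\<lambda>x. (f x)\<^sup>2) = 0"
    using assms(2) L2_norm_square[of M f] by (simp add: L2_inner_def power2_eq_square)
  hence "AE x in M. (f x)\<^sup>2 = 0"
    using integral_nonneg_eq_0_iff_AE[OF L2_square_integrable[OF assms(1)]] by simp
  thus ?thesis
    by simp
qed

lemma L2_sums_unique_AE:
  assumes u: "L2_sums M F u" and v: "L2_sums M F v" and F: "\<And>k. F k \<in> L2 M"
  shows "AE x in M. u x = v x"
proof -
  have L2: "u \<in> L2 M" "v \<in> L2 M" "\<And>n. (\<lambda>x. \<Sum>k<n. F k x) \<in> L2 M"
    using u v F by (auto simp: L2_sums_def intro: L2_sum)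
  have "L2_norm M (\<lambda>x. u x - v x) \<le> L2_norm M (\<lambda>x. u x - (\<Sum>k<n. F k x)) + L2_norm M (\<lambda>x. v x - (\<Sum>k<n. F k x))" for n
  proof -
    have "L2_norm M (\<lambda>x. u x - v x)
        = L2_norm M (\<lambda>x. (u x - (\<Sum>k<n. F k x)) + - 1 * (v x - (\<Sum>k<n. F k x)))"
      by simp
    also have "\<dots> \<le> L2_norm M (\<lambda>x. u x - (\<Sum>k<n. F k x)) + L2_norm M (\<lambda>x. - 1 * (v x - (\<Sum>k<n. F k x)))"
      by (intro L2_norm_add_le L2_scale L2_diff L2)
    finally show ?thesis
      unfolding L2_norm_scale by simp
  qed
  moreover have "(\<lambda>n. L2_norm M (\<lambda>x. u x - (\<Sum>k<n. F k x)) + L2_norm M (\<lambda>x. v x - (\<Sum>k<n. F k x))) \<longlonglongrightarrow> 0 + 0"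
    using u v by (intro tendsto_add) (auto simp: L2_sums_def)
  ultimately have "L2_norm M (\<lambda>x. u x - v x) \<le> 0 + 0"
    by (intro LIMSEQ_le_const) auto
  hence "L2_norm M (\<lambda>x. u x - v x) = 0"
    using L2_norm_nonneg[of M "\<lambda>x. u x - v x"] by simp
  hence "AE x in M. u x - v x = 0"
    by (intro L2_norm_zero_imp_AE L2_diff L2)
  thus ?thesis
    by simp
qed

lemma L2_sums_lincomb:
  assumes u: "L2_sums M F u" and v: "L2_sums M G v" and F: "\<And>k. F k \<in> L2 M" and G: "\<And>k. G k \<in> L2 M"
  shows "L2_sums M (\<lambda>k x. a * F k x + b * G k x) (\<lambda>x. a * u x + b * v x)"
  unfolding L2_sums_def
proof
  have L2: "u \<in> L2 M" "v \<in> L2 M" "\<And>n. (\<lambda>x. \<Sum>k<n. F k x) \<in> L2 M" "\<And>n. (\<lambda>x. \<Sum>k<n. G k x) \<in> L2 M"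
    using u v F G by (auto simp: L2_sums_def intro: L2_sum)
  show "(\<lambda>x. a * u x + b * v x) \<in> L2 M"
    using L2 by (intro L2_lincomb)
  have eq: "a * u x + b * v x - (\<Sum>k<n. a * F k x + b * G k x)
      = a * (u x - (\<Sum>k<n. F k x)) + b * (v x - (\<Sum>k<n. G k x))" for n x
    by (simp add: sum.distrib right_diff_distrib flip: sum_distrib_left)
  have bound: "L2_norm M (\<lambda>x. a * u x + b * v x - (\<Sum>k<n. a * F k x + b * G k x))
      \<le> \<bar>a\<bar> * L2_norm M (\<lambda>x. u x - (\<Sum>k<n. F k x)) + \<bar>b\<bar> * L2_norm M (\<lambda>x. v x - (\<Sum>k<n. G k x))" for n
  proof -
    have "L2_norm M (\<lambda>x. a * u x + b * v x - (\<Sum>k<n. a * F k x + b * G k x))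
        = L2_norm M (\<lambda>x. a * (u x - (\<Sum>k<n. F k x)) + b * (v x - (\<Sum>k<n. G k x)))"
      by (simp only: eq)
    also have "\<dots> \<le> L2_norm M (\<lambda>x. a * (u x - (\<Sum>k<n. F k x)))
        + L2_norm M (\<lambda>x. b * (v x - (\<Sum>k<n. G k x)))"
      by (intro L2_norm_add_le L2_scale L2_diff L2)
    finally show ?thesis
      by (simp only: L2_norm_scale)
  qed
  have "(\<lambda>n. \<bar>a\<bar> * L2_norm M (\<lambda>x. u x - (\<Sum>k<n. F k x)) + \<bar>b\<bar> * L2_norm M (\<lambda>x. v x - (\<Sum>k<n. G k x)))
      \<longlonglongrightarrow> \<bar>a\<bar> * 0 + \<bar>b\<bar> * 0"
    using u v unfolding L2_sums_def by (intro tendsto_add tendsto_mult tendsto_const) simp_all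
  hence "(\<lambda>n. \<bar>a\<bar> * L2_norm M (\<lambda>x. u x - (\<Sum>k<n. F k x)) + \<bar>b\<bar> * L2_norm M (\<lambda>x. v x - (\<Sum>k<n. G k x)))
      \<longlonglongrightarrow> 0"
    by simp
  thus "(\<lambda>n. L2_norm M (\<lambda>x. a * u x + b * v x - (\<Sum>k<n. a * F k x + b * G k x))) \<longlonglongrightarrow> 0"
    by (rule Lim_null_comparison[rotated]) (intro always_eventually allI, simp only: real_norm_def abs_of_nonneg[OF L2_norm_nonneg] bound)
qed

text \<open>The inner product with the unit vector \<open>\<Phi> k\<close> is continuous, and it
  equals \<open>a k\<close> on every partial sum with more than \<open>k\<close> terms.\<close>

lemma L2_sums_orthonormal_coeff:
  assumes u: "L2_sums M (\<lambda>k x. a k * \<Phi> k x) u" and \<Phi>: "\<And>k. \<Phi> k \<in> L2 M"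
    and orth: "\<And>k l. L2_inner M (\<Phi> k) (\<Phi> l) = (if k = l then 1 else 0)"
  shows "L2_inner M u (\<Phi> k) = a k"
proof -
  have L2: "u \<in> L2 M" "\<And>n. (\<lambda>x. \<Sum>k<n. a k * \<Phi> k x) \<in> L2 M"
    using u \<Phi> by (auto simp: L2_sums_def intro!: L2_sum L2_scale)
  have "norm (L2_inner M u (\<Phi> k) - a k) \<le> L2_norm M (\<lambda>x. u x - (\<Sum>k<n. a k * \<Phi> k x))" if "k < n" for n
  proof -
    have "L2_inner M (\<lambda>x. \<Sum>k<n. a k * \<Phi> k x) (\<Phi> k) = (\<Sum>l<n. a l * (if l = k then 1 else 0))"
      using \<Phi> by (simp add: L2_inner_sum L2_scale L2_inner_scale orth)
    also have "\<dots> = (\<Sum>l<n. if l = k then a l else 0)"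
      by (intro sum.cong) auto
    also have "\<dots> = a k"
      using that by simp
    finally have "L2_inner M u (\<Phi> k) - a k = L2_inner M (\<lambda>x. u x - (\<Sum>k<n. a k * \<Phi> k x)) (\<Phi> k)"
      using L2 \<Phi> by (simp add: L2_inner_diff)
    also have "norm \<dots> \<le> L2_norm M (\<lambda>x. u x - (\<Sum>k<n. a k * \<Phi> k x)) * L2_norm M (\<Phi> k)"
      unfolding real_norm_def by (intro L2_Cauchy_Schwarz L2_diff L2 \<Phi>)
    also have "L2_norm M (\<Phi> k) = 1"
      by (simp add: L2_norm_def orth)
    finally show ?thesis
      by simp
  qed
  hence "norm (L2_inner M u (\<Phi> k) - a k) \<le> 0"
    using u by (intro LIMSEQ_le_const[where X = "\<lambda>n. L2_norm M (\<lambda>x. u x - (\<Sum>k<n. a k * \<Phi> k x))"])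
      (auto simp: L2_sums_def intro!: exI[of _ "Suc k"])
  thus ?thesis
    by simp
qed

lemma ell2_Cauchy_Schwarz:
  fixes x y :: "nat \<Rightarrow> real"
  assumes "summable (\<lambda>k. (x k)\<^sup>2)" "summable (\<lambda>k. (y k)\<^sup>2)"
  shows "summable (\<lambda>k. \<bar>x k * y k\<bar>)"
    and "\<bar>\<Sum>k. x k * y k\<bar> \<le> sqrt (\<Sum>k. (x k)\<^sup>2) * sqrt (\<Sum>k. (y k)\<^sup>2)"
proof -
  let ?B = "sqrt (\<Sum>k. (x k)\<^sup>2) * sqrt (\<Sum>k. (y k)\<^sup>2)"
  have le: "(\<Sum>k<n. \<bar>x k * y k\<bar>) \<le> ?B" for n
  proof (rule power2_le_imp_le)
    have "(\<Sum>k<n. \<bar>x k * y k\<bar>)\<^sup>2 \<le> (\<Sum>k<n. \<bar>x k\<bar>\<^sup>2) * (\<Sum>k<n. \<bar>y k\<bar>\<^sup>2)"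
      unfolding abs_mult by (rule Cauchy_Schwarz_ineq_sum)
    also have "\<dots> \<le> (\<Sum>k. (x k)\<^sup>2) * (\<Sum>k. (y k)\<^sup>2)"
      using assms by (intro mult_mono) (auto intro!: sum_le_suminf sum_nonneg suminf_nonneg)
    also have "\<dots> = ?B\<^sup>2"
      using assms by (simp add: power_mult_distrib suminf_nonneg)
    finally show "(\<Sum>k<n. \<bar>x k * y k\<bar>)\<^sup>2 \<le> ?B\<^sup>2" .
  qed (use assms in \<open>simp add: suminf_nonneg\<close>)
  show sm: "summable (\<lambda>k. \<bar>x k * y k\<bar>)"
    by (rule summableI_nonneg_bounded[OF _ le]) simp
  have "\<bar>\<Sum>k. x k * y k\<bar> \<le> (\<Sum>k. \<bar>x k * y k\<bar>)"
    using sm by (rule summable_rabs)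
  also have "\<dots> \<le> ?B"
    using sm le by (intro suminf_le_const)
  finally show "\<bar>\<Sum>k. x k * y k\<bar> \<le> ?B" .
qed

section \<open>The scale of spaces and its duals\<close>

text \<open>Separates the Hilbert scale argument, which works with coefficient sequences, from the
  analysis of Bessel functions; \<open>bessel_heat\<close> discharges the assumptions.\<close>

locale spectral_scale =
  fixes \<alpha> \<beta> \<mu> s :: real
  assumes Phi_L2: "\<And>k. Phi \<alpha> \<beta> \<mu> k \<in> L2 (weighted \<beta>)"
    and orthonormal: "\<And>k l. L2_inner (weighted \<beta>) (Phi \<alpha> \<beta> \<mu> k) (Phi \<alpha> \<beta> \<mu> l) = (if k = l then 1 else 0)"
    and eigval_pos: "\<And>k. 0 < eigval \<alpha> \<beta> \<mu> k"
begin

abbreviation "W \<equiv> weighted \<beta>"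
abbreviation "\<Phi> \<equiv> Phi \<alpha> \<beta> \<mu>"
abbreviation "lam \<equiv> eigval \<alpha> \<beta> \<mu>"
abbreviation "cf \<equiv> coeff \<alpha> \<beta> \<mu>"
abbreviation "H \<equiv> H_space \<alpha> \<beta> \<mu> s"
abbreviation "nrm \<equiv> H_norm \<alpha> \<beta> \<mu> s"
abbreviation "Hd \<equiv> H_dual \<alpha> \<beta> \<mu> s"
abbreviation "dnrm \<equiv> H_dual_norm \<alpha> \<beta> \<mu> s"

lemma coeff_of_L2_sums: "L2_sums W (\<lambda>k x. a k * \<Phi> k x) u \<Longrightarrow> cf u k = a k"
  unfolding coeff_def using L2_sums_orthonormal_coeff[OF _ Phi_L2 orthonormal] .

lemma H_spaceI:
  assumes "L2_sums W (\<lambda>k x. a k * \<Phi> k x) u" "summable (\<lambda>k. (a k)\<^sup>2 * lam k powr s)"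
  shows "u \<in> H"
  using assms unfolding H_space_def by auto

lemma H_space_expansion:
  assumes "u \<in> H"
  shows "L2_sums W (\<lambda>k x. cf u k * \<Phi> k x) u" "summable (\<lambda>k. (cf u k)\<^sup>2 * lam k powr s)"
proof -
  obtain a where a: "L2_sums W (\<lambda>k x. a k * \<Phi> k x) u" "summable (\<lambda>k. \<bar>a k\<bar>\<^sup>2 * lam k powr s)"
    using assms unfolding H_space_def by blast
  moreover have "cf u = a"
    using coeff_of_L2_sums[OF a(1)] by auto
  ultimately show "L2_sums W (\<lambda>k x. cf u k * \<Phi> k x) u" "summable (\<lambda>k. (cf u k)\<^sup>2 * lam k powr s)"
    by simp_all
qed

lemma H_space_L2: "u \<in> H \<Longrightarrow> u \<in> L2 W"
  using H_space_expansion(1) by (auto simp: L2_sums_def)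

lemma coeff_lincomb: "u \<in> L2 W \<Longrightarrow> v \<in> L2 W \<Longrightarrow> cf (\<lambda>x. a * u x + b * v x) k = a * cf u k + b * cf v k"
  unfolding coeff_def by (rule L2_inner_lincomb[OF _ _ Phi_L2])

lemma H_norm_square: "u \<in> H \<Longrightarrow> (nrm u)\<^sup>2 = (\<Sum>k. (cf u k)\<^sup>2 * lam k powr s)"
  unfolding H_norm_def using H_space_expansion(2)[of u] by (simp add: suminf_nonneg)

lemma H_norm_nonneg: "u \<in> H \<Longrightarrow> 0 \<le> nrm u"
  unfolding H_norm_def using H_space_expansion(2)[of u] by (simp add: suminf_nonneg)

lemma H_space_lincomb:
  assumes "u \<in> H" "v \<in> H"
  shows "(\<lambda>x. a * u x + b * v x) \<in> H"
proof (rule H_spaceI)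
  let ?w = "\<lambda>k. a * cf u k + b * cf v k"
  have "L2_sums W (\<lambda>k x. a * (cf u k * \<Phi> k x) + b * (cf v k * \<Phi> k x)) (\<lambda>x. a * u x + b * v x)"
    using assms by (intro L2_sums_lincomb H_space_expansion L2_scale Phi_L2)
  thus "L2_sums W (\<lambda>k x. ?w k * \<Phi> k x) (\<lambda>x. a * u x + b * v x)"
    by (simp add: algebra_simps)
  have "summable (\<lambda>k. 2 * a\<^sup>2 * ((cf u k)\<^sup>2 * lam k powr s) + 2 * b\<^sup>2 * ((cf v k)\<^sup>2 * lam k powr s))"
    using assms by (intro summable_add summable_mult H_space_expansion)
  thus "summable (\<lambda>k. (?w k)\<^sup>2 * lam k powr s)"
  proof (rule summable_comparison_test'[where N = 0])
    fix k
    have "(?w k)\<^sup>2 \<le> 2 * (a * cf u k)\<^sup>2 + 2 * (b * cf v k)\<^sup>2"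
      using zero_le_power2[of "a * cf u k - b * cf v k"] by (simp add: power2_sum power2_diff)
    hence "(?w k)\<^sup>2 * lam k powr s \<le> (2 * (a * cf u k)\<^sup>2 + 2 * (b * cf v k)\<^sup>2) * lam k powr s"
      by (rule mult_right_mono) simp
    thus "norm ((?w k)\<^sup>2 * lam k powr s)
        \<le> 2 * a\<^sup>2 * ((cf u k)\<^sup>2 * lam k powr s) + 2 * b\<^sup>2 * ((cf v k)\<^sup>2 * lam k powr s)"
      by (simp add: power_mult_distrib algebra_simps)
  qed
qed

lemma Phi_mem_H: "\<Phi> n \<in> H"
proof (rule H_spaceI[where a = "\<lambda>k. if k = n then 1 else 0"])
  have "(\<Sum>k<N. (if k = n then 1 else 0) * \<Phi> k x) = \<Phi> n x" if "n < N" for N x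
  proof -
    have "(\<Sum>k<N. (if k = n then 1 else 0) * \<Phi> k x) = (\<Sum>k<N. if k = n then \<Phi> k x else 0)"
      by (intro sum.cong) auto
    thus ?thesis
      using that by simp
  qed
  hence "L2_norm W (\<lambda>x. \<Phi> n x - (\<Sum>k<N. (if k = n then 1 else 0) * \<Phi> k x)) = 0" if "n < N" for N
    using that by (simp add: L2_norm_def L2_inner_def)
  hence "(\<lambda>N. L2_norm W (\<lambda>x. \<Phi> n x - (\<Sum>k<N. (if k = n then 1 else 0) * \<Phi> k x))) \<longlonglongrightarrow> 0"
    by (intro tendsto_eventually) (auto intro: eventually_mono[OF eventually_gt_at_top[of n]])
  thus "L2_sums W (\<lambda>k x. (if k = n then 1 else 0) * \<Phi> k x) (\<Phi> n)"
    unfolding L2_sums_def using Phi_L2 by blast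
  show "summable (\<lambda>k. (if k = n then 1 else 0)\<^sup>2 * lam k powr s)"
    by (rule summable_finite[of "{n}"]) auto
qed

lemma coeff_Phi: "cf (\<Phi> n) k = (if n = k then 1 else 0)"
  unfolding coeff_def by (rule orthonormal)

lemma zero_mem_H: "(\<lambda>_. 0) \<in> H"
  using H_space_lincomb[OF Phi_mem_H Phi_mem_H, of 0 0 0 0] by simp

lemma H_norm_zero: "nrm (\<lambda>_. 0) = 0"
  by (simp add: H_norm_def coeff_def L2_inner_def)

lemma H_space_scale: "u \<in> H \<Longrightarrow> (\<lambda>x. a * u x) \<in> H"
  using H_space_lincomb[of u u a 0] by simp

lemma H_norm_scale:
  assumes "u \<in> H"
  shows "nrm (\<lambda>x. a * u x) = \<bar>a\<bar> * nrm u"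
proof -
  have "cf (\<lambda>x. a * u x) k = a * cf u k" for k
    using coeff_lincomb[of u u a 0] H_space_L2[OF assms] by simp
  hence "(\<Sum>k. \<bar>cf (\<lambda>x. a * u x) k\<bar>\<^sup>2 * lam k powr s) = a\<^sup>2 * (\<Sum>k. \<bar>cf u k\<bar>\<^sup>2 * lam k powr s)"
    using H_space_expansion(2)[OF assms] by (simp add: power_mult_distrib mult.assoc suminf_mult)
  thus ?thesis
    by (simp add: H_norm_def real_sqrt_mult)
qed

lemma Phi_sum_mem_H: "(\<lambda>x. \<Sum>k<n. b k * \<Phi> k x) \<in> H"
proof (induction n)
  case (Suc n)
  show ?case
    using H_space_lincomb[OF Suc Phi_mem_H, of 1 "b n" n] by simp
qed (simp add: zero_mem_H)

lemma coeff_Phi_sum: "cf (\<lambda>x. \<Sum>k<n. b k * \<Phi> k x) l = (if l < n then b l else 0)"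
proof (induction n)
  case 0
  show ?case
    by (simp add: coeff_def L2_inner_def)
next
  case (Suc n)
  have "cf (\<lambda>x. 1 * (\<Sum>k<n. b k * \<Phi> k x) + b n * \<Phi> n x) l
      = 1 * cf (\<lambda>x. \<Sum>k<n. b k * \<Phi> k x) l + b n * cf (\<Phi> n) l"
    by (intro coeff_lincomb H_space_L2 Phi_sum_mem_H Phi_mem_H)
  thus ?case
    by (auto simp: Suc coeff_Phi less_Suc_eq)
qed

section \<open>Bounded functionals and their coefficient sequences\<close>

lemma H_dual_linear:
  "\<phi> \<in> Hd \<Longrightarrow> y \<in> H \<Longrightarrow> z \<in> H \<Longrightarrow> \<phi> (\<lambda>x. a * y x + b * z x) = a * \<phi> y + b * \<phi> z"
  by (simp add: H_dual_def)

lemma H_dual_scale: "\<phi> \<in> Hd \<Longrightarrow> z \<in> H \<Longrightarrow> \<phi> (\<lambda>x. a * z x) = a * \<phi> z"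
  using H_dual_linear[of \<phi> z z a 0] by simp

lemma H_dual_diff: "\<phi> \<in> Hd \<Longrightarrow> y \<in> H \<Longrightarrow> z \<in> H \<Longrightarrow> \<phi> (\<lambda>x. y x - z x) = \<phi> y - \<phi> z"
  using H_dual_linear[of \<phi> y z 1 "-1"] by simp

lemma H_dual_zero: "\<phi> \<in> Hd \<Longrightarrow> \<phi> (\<lambda>_. 0) = 0"
  using H_dual_scale[OF _ zero_mem_H, of \<phi> 0] by simp

lemma H_dual_Phi_sum:
  assumes "\<phi> \<in> Hd"
  shows "\<phi> (\<lambda>x. \<Sum>k<n. b k * \<Phi> k x) = (\<Sum>k<n. b k * \<phi> (\<Phi> k))"
proof (induction n)
  case (Suc n)
  have "\<phi> (\<lambda>x. 1 * (\<Sum>k<n. b k * \<Phi> k x) + b n * \<Phi> n x) = 1 * \<phi> (\<lambda>x. \<Sum>k<n. b k * \<Phi> k x) + b n * \<phi> (\<Phi> n)"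
    by (rule H_dual_linear[OF assms Phi_sum_mem_H Phi_mem_H])
  thus ?case
    by (simp add: Suc)
qed (simp add: H_dual_zero[OF assms])

text \<open>A real \<open>SUP\<close> is informative only over a set that is bounded above; every
  use of \<open>H_dual_norm\<close> as an upper bound rests on this.\<close>

lemma H_dual_bdd_above:
  assumes "\<phi> \<in> Hd"
  shows "bdd_above ((\<lambda>z. \<bar>\<phi> z\<bar>) ` {z \<in> H. nrm z \<le> 1})"
proof -
  obtain C where C: "\<And>z. z \<in> H \<Longrightarrow> \<bar>\<phi> z\<bar> \<le> C * nrm z"
    using assms unfolding H_dual_def by blast
  \<comment> \<open>The constant in \<open>H_dual\<close> carries no sign, hence
    \<open>\<bar>C\<bar>\<close>.\<close>
  have "\<bar>\<phi> z\<bar> \<le> \<bar>C\<bar>" if "z \<in> H" "nrm z \<le> 1" for z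
  proof -
    have "\<bar>\<phi> z\<bar> \<le> \<bar>C\<bar> * nrm z"
      using C[OF that(1)] mult_right_mono[OF abs_ge_self H_norm_nonneg[OF that(1)], of C] by linarith
    also have "\<dots> \<le> \<bar>C\<bar> * 1"
      using that by (intro mult_left_mono) auto
    finally show ?thesis
      by simp
  qed
  thus ?thesis
    by (intro bdd_aboveI2[where M = "\<bar>C\<bar>"]) auto
qed

lemma H_dual_norm_nonneg:
  assumes "\<phi> \<in> Hd"
  shows "0 \<le> dnrm \<phi>"
proof -
  have "\<bar>\<phi> (\<lambda>_. 0)\<bar> \<le> dnrm \<phi>"
    unfolding H_dual_norm_def
    by (rule cSUP_upper[OF _ H_dual_bdd_above[OF assms]]) (simp add: zero_mem_H H_norm_zero)
  thus ?thesis
    by simp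
qed

lemma H_dual_norm_le:
  assumes "\<And>z. z \<in> H \<Longrightarrow> \<bar>\<phi> z\<bar> \<le> C * nrm z" "0 \<le> C"
  shows "dnrm \<phi> \<le> C"
  unfolding H_dual_norm_def
proof (rule cSUP_least)
  show "{z \<in> H. nrm z \<le> 1} \<noteq> {}"
    using zero_mem_H H_norm_zero by force
  fix z assume z: "z \<in> {z \<in> H. nrm z \<le> 1}"
  have "\<bar>\<phi> z\<bar> \<le> C * nrm z"
    using z assms(1) by blast
  also have "\<dots> \<le> C * 1"
    using z assms(2) by (intro mult_left_mono) auto
  finally show "\<bar>\<phi> z\<bar> \<le> C"
    by simp
qed

lemma H_dual_norm_bound:
  assumes "\<phi> \<in> Hd" "z \<in> H"
  shows "\<bar>\<phi> z\<bar> \<le> dnrm \<phi> * nrm z"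
proof (cases "nrm z = 0")
  \<comment> \<open>Such a \<open>z\<close> represents the zero class and cannot be rescaled to norm
    one; boundedness itself gives \<open>\<phi> z = 0\<close>.\<close>
  case True
  obtain C where "\<bar>\<phi> z\<bar> \<le> C * nrm z"
    using assms unfolding H_dual_def by blast
  thus ?thesis
    using True by simp
next
  case False
  hence pos: "0 < nrm z"
    using H_norm_nonneg[OF assms(2)] by linarith
  have "\<bar>\<phi> (\<lambda>x. inverse (nrm z) * z x)\<bar> \<le> dnrm \<phi>"
    unfolding H_dual_norm_def using pos
    by (intro cSUP_upper[OF _ H_dual_bdd_above[OF assms(1)]])
      (simp add: H_space_scale H_norm_scale assms)
  hence "\<bar>\<phi> z\<bar> / nrm z \<le> dnrm \<phi>"
    unfolding H_dual_scale[OF assms] using pos by (simp add: abs_mult divide_inverse mult.commute)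
  thus ?thesis
    using pos by (simp add: pos_divide_le_eq)
qed

lemma H_norm_tail_tendsto_0:
  assumes "z \<in> H"
  shows "(\<lambda>n. nrm (\<lambda>x. z x - (\<Sum>k<n. cf z k * \<Phi> k x))) \<longlonglongrightarrow> 0"
proof -
  let ?f = "\<lambda>k. (cf z k)\<^sup>2 * lam k powr s"
  have sm: "summable ?f"
    using assms by (rule H_space_expansion)
  have eq: "nrm (\<lambda>x. z x - (\<Sum>k<n. cf z k * \<Phi> k x)) = sqrt (suminf ?f - (\<Sum>k<n. ?f k))" for n
  proof -
    have c: "cf (\<lambda>x. z x - (\<Sum>k<n. cf z k * \<Phi> k x)) k = cf z k - (if k < n then cf z k else 0)" for k
    proof -
      have "cf (\<lambda>x. 1 * z x + (- 1) * (\<Sum>k<n. cf z k * \<Phi> k x)) k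
          = 1 * cf z k + (- 1) * cf (\<lambda>x. \<Sum>k<n. cf z k * \<Phi> k x) k"
        by (intro coeff_lincomb H_space_L2 assms Phi_sum_mem_H)
      thus ?thesis
        by (simp add: coeff_Phi_sum)
    qed
    have "(\<lambda>k. ?f k - (if k \<in> {..<n} then ?f k else 0)) sums (suminf ?f - (\<Sum>k<n. ?f k))"
      by (intro sums_diff summable_sums[OF sm] sums_If_finite_set) simp
    also have "(\<lambda>k. ?f k - (if k \<in> {..<n} then ?f k else 0))
        = (\<lambda>k. \<bar>cf (\<lambda>x. z x - (\<Sum>k<n. cf z k * \<Phi> k x)) k\<bar>\<^sup>2 * lam k powr s)"
      unfolding c by auto
    finally show ?thesis
      unfolding H_norm_def by (simp add: sums_iff)
  qed
  have "(\<lambda>n. sqrt (suminf ?f - (\<Sum>k<n. ?f k))) \<longlonglongrightarrow> sqrt (suminf ?f - suminf ?f)"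
    by (intro tendsto_real_sqrt tendsto_diff tendsto_const summable_LIMSEQ sm)
  thus ?thesis
    unfolding eq by simp
qed

text \<open>Truncated expansions converge to \<open>z\<close> in the norm of \<open>H\<close>, and
  boundedness transfers this to their values under \<open>\<phi>\<close>.\<close>

lemma H_dual_expansion:
  assumes "\<phi> \<in> Hd" "z \<in> H"
  shows "(\<lambda>k. \<phi> (\<Phi> k) * cf z k) sums \<phi> z"
proof -
  have "norm ((\<Sum>k<n. \<phi> (\<Phi> k) * cf z k) - \<phi> z) \<le> dnrm \<phi> * nrm (\<lambda>x. z x - (\<Sum>k<n. cf z k * \<Phi> k x))" for n
  proof -
    have "\<phi> (\<lambda>x. z x - (\<Sum>k<n. cf z k * \<Phi> k x)) = \<phi> z - (\<Sum>k<n. \<phi> (\<Phi> k) * cf z k)"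
      unfolding H_dual_diff[OF assms Phi_sum_mem_H] H_dual_Phi_sum[OF assms(1)]
      by (simp add: mult.commute)
    moreover have "(\<lambda>x. z x - (\<Sum>k<n. cf z k * \<Phi> k x)) \<in> H"
      using H_space_lincomb[OF assms(2) Phi_sum_mem_H, of 1 "-1"] by simp
    from H_dual_norm_bound[OF assms(1) this]
    have "\<bar>\<phi> (\<lambda>x. z x - (\<Sum>k<n. cf z k * \<Phi> k x))\<bar> \<le> dnrm \<phi> * nrm (\<lambda>x. z x - (\<Sum>k<n. cf z k * \<Phi> k x))" .
    ultimately show ?thesis
      by (simp only: real_norm_def abs_minus_commute[of _ "\<phi> z"])
  qed
  note bound = this
  have "(\<lambda>n. dnrm \<phi> * nrm (\<lambda>x. z x - (\<Sum>k<n. cf z k * \<Phi> k x))) \<longlonglongrightarrow> dnrm \<phi> * 0"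
    by (intro tendsto_mult tendsto_const H_norm_tail_tendsto_0 assms)
  hence "(\<lambda>n. dnrm \<phi> * nrm (\<lambda>x. z x - (\<Sum>k<n. cf z k * \<Phi> k x))) \<longlonglongrightarrow> 0"
    by simp
  hence "(\<lambda>n. (\<Sum>k<n. \<phi> (\<Phi> k) * cf z k) - \<phi> z) \<longlonglongrightarrow> 0"
    by (rule Lim_null_comparison[rotated]) (intro always_eventually allI bound)
  thus ?thesis
    unfolding sums_def by (rule LIM_zero_cancel)
qed

text \<open>Test \<open>\<phi>\<close> on the truncated Riesz representative \<open>?z\<close>, with
  coefficients \<open>\<phi> (\<Phi> k) * lam k powr - s\<close>: both \<open>\<phi> ?z\<close> and
  the square of \<open>nrm ?z\<close> equal the partial sum \<open>?S\<close>, so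
  \<open>nrm ?z \<le> dnrm \<phi>\<close>.\<close>

lemma H_dual_coeffs:
  assumes "\<phi> \<in> Hd"
  shows "summable (\<lambda>k. (\<phi> (\<Phi> k))\<^sup>2 * lam k powr - s)"
    and "sqrt (\<Sum>k. (\<phi> (\<Phi> k))\<^sup>2 * lam k powr - s) \<le> dnrm \<phi>"
proof -
  let ?f = "\<lambda>k. (\<phi> (\<Phi> k))\<^sup>2 * lam k powr - s"
  have le: "(\<Sum>k<n. ?f k) \<le> (dnrm \<phi>)\<^sup>2" for n
  proof -
    let ?b = "\<lambda>k. \<phi> (\<Phi> k) * lam k powr - s"
    let ?z = "\<lambda>x. \<Sum>k<n. ?b k * \<Phi> k x" and ?S = "\<Sum>k<n. ?f k"
    have "\<phi> ?z = ?S"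
      unfolding H_dual_Phi_sum[OF assms] by (simp add: power2_eq_square mult_ac)
    have "(\<lambda>k. if k \<in> {..<n} then ?f k else 0) sums ?S"
      by (intro sums_If_finite_set) simp
    also have "(\<lambda>k. if k \<in> {..<n} then ?f k else 0) = (\<lambda>k. (cf ?z k)\<^sup>2 * lam k powr s)"
    proof
      fix k
      have "lam k powr - s * lam k powr s = 1"
        using eigval_pos[of k] by (simp flip: powr_add)
      hence "(?b k)\<^sup>2 * lam k powr s = ?f k"
        by (simp add: power2_eq_square mult.assoc)
      thus "(if k \<in> {..<n} then ?f k else 0) = (cf ?z k)\<^sup>2 * lam k powr s"
        unfolding coeff_Phi_sum by simp
    qed
    finally have "(nrm ?z)\<^sup>2 = ?S"
      using H_norm_square[OF Phi_sum_mem_H] by (simp add: sums_iff)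
    moreover have "\<bar>\<phi> ?z\<bar> \<le> dnrm \<phi> * nrm ?z"
      by (intro H_dual_norm_bound assms Phi_sum_mem_H)
    ultimately have *: "nrm ?z * nrm ?z \<le> dnrm \<phi> * nrm ?z"
      unfolding \<open>\<phi> ?z = ?S\<close> by (simp add: power2_eq_square)
    have "nrm ?z \<le> dnrm \<phi>"
    proof (cases "nrm ?z = 0")
      case False
      hence "0 < nrm ?z"
        using H_norm_nonneg[OF Phi_sum_mem_H, of ?b n] by linarith
      thus ?thesis
        using * by (rule mult_right_le_imp_le[rotated])
    qed (simp add: H_dual_norm_nonneg assms)
    hence "(nrm ?z)\<^sup>2 \<le> (dnrm \<phi>)\<^sup>2"
      using H_norm_nonneg[OF Phi_sum_mem_H, of ?b n] by (intro power_mono)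
    thus ?thesis
      using \<open>(nrm ?z)\<^sup>2 = ?S\<close> by simp
  qed
  show sm: "summable ?f"
    by (rule summableI_nonneg_bounded[OF _ le]) simp
  have "suminf ?f \<le> (dnrm \<phi>)\<^sup>2"
    using sm le by (intro suminf_le_const)
  hence "sqrt (suminf ?f) \<le> sqrt ((dnrm \<phi>)\<^sup>2)"
    by (rule real_sqrt_le_mono)
  thus "sqrt (suminf ?f) \<le> dnrm \<phi>"
    using H_dual_norm_nonneg[OF assms] by simp
qed

text \<open>Inverse to reading off the coefficients \<open>\<phi> (\<Phi> k)\<close>. The value
  \<open>0\<close> off \<open>H\<close> matches \<open>H_dual\<close>, so that
  \<open>dual_of_eq\<close> is an equality in HOL.\<close>

definition dual_of :: "(nat \<Rightarrow> real) \<Rightarrow> (real \<Rightarrow> real) \<Rightarrow> real" where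
  "dual_of b z = (if z \<in> H then \<Sum>k. b k * cf z k else 0)"

lemma dual_of_eq:
  assumes "\<phi> \<in> Hd"
  shows "dual_of (\<lambda>k. \<phi> (\<Phi> k)) = \<phi>"
proof
  fix z
  show "dual_of (\<lambda>k. \<phi> (\<Phi> k)) z = \<phi> z"
    using H_dual_expansion[OF assms, of z] assms by (auto simp: dual_of_def sums_iff H_dual_def)
qed

text \<open>Cauchy-Schwarz after distributing \<open>lam k powr (- s / 2)\<close> and
  \<open>lam k powr (s / 2)\<close> over the two factors. The first claim also provides the absolute
  convergence of the trace series.\<close>

lemma dual_of_summable:
  assumes "summable (\<lambda>k. (b k)\<^sup>2 * lam k powr - s)" "z \<in> H"
  shows "summable (\<lambda>k. \<bar>b k * cf z k\<bar>)"
    and "\<bar>\<Sum>k. b k * cf z k\<bar> \<le> sqrt (\<Sum>k. (b k)\<^sup>2 * lam k powr - s) * nrm z"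
proof -
  define x where "x k = b k * lam k powr (- s / 2)" for k
  define y where "y k = cf z k * lam k powr (s / 2)" for k
  have xy: "x k * y k = b k * cf z k" and x: "(x k)\<^sup>2 = (b k)\<^sup>2 * lam k powr - s"
    and y: "(y k)\<^sup>2 = (cf z k)\<^sup>2 * lam k powr s" for k
    using eigval_pos[of k] unfolding x_def y_def
    by (simp_all add: power2_eq_square mult_ac) (simp_all add: mult.assoc[symmetric] flip: powr_add)
  have "summable (\<lambda>k. (x k)\<^sup>2)" "summable (\<lambda>k. (y k)\<^sup>2)"
    unfolding x y using assms H_space_expansion(2) by auto
  from ell2_Cauchy_Schwarz[OF this]
  show "summable (\<lambda>k. \<bar>b k * cf z k\<bar>)"
    "\<bar>\<Sum>k. b k * cf z k\<bar> \<le> sqrt (\<Sum>k. (b k)\<^sup>2 * lam k powr - s) * nrm z"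
    unfolding xy x y by (simp_all add: H_norm_def)
qed

lemma dual_of_bound:
  assumes "summable (\<lambda>k. (b k)\<^sup>2 * lam k powr - s)" "z \<in> H"
  shows "\<bar>dual_of b z\<bar> \<le> sqrt (\<Sum>k. (b k)\<^sup>2 * lam k powr - s) * nrm z"
  using dual_of_summable(2)[OF assms] assms(2) by (simp add: dual_of_def)

lemma dual_of_norm_le:
  assumes "summable (\<lambda>k. (b k)\<^sup>2 * lam k powr - s)"
  shows "dnrm (dual_of b) \<le> sqrt (\<Sum>k. (b k)\<^sup>2 * lam k powr - s)"
  by (rule H_dual_norm_le[OF dual_of_bound[OF assms]]) (auto intro!: suminf_nonneg assms)

lemma dual_of_mem:
  assumes "summable (\<lambda>k. (b k)\<^sup>2 * lam k powr - s)"
  shows "dual_of b \<in> Hd"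
  unfolding H_dual_def
proof (intro CollectI conjI ballI allI impI)
  show "\<exists>C. \<forall>z\<in>H. \<bar>dual_of b z\<bar> \<le> C * nrm z"
    using dual_of_bound[OF assms] by blast
  fix y z c d assume yz: "y \<in> H" "z \<in> H"
  have "(\<Sum>k. b k * cf (\<lambda>x. c * y x + d * z x) k) = (\<Sum>k. c * (b k * cf y k) + d * (b k * cf z k))"
    using yz by (simp add: coeff_lincomb H_space_L2 algebra_simps)
  also have "\<dots> = c * (\<Sum>k. b k * cf y k) + d * (\<Sum>k. b k * cf z k)"
    by (rule sums_unique[symmetric], intro sums_add sums_mult summable_sums)
      (rule summable_rabs_cancel[OF dual_of_summable(1)[OF assms]], fact)+
  finally show "dual_of b (\<lambda>x. c * y x + d * z x) = c * dual_of b y + d * dual_of b z"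
    using yz by (simp add: dual_of_def H_space_lincomb)
qed (simp add: dual_of_def)

lemma ell2_weighted_lincomb:
  assumes "summable (\<lambda>k. (b k)\<^sup>2 * lam k powr - s)" "summable (\<lambda>k. (c k)\<^sup>2 * lam k powr - s)"
  shows "summable (\<lambda>k. (p * b k + q * c k)\<^sup>2 * lam k powr - s)"
proof -
  have "summable (\<lambda>k. 2 * p\<^sup>2 * ((b k)\<^sup>2 * lam k powr - s) + 2 * q\<^sup>2 * ((c k)\<^sup>2 * lam k powr - s))"
    using assms by (intro summable_add summable_mult)
  thus ?thesis
  proof (rule summable_comparison_test'[where N = 0])
    fix k
    have "(p * b k + q * c k)\<^sup>2 \<le> 2 * (p * b k)\<^sup>2 + 2 * (q * c k)\<^sup>2"
      using zero_le_power2[of "p * b k - q * c k"] by (simp add: power2_sum power2_diff)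
    hence "(p * b k + q * c k)\<^sup>2 * lam k powr - s \<le> (2 * (p * b k)\<^sup>2 + 2 * (q * c k)\<^sup>2) * lam k powr - s"
      by (rule mult_right_mono) simp
    thus "norm ((p * b k + q * c k)\<^sup>2 * lam k powr - s)
        \<le> 2 * p\<^sup>2 * ((b k)\<^sup>2 * lam k powr - s) + 2 * q\<^sup>2 * ((c k)\<^sup>2 * lam k powr - s)"
      by (simp add: power_mult_distrib algebra_simps)
  qed
qed

lemma dual_of_lincomb:
  assumes "summable (\<lambda>k. (b k)\<^sup>2 * lam k powr - s)" "summable (\<lambda>k. (c k)\<^sup>2 * lam k powr - s)"
  shows "dual_of (\<lambda>k. p * b k + q * c k) = (\<lambda>z. p * dual_of b z + q * dual_of c z)"
proof
  fix z
  show "dual_of (\<lambda>k. p * b k + q * c k) z = p * dual_of b z + q * dual_of c z"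
  proof (cases "z \<in> H")
    case True
    have "(\<Sum>k. (p * b k + q * c k) * cf z k) = (\<Sum>k. p * (b k * cf z k) + q * (c k * cf z k))"
      by (simp add: algebra_simps)
    also have "\<dots> = p * (\<Sum>k. b k * cf z k) + q * (\<Sum>k. c k * cf z k)"
      by (rule sums_unique[symmetric], intro sums_add sums_mult summable_sums)
        (rule summable_rabs_cancel[OF dual_of_summable(1)[OF _ True]], fact)+
    finally show ?thesis
      using True by (simp add: dual_of_def)
  qed (simp add: dual_of_def)
qed

lemma H_dual_norm_triangle:
  assumes "\<phi> \<in> Hd" "\<psi> \<in> Hd"
  shows "dnrm (\<lambda>z. \<phi> z + \<psi> z) \<le> dnrm \<phi> + dnrm \<psi>"
proof (rule H_dual_norm_le)
  fix z assume "z \<in> H"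
  thus "\<bar>\<phi> z + \<psi> z\<bar> \<le> (dnrm \<phi> + dnrm \<psi>) * nrm z"
    using H_dual_norm_bound[OF assms(1), of z] H_dual_norm_bound[OF assms(2), of z]
    by (simp add: distrib_right)
qed (simp add: H_dual_norm_nonneg assms)

lemma H_dual_lincomb:
  assumes "\<phi> \<in> Hd" "\<psi> \<in> Hd"
  shows "(\<lambda>z. p * \<phi> z + q * \<psi> z) \<in> Hd"
proof -
  have "dual_of (\<lambda>k. p * \<phi> (\<Phi> k) + q * \<psi> (\<Phi> k)) \<in> Hd"
    by (intro dual_of_mem ell2_weighted_lincomb H_dual_coeffs assms)
  thus ?thesis
    by (simp only: dual_of_lincomb[OF H_dual_coeffs(1)[OF assms(1)] H_dual_coeffs(1)[OF assms(2)]] dual_of_eq assms)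
qed

text \<open>The norm of a difference is at most the root of \<open>\<Sum>k. f k r\<close>, whose
  terms are dominated by \<open>4 * ((B k)^2 * lam k powr - s)\<close> uniformly in
  \<open>r\<close>. By the Weierstrass test this sum is continuous in \<open>r\<close>, and it
  vanishes at \<open>r = t\<close>.\<close>

lemma continuous_in_dual_dual_of:
  assumes cont: "\<And>k. continuous_on {0..T} (\<lambda>t. b t k)"
    and bound: "\<And>t k. t \<in> {0..T} \<Longrightarrow> \<bar>b t k\<bar> \<le> B k"
    and B: "summable (\<lambda>k. (B k)\<^sup>2 * lam k powr - s)"
  shows "continuous_in_dual \<alpha> \<beta> \<mu> s T (\<lambda>t. dual_of (b t))"
  unfolding continuous_in_dual_def
proof (intro conjI ballI)
  have sm: "summable (\<lambda>k. (b t k)\<^sup>2 * lam k powr - s)" if "t \<in> {0..T}" for t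
  proof (rule summable_comparison_test'[OF B, where N = 0])
    fix k
    have "(b t k)\<^sup>2 \<le> (B k)\<^sup>2"
      using bound[OF that, of k] by (simp add: abs_le_square_iff[symmetric])
    thus "norm ((b t k)\<^sup>2 * lam k powr - s) \<le> (B k)\<^sup>2 * lam k powr - s"
      by (simp add: mult_right_mono)
  qed
  show "dual_of (b t) \<in> Hd" if "t \<in> {0..T}" for t
    using sm[OF that] by (rule dual_of_mem)
  fix t assume t: "t \<in> {0..T}"
  define f where "f k r = (b r k - b t k)\<^sup>2 * lam k powr - s" for k r
  have f_bound: "norm (f k r) \<le> 4 * ((B k)\<^sup>2 * lam k powr - s)" if r: "r \<in> {0..T}" for k r
  proof -
    have "\<bar>b r k - b t k\<bar> \<le> 2 * B k"
      using bound[OF r, of k] bound[OF t, of k] by linarith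
    hence "(b r k - b t k)\<^sup>2 \<le> (2 * B k)\<^sup>2"
      by (intro abs_le_square_iff[THEN iffD1]) linarith
    hence "(b r k - b t k)\<^sup>2 * lam k powr - s \<le> (2 * B k)\<^sup>2 * lam k powr - s"
      by (rule mult_right_mono) simp
    thus ?thesis
      by (simp add: f_def power_mult_distrib)
  qed
  have "uniform_limit {0..T} (\<lambda>n r. \<Sum>k<n. f k r) (\<lambda>r. \<Sum>k. f k r) sequentially"
    by (rule Weierstrass_m_test[OF f_bound summable_mult[OF B]])
  moreover have "\<forall>\<^sub>F n in sequentially. continuous_on {0..T} (\<lambda>r. \<Sum>k<n. f k r)"
    unfolding f_def by (intro always_eventually allI continuous_intros cont)
  ultimately have "continuous_on {0..T} (\<lambda>r. \<Sum>k. f k r)"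
    by (intro uniform_limit_theorem) auto
  hence "continuous_on {0..T} (\<lambda>r. sqrt (\<Sum>k. f k r))"
    by (rule continuous_on_real_sqrt)
  hence "((\<lambda>r. sqrt (\<Sum>k. f k r)) \<longlongrightarrow> sqrt (\<Sum>k. f k t)) (at t within {0..T})"
    using t by (auto simp: continuous_on_def)
  hence lim: "((\<lambda>r. sqrt (\<Sum>k. f k r)) \<longlongrightarrow> 0) (at t within {0..T})"
    by (simp add: f_def)
  have le: "norm (dnrm (\<lambda>z. dual_of (b r) z - dual_of (b t) z)) \<le> sqrt (\<Sum>k. f k r)" if r: "r \<in> {0..T}" for r
  proof -
    have eq: "(\<lambda>z. dual_of (b r) z - dual_of (b t) z) = dual_of (\<lambda>k. b r k - b t k)"
      using dual_of_lincomb[OF sm[OF r] sm[OF t], of 1 "-1"] by simp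
    have s': "summable (\<lambda>k. (b r k - b t k)\<^sup>2 * lam k powr - s)"
      using ell2_weighted_lincomb[OF sm[OF r] sm[OF t], of 1 "-1"] by simp
    show ?thesis
      unfolding eq f_def using dual_of_norm_le[OF s'] H_dual_norm_nonneg[OF dual_of_mem[OF s']] by simp
  qed
  show "((\<lambda>r. dnrm (\<lambda>z. dual_of (b r) z - dual_of (b t) z)) \<longlongrightarrow> 0) (at t within {0..T})"
    by (rule Lim_null_comparison[OF _ lim]) (use le in \<open>auto simp: eventually_at_filter\<close>)
qed

end

section \<open>Orthonormality of the eigenfunctions\<close>

lemma weight_measurable: "(\<lambda>x::real. x powr \<beta>) \<in> borel_measurable (lebesgue_on {0<..<1})"
  by (rule continuous_imp_measurable_on_sets_lebesgue) (auto intro!: continuous_intros)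

lemma measurable_weighted: "f \<in> borel_measurable (weighted \<beta>) \<longleftrightarrow> f \<in> borel_measurable (lebesgue_on {0<..<1})"
  unfolding weighted_def by simp

lemma integrable_weighted:
  fixes f :: "real \<Rightarrow> real"
  assumes "f \<in> borel_measurable (lebesgue_on {0<..<1})"
  shows "integrable (weighted \<beta>) f \<longleftrightarrow> integrable (lebesgue_on {0<..<1}) (\<lambda>x. x powr \<beta> * f x)"
  unfolding weighted_def using integrable_density[OF assms weight_measurable] by simp

lemma integral_weighted:
  fixes f :: "real \<Rightarrow> real"
  assumes "f \<in> borel_measurable (lebesgue_on {0<..<1})"
  shows "(LINT x|weighted \<beta>. f x) = (LINT x|lebesgue_on {0<..<1}. x powr \<beta> * f x)"
  unfolding weighted_def using integral_density[OF assms weight_measurable] by simp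

text \<open>The weight is positive on the open interval, so both measures have the same null
  sets.\<close>

lemma AE_weighted: "(AE x in weighted \<beta>. P x) \<longleftrightarrow> (AE x in lebesgue_on {0<..<1}. P x)"
proof -
  have "(AE x in weighted \<beta>. P x) \<longleftrightarrow> (AE x in lebesgue_on {0<..<1}. 0 < ennreal (x powr \<beta>) \<longrightarrow> P x)"
    unfolding weighted_def by (rule AE_density[OF measurable_compose[OF weight_measurable measurable_ennreal]])
  also have "\<dots> \<longleftrightarrow> (AE x in lebesgue_on {0<..<1}. P x)"
    by (rule AE_cong) auto
  finally show ?thesis .
qed

text \<open>The closed form of \<open>Phi\<close> holds for \<open>x > 0\<close> only, and the
  measure lives on the open unit interval.\<close>

lemma L2_cong_on:
  assumes "f \<in> L2 (weighted \<beta>)" "\<And>x. 0 < x \<Longrightarrow> x < 1 \<Longrightarrow> f x = g x"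
  shows "g \<in> L2 (weighted \<beta>)"
proof -
  have sp: "space (weighted \<beta>) = {0<..<1}"
    by (simp add: weighted_def)
  have "g \<in> borel_measurable (weighted \<beta>) \<longleftrightarrow> f \<in> borel_measurable (weighted \<beta>)"
    using assms(2) by (intro measurable_cong) (auto simp: sp)
  moreover have "integrable (weighted \<beta>) (\<lambda>x. (g x)\<^sup>2) \<longleftrightarrow> integrable (weighted \<beta>) (\<lambda>x. (f x)\<^sup>2)"
    using assms(2) by (intro Bochner_Integration.integrable_cong) (auto simp: sp)
  ultimately show ?thesis
    using assms(1) by (simp add: L2_def)
qed

lemma integral_weighted_cong:
  fixes f g :: "real \<Rightarrow> real"
  assumes "\<And>x. 0 < x \<Longrightarrow> x < 1 \<Longrightarrow> f x = g x"
  shows "(LINT x|weighted \<beta>. f x) = (LINT x|weighted \<beta>. g x)"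
  using assms by (intro Bochner_Integration.integral_cong) (auto simp: weighted_def)

lemma integral_weighted_eq:
  fixes f :: "real \<Rightarrow> real"
  assumes f: "integrable (weighted \<beta>) f"
    and I: "((\<lambda>x. x powr \<beta> * f x) has_integral I) {0<..<1}"
  shows "(LINT x|weighted \<beta>. f x) = I"
proof -
  have m: "f \<in> borel_measurable (lebesgue_on {0<..<1})"
    using f measurable_weighted by blast
  hence "integrable (lebesgue_on {0<..<1}) (\<lambda>x. x powr \<beta> * f x)"
    using f by (simp add: integrable_weighted)
  hence "(LINT x|lebesgue_on {0<..<1}. x powr \<beta> * f x) = integral {0<..<1} (\<lambda>x. x powr \<beta> * f x)"
    by (rule lebesgue_integral_eq_integral) simp
  thus ?thesis
    using m I by (simp add: integral_weighted integral_unique)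
qed

text \<open>Nonnegativity of the square upgrades gauge integrability to Lebesgue integrability, so
  an explicit primitive is enough to establish membership.\<close>

lemma L2_weightedI:
  fixes f :: "real \<Rightarrow> real"
  assumes "continuous_on {0<..<1} f" "(\<lambda>x. x powr \<beta> * (f x)\<^sup>2) integrable_on {0<..<1}"
  shows "f \<in> L2 (weighted \<beta>)"
proof -
  have m: "f \<in> borel_measurable (lebesgue_on {0<..<1})"
    using assms(1) by (rule continuous_imp_measurable_on_sets_lebesgue) simp
  have "(\<lambda>x. x powr \<beta> * (f x)\<^sup>2) absolutely_integrable_on {0<..<1}"
    using assms(2) by (rule nonnegative_absolutely_integrable_1) simp
  hence "integrable (lebesgue_on {0<..<1}) (\<lambda>x. x powr \<beta> * (f x)\<^sup>2)"
    by (rule absolutely_integrable_imp_integrable) simp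
  moreover have "(\<lambda>x. (f x)\<^sup>2) \<in> borel_measurable (lebesgue_on {0<..<1})"
    using m by measurable
  ultimately show ?thesis
    using m by (simp add: L2_def integrable_weighted measurable_weighted)
qed

section \<open>Eigenfunctions through the entire part, and their normalisation\<close>

locale bessel_heat =
  fixes \<alpha> \<beta> \<mu> s :: real
  assumes alpha: "\<alpha> < 2" and alpha_beta: "\<alpha> + \<beta> < 1"
    and mu: "\<mu> < mu_crit (\<alpha> + \<beta>)" and s: "nu \<alpha> \<beta> \<mu> < s"
begin

abbreviation "\<kappa> \<equiv> kappa \<alpha>"
abbreviation "\<nu> \<equiv> nu \<alpha> \<beta> \<mu>"

text \<open>Leading exponent of every \<open>Phi\<close> at \<open>0\<close>, since
  \<open>bessel_E \<nu> 0\<close> is positive.\<close>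

definition pexp :: real where
  "pexp = (1 - \<alpha> - \<beta>) / 2 + \<kappa> * \<nu>"

text \<open>The positive zeros of \<open>bessel_E \<nu>\<close> in its own variable, because
  \<open>bessel_J\<close> evaluates it at \<open>x^2 / 4\<close>.\<close>

definition rho :: "nat \<Rightarrow> real" where
  "rho k = (bessel_zero \<nu> k)\<^sup>2 / 4"

text \<open>The constant in \<open>Phi\<close> once the derivative is rewritten by
  \<open>deriv_bessel_J_at_zero\<close>: the factor \<open>(j / 2) powr \<nu>\<close> there cancels
  against the one in the Bessel function.\<close>

definition amp :: "nat \<Rightarrow> real" where
  "amp k = sqrt (2 * \<kappa>) / (bessel_zero \<nu> k / 2 * \<bar>bessel_E (\<nu> + 1) (rho k)\<bar>)"

lemma kappa_pos: "0 < \<kappa>"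
  using alpha by (simp add: kappa_def)

lemma nu_pos: "0 < \<nu>"
  using kappa_pos mu by (simp add: nu_def)

lemma nu_gt: "- 1 < \<nu>"
  using nu_pos by simp

lemma pexp_pos: "0 < pexp"
  using alpha_beta kappa_pos nu_pos by (simp add: pexp_def add_pos_pos)

lemma gam_eq: "gam \<alpha> \<beta> \<mu> = (1 - \<alpha> - \<beta>) / 2 - \<kappa> * \<nu>"
proof -
  have "sqrt (mu_crit (\<alpha> + \<beta>)) = (1 - \<alpha> - \<beta>) / 2"
    using alpha_beta by (simp add: mu_crit_def real_sqrt_divide)
  thus ?thesis
    using kappa_pos by (simp add: gam_def nu_def)
qed

text \<open>The weight of the trace thus cancels exactly the \<open>x powr (pexp - 1)\<close> that
  differentiation produces.\<close>

lemma trace_exponent: "\<alpha> + \<beta> + gam \<alpha> \<beta> \<mu> = 1 - pexp"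
  by (simp add: gam_eq pexp_def field_simps)

text \<open>The exponent count for \<open>y = x powr (2 * \<kappa>)\<close>: it turns
  \<open>x powr (\<beta> + 2 * pexp) dx\<close> into
  \<open>y powr \<nu> dy / (2 * \<kappa>)\<close>.\<close>

lemma weight_exponent: "\<beta> + 2 * pexp = 2 * \<kappa> * \<nu> + (2 * \<kappa> - 1)"
  by (simp add: pexp_def kappa_def field_simps)

lemma rho_pos: "0 < rho k"
  using bessel_zero_pos[OF nu_gt, of k] by (simp add: rho_def)

lemma bessel_E_rho: "bessel_E \<nu> (rho k) = 0"
  using bessel_J_bessel_zero[OF nu_gt, of k] bessel_zero_pos[OF nu_gt, of k]
  by (simp add: bessel_J_eq_0_iff nu_gt rho_def)

lemma bessel_E1_rho: "bessel_E (\<nu> + 1) (rho k) \<noteq> 0"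
  by (rule bessel_E_zeros_simple[OF nu_gt rho_pos bessel_E_rho])

lemma rho_inj: "rho k = rho l \<Longrightarrow> k = l"
  using bessel_zero_pos[OF nu_gt] strict_mono_eq[OF bessel_zero(1)[OF nu_gt]]
  by (simp add: rho_def power2_eq_iff_nonneg less_imp_le)

lemma eigval_eq: "eigval \<alpha> \<beta> \<mu> k = 4 * \<kappa>\<^sup>2 * rho k"
  by (simp add: eigval_def rho_def)

lemma amp_pos: "0 < amp k"
  using kappa_pos bessel_zero_pos[OF nu_gt, of k] bessel_E1_rho[of k] by (simp add: amp_def)

lemma amp_square: "(amp k)\<^sup>2 = 2 * \<kappa> / (rho k * (bessel_E (\<nu> + 1) (rho k))\<^sup>2)"
  using kappa_pos by (simp add: amp_def power_divide power_mult_distrib rho_def)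

lemma Phi_eq:
  assumes "0 < x"
  shows "Phi \<alpha> \<beta> \<mu> k x = amp k * (x powr pexp * bessel_E \<nu> (rho k * x powr (2 * \<kappa>)))"
proof -
  let ?j = "bessel_zero \<nu> k"
  have j: "0 < ?j" "bessel_J \<nu> ?j = 0"
    using nu_gt by (auto simp: bessel_zero_pos bessel_J_bessel_zero)
  have J: "bessel_J \<nu> (?j * x powr \<kappa>) = (?j / 2) powr \<nu> * x powr (\<kappa> * \<nu>) * bessel_E \<nu> (rho k * x powr (2 * \<kappa>))"
  proof -
    have "(?j * x powr \<kappa> / 2) powr \<nu> = (?j / 2) powr \<nu> * x powr (\<kappa> * \<nu>)"
      using j assms powr_mult[of "?j / 2" "x powr \<kappa>" \<nu>] by (simp add: powr_powr)
    moreover have "(?j * x powr \<kappa>)\<^sup>2 / 4 = rho k * x powr (2 * \<kappa>)"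
      using assms by (simp add: rho_def power_mult_distrib power2_eq_square mult_ac flip: powr_add)
    ultimately show ?thesis
      using j assms nu_gt by (simp add: bessel_J_eq)
  qed
  have d: "\<bar>deriv (bessel_J \<nu>) ?j\<bar> = (?j / 2) powr \<nu> * (?j / 2 * \<bar>bessel_E (\<nu> + 1) (rho k)\<bar>)"
    using j nu_gt by (simp add: deriv_bessel_J_at_zero rho_def abs_mult powr_add)
  have x: "x powr ((1 - \<alpha> - \<beta>) / 2) * x powr (\<kappa> * \<nu>) = x powr pexp"
    by (simp add: pexp_def flip: powr_add)
  have "Phi \<alpha> \<beta> \<mu> k x = sqrt (2 * \<kappa>) / ((?j / 2) powr \<nu> * (?j / 2 * \<bar>bessel_E (\<nu> + 1) (rho k)\<bar>))
      * x powr ((1 - \<alpha> - \<beta>) / 2)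
      * ((?j / 2) powr \<nu> * x powr (\<kappa> * \<nu>) * bessel_E \<nu> (rho k * x powr (2 * \<kappa>)))"
    unfolding Phi_def Let_def J d ..
  also have "\<dots> = amp k * ((x powr ((1 - \<alpha> - \<beta>) / 2) * x powr (\<kappa> * \<nu>)) * bessel_E \<nu> (rho k * x powr (2 * \<kappa>)))"
    using j by (simp add: amp_def)
  finally show ?thesis
    unfolding x .
qed

text \<open>The change of variables is made in the primitive: \<open>F\<close> is continuous on the
  closed interval but need not be differentiable at \<open>0\<close>, hence the interior form of the
  fundamental theorem.\<close>

lemma substitution_integral:
  assumes P: "continuous_on {0..1} P"
    and D: "\<And>y. 0 < y \<Longrightarrow> (P has_real_derivative y powr \<nu> * g y) (at y)"
  shows "((\<lambda>x. x powr \<beta> * ((x powr pexp)\<^sup>2 * g (x powr (2 * \<kappa>)))) has_integral (P 1 - P 0) / (2 * \<kappa>)) {0<..<1}"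
proof -
  define F where "F x = P (x powr (2 * \<kappa>)) / (2 * \<kappa>)" for x
  have "((\<lambda>x. x powr \<beta> * ((x powr pexp)\<^sup>2 * g (x powr (2 * \<kappa>)))) has_integral (F 1 - F 0)) {0..1}"
  proof (rule fundamental_theorem_of_calculus_interior)
    have "continuous_on {0..1::real} (\<lambda>x. x powr (2 * \<kappa>))"
      using kappa_pos by (intro continuous_on_powr' continuous_intros) auto
    moreover have "(\<lambda>x. x powr (2 * \<kappa>)) ` {0..1::real} \<subseteq> {0..1}"
    proof clarsimp
      fix x :: real assume "0 \<le> x" "x \<le> 1"
      thus "x powr (2 * \<kappa>) \<le> 1"
        using powr_mono2[of "2 * \<kappa>" x 1] kappa_pos by simp
    qed
    ultimately have "continuous_on {0..1} (\<lambda>x. P (x powr (2 * \<kappa>)))"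
      by (rule continuous_on_compose2[OF P])
    thus "continuous_on {0..1} F"
      unfolding F_def using kappa_pos by (intro continuous_on_divide continuous_on_const) auto
    fix x :: real assume x: "x \<in> {0<..<1}"
    hence x0: "0 < x"
      by simp
    have "((\<lambda>x. x powr (2 * \<kappa>)) has_real_derivative 2 * \<kappa> * x powr (2 * \<kappa> - 1)) (at x)"
      using x0 by (rule has_real_derivative_powr)
    moreover have "(P has_real_derivative (x powr (2 * \<kappa>)) powr \<nu> * g (x powr (2 * \<kappa>))) (at (x powr (2 * \<kappa>)))"
      using x0 by (intro D) simp
    ultimately have "(F has_real_derivative ((x powr (2 * \<kappa>)) powr \<nu> * g (x powr (2 * \<kappa>))) * (2 * \<kappa> * x powr (2 * \<kappa> - 1)) / (2 * \<kappa>)) (at x)"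
      unfolding F_def[abs_def] by (intro DERIV_cdivide) (rule DERIV_chain2)
    also have "((x powr (2 * \<kappa>)) powr \<nu> * g (x powr (2 * \<kappa>))) * (2 * \<kappa> * x powr (2 * \<kappa> - 1)) / (2 * \<kappa>)
        = (x powr (2 * \<kappa> * \<nu>) * x powr (2 * \<kappa> - 1)) * g (x powr (2 * \<kappa>))"
      unfolding powr_powr using kappa_pos by simp
    also have "x powr (2 * \<kappa> * \<nu>) * x powr (2 * \<kappa> - 1) = x powr \<beta> * (x powr pexp * x powr pexp)"
      unfolding powr_add[symmetric] by (rule arg_cong[of _ _ "\<lambda>e. x powr e"]) (use weight_exponent in simp)
    also have "x powr \<beta> * (x powr pexp * x powr pexp) * g (x powr (2 * \<kappa>)) = x powr \<beta> * ((x powr pexp)\<^sup>2 * g (x powr (2 * \<kappa>)))"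
      by (simp only: power2_eq_square mult.assoc)
    finally show "(F has_vector_derivative x powr \<beta> * ((x powr pexp)\<^sup>2 * g (x powr (2 * \<kappa>)))) (at x)"
      by (simp add: has_real_derivative_iff_has_vector_derivative)
  qed simp
  moreover have "F 1 - F 0 = (P 1 - P 0) / (2 * \<kappa>)"
    using kappa_pos by (simp add: F_def diff_divide_distrib)
  ultimately show ?thesis
    by (simp add: has_integral_Icc_iff_Ioo)
qed

text \<open>Lommel's primitive vanishes at \<open>0\<close> because of its power factor; at
  \<open>1\<close> only the square of \<open>bessel_E (\<nu> + 1)\<close> remains, as
  \<open>rho k\<close> is a zero of \<open>bessel_E \<nu>\<close>.\<close>

lemma norm_integral:
  "((\<lambda>x. x powr \<beta> * (x powr pexp * bessel_E \<nu> (rho k * x powr (2 * \<kappa>)))\<^sup>2) has_integral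
     rho k * (bessel_E (\<nu> + 1) (rho k))\<^sup>2 / (2 * \<kappa>)) {0<..<1}"
proof -
  define P where "P y = y powr (\<nu> + 1) * (rho k * y * (bessel_E (\<nu> + 1) (rho k * y))\<^sup>2
      + (bessel_E \<nu> (rho k * y))\<^sup>2 - \<nu> * bessel_E \<nu> (rho k * y) * bessel_E (\<nu> + 1) (rho k * y))" for y
  have "continuous_on {0..1} P"
    unfolding P_def using nu_pos by (intro continuous_intros continuous_on_powr') auto
  moreover have "(P has_real_derivative y powr \<nu> * (bessel_E \<nu> (rho k * y))\<^sup>2) (at y)" if "0 < y" for y
    unfolding P_def by (rule bessel_E_norm_primitive[OF nu_gt that])
  ultimately have "((\<lambda>x. x powr \<beta> * ((x powr pexp)\<^sup>2 * (bessel_E \<nu> (rho k * x powr (2 * \<kappa>)))\<^sup>2)) has_integral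
      (P 1 - P 0) / (2 * \<kappa>)) {0<..<1}"
    by (rule substitution_integral)
  thus ?thesis
    using nu_pos by (simp add: P_def bessel_E_rho power_mult_distrib)
qed

text \<open>The Wronskian primitive vanishes at both ends: at \<open>0\<close> through the power
  factor, at \<open>1\<close> because \<open>rho k\<close> and \<open>rho l\<close> are zeros.
  Distinctness of the zeros allows division by \<open>rho l - rho k\<close>.\<close>

lemma orthogonality_integral:
  assumes "k \<noteq> l"
  shows "((\<lambda>x. x powr \<beta> * ((x powr pexp * bessel_E \<nu> (rho k * x powr (2 * \<kappa>)))
      * (x powr pexp * bessel_E \<nu> (rho l * x powr (2 * \<kappa>))))) has_integral 0) {0<..<1}"
proof -
  define P where "P y = y powr (\<nu> + 1) * (rho l * bessel_E \<nu> (rho k * y) * bessel_E (\<nu> + 1) (rho l * y)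
      - rho k * bessel_E (\<nu> + 1) (rho k * y) * bessel_E \<nu> (rho l * y))" for y
  have ne: "rho l - rho k \<noteq> 0"
    using assms rho_inj by force
  have "continuous_on {0..1} P"
    unfolding P_def using nu_pos by (intro continuous_intros continuous_on_powr') auto
  moreover have "(P has_real_derivative y powr \<nu> * ((rho l - rho k) * (bessel_E \<nu> (rho k * y) * bessel_E \<nu> (rho l * y)))) (at y)"
    if "0 < y" for y
    using bessel_E_orthogonality_primitive[OF nu_gt that, of "rho l" "rho k"]
    unfolding P_def by (simp add: mult.left_commute)
  ultimately have "((\<lambda>x. x powr \<beta> * ((x powr pexp)\<^sup>2 * ((rho l - rho k) * (bessel_E \<nu> (rho k * x powr (2 * \<kappa>)) * bessel_E \<nu> (rho l * x powr (2 * \<kappa>))))))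
      has_integral (P 1 - P 0) / (2 * \<kappa>)) {0<..<1}"
    by (rule substitution_integral)
  moreover have "P 1 = 0" "P 0 = 0"
    using nu_pos by (auto simp: P_def bessel_E_rho)
  ultimately have "((\<lambda>x. (1 / (rho l - rho k)) * (x powr \<beta> * ((x powr pexp)\<^sup>2 * ((rho l - rho k) * (bessel_E \<nu> (rho k * x powr (2 * \<kappa>)) * bessel_E \<nu> (rho l * x powr (2 * \<kappa>)))))))
      has_integral (1 / (rho l - rho k)) * 0) {0<..<1}"
    by (intro has_integral_mult_right) simp
  thus ?thesis
    using ne by (simp add: power2_eq_square mult_ac)
qed

lemma mode_continuous: "continuous_on {0<..<1} (\<lambda>x. x powr pexp * bessel_E \<nu> (rho k * x powr (2 * \<kappa>)))"
  by (intro continuous_intros nu_gt) auto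

lemma mode_L2: "(\<lambda>x. x powr pexp * bessel_E \<nu> (rho k * x powr (2 * \<kappa>))) \<in> L2 (weighted \<beta>)"
  using norm_integral by (intro L2_weightedI mode_continuous) (auto simp: integrable_on_def)

lemma Phi_mem_L2: "Phi \<alpha> \<beta> \<mu> k \<in> L2 (weighted \<beta>)"
  by (rule L2_cong_on[OF L2_scale[OF mode_L2[of k], of "amp k"]]) (simp add: Phi_eq)

lemma Phi_orthonormal:
  "L2_inner (weighted \<beta>) (Phi \<alpha> \<beta> \<mu> k) (Phi \<alpha> \<beta> \<mu> l) = (if k = l then 1 else 0)"
proof -
  let ?m = "\<lambda>k x. x powr pexp * bessel_E \<nu> (rho k * x powr (2 * \<kappa>))"
  have "L2_inner (weighted \<beta>) (Phi \<alpha> \<beta> \<mu> k) (Phi \<alpha> \<beta> \<mu> l)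
      = (LINT x|weighted \<beta>. (amp k * amp l) * (?m k x * ?m l x))"
    unfolding L2_inner_def by (rule integral_weighted_cong) (simp add: Phi_eq)
  also have "\<dots> = amp k * amp l * (LINT x|weighted \<beta>. ?m k x * ?m l x)"
    by simp
  also have "(LINT x|weighted \<beta>. ?m k x * ?m l x)
      = (if k = l then rho k * (bessel_E (\<nu> + 1) (rho k))\<^sup>2 / (2 * \<kappa>) else 0)"
    using norm_integral[of k] orthogonality_integral[of k l]
    by (intro integral_weighted_eq L2_mult_integrable mode_L2) (auto simp: power2_eq_square)
  finally have *: "L2_inner (weighted \<beta>) (Phi \<alpha> \<beta> \<mu> k) (Phi \<alpha> \<beta> \<mu> l)
      = amp k * amp l * (if k = l then rho k * (bessel_E (\<nu> + 1) (rho k))\<^sup>2 / (2 * \<kappa>) else 0)" .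
  have "(amp k)\<^sup>2 * (rho k * (bessel_E (\<nu> + 1) (rho k))\<^sup>2 / (2 * \<kappa>)) = 1"
    unfolding amp_square using rho_pos[of k] bessel_E1_rho[of k] kappa_pos by simp
  thus ?thesis
    unfolding * by (auto simp: power2_eq_square)
qed

sublocale spectral_scale \<alpha> \<beta> \<mu> s
proof
  show "0 < eigval \<alpha> \<beta> \<mu> k" for k
    using rho_pos[of k] kappa_pos by (simp add: eigval_eq)
qed (rule Phi_mem_L2 Phi_orthonormal)+

end

section \<open>Smoothness and the boundary trace\<close>

text \<open>The class \<open>x^q G(x^r)\<close> with real exponents and, in all uses, entire
  \<open>G\<close>. Differentiation preserves it with the same \<open>r\<close>, so smoothness
  becomes an induction and the trace a limit of a power series.\<close>

definition power_series_fun :: "(nat \<Rightarrow> real) \<Rightarrow> real \<Rightarrow> real \<Rightarrow> real \<Rightarrow> real" where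
  "power_series_fun h q r x = x powr q * (\<Sum>m. h m * (x powr r) ^ m)"

lemma power_series_fun_deriv:
  fixes h :: "nat \<Rightarrow> real" and q r x :: real
  assumes h: "\<And>y. summable (\<lambda>m. h m * y ^ m)" and x: "0 < x"
  shows "(power_series_fun h q r has_real_derivative
      power_series_fun (\<lambda>m. (q + r * real m) * h m) (q - 1) r x) (at x)"
    and "summable (\<lambda>m. (q + r * real m) * h m * y ^ m)"
proof -
  define h' where "h' m = (q + r * real m) * h m" for m
  \<comment> \<open>Multiplying the coefficients by \<open>q + r * real m\<close> applies the Euler
    operator \<open>q + r y d/dy\<close> to the series; the zero term at \<open>m = 0\<close>
    absorbs the index shift in \<open>diffs\<close>.\<close>
  have sums: "(\<lambda>m. h' m * y ^ m) sums (q * (\<Sum>m. h m * y ^ m) + r * (y * (\<Sum>m. diffs h m * y ^ m)))" for y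
  proof -
    have "(\<lambda>m. y * (diffs h m * y ^ m)) sums (y * (\<Sum>m. diffs h m * y ^ m))"
      by (intro sums_mult summable_sums termdiff_converges_all h)
    also have "(\<lambda>m. y * (diffs h m * y ^ m)) = (\<lambda>m. real (Suc m) * h (Suc m) * y ^ Suc m)"
      by (simp add: diffs_def mult_ac)
    finally have "(\<lambda>m. real m * h m * y ^ m) sums (y * (\<Sum>m. diffs h m * y ^ m))"
      using sums_Suc[of "\<lambda>m. real m * h m * y ^ m"] by simp
    hence "(\<lambda>m. q * (h m * y ^ m) + r * (real m * h m * y ^ m)) sums
        (q * (\<Sum>m. h m * y ^ m) + r * (y * (\<Sum>m. diffs h m * y ^ m)))"
      by (intro sums_add sums_mult summable_sums h)
    thus ?thesis
      by (simp add: h'_def algebra_simps)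
  qed
  show "summable (\<lambda>m. (q + r * real m) * h m * y ^ m)"
    using sums[of y] unfolding h'_def by (rule sums_summable)
  let ?G = "\<lambda>y. \<Sum>m. h m * y ^ m" and ?G' = "\<lambda>y. \<Sum>m. diffs h m * y ^ m"
  have "((\<lambda>x. ?G (x powr r)) has_real_derivative ?G' (x powr r) * (r * x powr (r - 1))) (at x)"
    by (rule DERIV_chain2[OF termdiffs_strong_converges_everywhere[OF h] has_real_derivative_powr[OF x]])
  from DERIV_mult[OF has_real_derivative_powr[OF x, of q] this]
  have "(power_series_fun h q r has_real_derivative
      q * x powr (q - 1) * ?G (x powr r) + ?G' (x powr r) * (r * x powr (r - 1)) * x powr q) (at x)"
    unfolding power_series_fun_def[abs_def] by simp
  also have "q * x powr (q - 1) * ?G (x powr r) + ?G' (x powr r) * (r * x powr (r - 1)) * x powr q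
      = x powr (q - 1) * (q * ?G (x powr r) + r * (x powr r * ?G' (x powr r)))"
  proof -
    have "x powr (r - 1) * x powr q = x powr (q - 1) * x powr r"
      by (simp add: algebra_simps flip: powr_add)
    thus ?thesis
      by (simp add: algebra_simps)
  qed
  also have "\<dots> = power_series_fun h' (q - 1) r x"
    using sums[of "x powr r"] by (simp add: power_series_fun_def sums_iff)
  finally show "(power_series_fun h q r has_real_derivative
      power_series_fun (\<lambda>m. (q + r * real m) * h m) (q - 1) r x) (at x)"
    unfolding h'_def .
qed

text \<open>The induction carries the form of the \<open>n\<close>th derivative on
  \<open>x > 0\<close>; coefficients and exponent are existential because each differentiation
  changes both.\<close>

lemma smooth_power_series_fun:
  assumes "\<And>y. summable (\<lambda>m. h m * y ^ m)"
  shows "smooth_on_unit (power_series_fun h q r)"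
proof -
  have ex: "\<exists>h' q'. (\<forall>y. summable (\<lambda>m. h' m * y ^ m)) \<and>
      (\<forall>x>0. (deriv ^^ n) (power_series_fun h q r) x = power_series_fun h' q' r x)" for n
  proof (induction n)
    case 0
    show ?case
      using assms by (intro exI[of _ h] exI[of _ q]) simp
  next
    case (Suc n)
    then obtain h' q' where h': "\<And>y. summable (\<lambda>m. h' m * y ^ m)"
      "\<And>x. 0 < x \<Longrightarrow> (deriv ^^ n) (power_series_fun h q r) x = power_series_fun h' q' r x"
      by blast
    define h'' where "h'' m = (q' + r * real m) * h' m" for m
    have "deriv ((deriv ^^ n) (power_series_fun h q r)) x = power_series_fun h'' (q' - 1) r x" if x: "0 < x" for x
    proof (rule DERIV_imp_deriv)
      have "(power_series_fun h' q' r has_real_derivative power_series_fun h'' (q' - 1) r x) (at x)"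
        unfolding h''_def by (rule power_series_fun_deriv(1)[OF h'(1) x])
      thus "((deriv ^^ n) (power_series_fun h q r) has_real_derivative power_series_fun h'' (q' - 1) r x) (at x)"
        by (rule has_field_derivative_transform_within_open[where S = "{0<..}"]) (use x h'(2) in auto)
    qed
    moreover have "summable (\<lambda>m. h'' m * y ^ m)" for y
      unfolding h''_def by (rule power_series_fun_deriv(2)[OF h'(1) zero_less_one])
    ultimately show ?case
      by (intro exI[of _ h''] exI[of _ "q' - 1"]) simp
  qed
  have "(deriv ^^ n) (power_series_fun h q r) differentiable (at x)" if x: "0 < x" for n x
  proof -
    obtain h' q' where h': "\<And>y. summable (\<lambda>m. h' m * y ^ m)"
      "\<And>x. 0 < x \<Longrightarrow> (deriv ^^ n) (power_series_fun h q r) x = power_series_fun h' q' r x"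
      using ex[of n] by blast
    have "((deriv ^^ n) (power_series_fun h q r) has_real_derivative
        power_series_fun (\<lambda>m. (q' + r * real m) * h' m) (q' - 1) r x) (at x)"
      using power_series_fun_deriv(1)[OF h'(1) x, of q' r]
      by (rule has_field_derivative_transform_within_open[where S = "{0<..}"]) (use x h'(2) in auto)
    thus ?thesis
      unfolding real_differentiable_def by blast
  qed
  thus ?thesis
    by (simp add: smooth_on_unit_def)
qed

text \<open>The derivative is \<open>x powr (q - 1)\<close> times a continuous function of
  \<open>x powr r\<close>. The weight cancels the first factor, and since \<open>r > 0\<close> only
  the constant coefficient remains in the limit.\<close>

lemma power_series_fun_trace:
  assumes h: "\<And>y. summable (\<lambda>m. h m * y ^ m)" and r: "0 < r"
  shows "((\<lambda>x. x powr (1 - q) * deriv (power_series_fun h q r) x) \<longlongrightarrow> q * h 0) (at_right 0)"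
proof -
  define h' where "h' m = (q + r * real m) * h m" for m
  have h': "summable (\<lambda>m. h' m * y ^ m)" for y
    unfolding h'_def by (rule power_series_fun_deriv(2)[OF h zero_less_one])
  have "isCont (\<lambda>y. \<Sum>m. h' m * y ^ m) 0"
    using termdiffs_strong_converges_everywhere[OF h'] by (rule DERIV_isCont)
  moreover have "((\<lambda>x. x powr r) \<longlongrightarrow> 0) (at_right 0)"
    by (rule tendsto_zero_powrI[OF tendsto_ident_at tendsto_const _ r])
      (intro eventually_at_rightI[of 0 1], auto)
  ultimately have "((\<lambda>x. \<Sum>m. h' m * (x powr r) ^ m) \<longlongrightarrow> (\<Sum>m. h' m * 0 ^ m)) (at_right 0)"
    by (rule isCont_tendsto_compose)
  also have "(\<Sum>m. h' m * 0 ^ m) = q * h 0"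
    unfolding powser_zero by (simp add: h'_def)
  finally show ?thesis
  proof (rule Lim_transform_eventually)
    have "(\<Sum>m. h' m * (x powr r) ^ m) = x powr (1 - q) * deriv (power_series_fun h q r) x" if x: "0 < x" for x
    proof -
      have "deriv (power_series_fun h q r) x = power_series_fun h' (q - 1) r x"
        unfolding h'_def by (rule DERIV_imp_deriv[OF power_series_fun_deriv(1)[OF h x]])
      moreover have "x powr (1 - q) * x powr (q - 1) = 1"
        using x by (simp flip: powr_add)
      ultimately show ?thesis
        by (simp add: power_series_fun_def flip: mult.assoc)
    qed
    thus "\<forall>\<^sub>F x in at_right 0. (\<Sum>m. h' m * (x powr r) ^ m) = x powr (1 - q) * deriv (power_series_fun h q r) x"
      by (intro eventually_at_rightI[of 0 1]) auto
  qed
qed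

section \<open>Well-definedness of the trace on equivalence classes\<close>

lemma continuous_AE_eq_imp_eq:
  fixes f g :: "real \<Rightarrow> real"
  assumes "continuous_on {a<..<b} f" "continuous_on {a<..<b} g"
    and AE: "AE x in lebesgue_on {a<..<b}. f x = g x" and x: "x \<in> {a<..<b}"
  shows "f x = g x"
proof (rule ccontr)
  assume ne: "f x \<noteq> g x"
  have "continuous_on {a<..<b} (\<lambda>x. f x - g x)"
    using assms by (intro continuous_on_diff)
  hence "open ({a<..<b} \<inter> (\<lambda>x. f x - g x) -` (- {0}))"
    by (intro continuous_open_preimage) auto
  moreover have "x \<in> {a<..<b} \<inter> (\<lambda>x. f x - g x) -` (- {0})"
    using x ne by simp
  ultimately obtain e where e: "0 < e" "ball x e \<subseteq> {a<..<b} \<inter> (\<lambda>x. f x - g x) -` (- {0})"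
    by (meson open_contains_ball)
  have "AE t in lebesgue. t \<in> {a<..<b} \<longrightarrow> f t = g t"
    using AE by (simp add: AE_restrict_space_iff)
  hence "AE t in lebesgue. t \<notin> ball x e"
    by (rule AE_mp) (use e(2) in \<open>auto intro!: AE_I2\<close>)
  hence "ball x e \<in> null_sets lebesgue"
    by (subst AE_iff_null_sets) auto
  hence "negligible (ball x e)"
    by (simp add: negligible_iff_null_sets)
  thus False
    using e(1) open_not_negligible[of "ball x e"] by simp
qed

text \<open>Smooth functions that agree almost everywhere agree on the whole open interval, and so
  do their derivatives; this gives the \<open>THE\<close> in \<open>boundary_trace\<close> its
  meaning.\<close>

lemma has_trace_unique:
  assumes "has_trace \<delta> z l" "has_trace \<delta> z l'"
  shows "l = l'"
proof -
  obtain w where w: "smooth_on_unit w" "AE x in lebesgue_on {0<..<1}. w x = z x"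
    "((\<lambda>x. x powr \<delta> * deriv w x) \<longlongrightarrow> l) (at_right 0)"
    using assms(1) unfolding has_trace_def by blast
  obtain v where v: "smooth_on_unit v" "AE x in lebesgue_on {0<..<1}. v x = z x"
    "((\<lambda>x. x powr \<delta> * deriv v x) \<longlongrightarrow> l') (at_right 0)"
    using assms(2) unfolding has_trace_def by blast
  have cont: "continuous_on {0<..<1} f" if "smooth_on_unit f" for f
  proof (rule continuous_at_imp_continuous_on, rule ballI)
    fix x :: real assume "x \<in> {0<..<1}"
    hence "(deriv ^^ 0) f differentiable (at x)"
      using that unfolding smooth_on_unit_def by blast
    thus "isCont f x"
      using differentiable_imp_continuous_within[of f x UNIV] by simp
  qed
  have "AE x in lebesgue_on {0<..<1}. w x = v x"
    using w(2) v(2) by eventually_elim simp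
  hence eq: "w x = v x" if "x \<in> {0<..<1}" for x
    using continuous_AE_eq_imp_eq[OF cont[OF w(1)] cont[OF v(1)]] that by blast
  have "deriv w x = deriv v x" if x: "x \<in> {0<..<1}" for x
  proof (rule deriv_cong_ev)
    show "\<forall>\<^sub>F t in nhds x. w t = v t"
      by (rule eventually_mono[OF eventually_nhds_in_open[OF open_greaterThanLessThan x] eq])
  qed simp
  hence "\<forall>\<^sub>F x in at_right 0. x powr \<delta> * deriv w x = x powr \<delta> * deriv v x"
    by (intro eventually_at_rightI[of 0 1]) auto
  hence "((\<lambda>x. x powr \<delta> * deriv v x) \<longlongrightarrow> l) (at_right 0)"
    by (rule Lim_transform_eventually[OF w(3)])
  thus ?thesis
    using v(3) by (rule tendsto_unique[rotated]) simp
qed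

lemma boundary_trace_eq: "has_trace \<delta> z l \<Longrightarrow> boundary_trace \<delta> z = l"
  unfolding boundary_trace_def by (rule the_equality) (assumption, rule has_trace_unique)

section \<open>Superpositions of rescaled entire parts\<close>

lemma bessel_E_exp_bound:
  assumes "-1 < \<nu>" "0 < \<epsilon>"
  shows "\<exists>K>0. \<forall>\<rho>\<ge>0. \<forall>y\<in>{0..1}. \<bar>bessel_E \<nu> (\<rho> * y)\<bar> \<le> K * exp (\<epsilon> * \<rho>)"
proof -
  obtain K where K: "0 < K" "\<And>\<rho> m. 0 \<le> \<rho> \<Longrightarrow> \<bar>bessel_coeff \<nu> m * (\<rho> * 1) ^ m\<bar> \<le> K * ((\<epsilon> * \<rho>) ^ m / fact m)"
    using bessel_coeff_majorant[OF assms, of 1] by blast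
  have "\<bar>bessel_E \<nu> (\<rho> * y)\<bar> \<le> K * exp (\<epsilon> * \<rho>)" if \<rho>: "0 \<le> \<rho>" and y: "y \<in> {0..1}" for \<rho> y
  proof -
    have "(\<lambda>m. K * ((\<epsilon> * \<rho>) ^ m / fact m)) sums (K * exp (\<epsilon> * \<rho>))"
      using exp_converges[of "\<epsilon> * \<rho>"] by (intro sums_mult) (simp add: divide_inverse mult.commute)
    moreover have "\<bar>bessel_coeff \<nu> m * (\<rho> * y) ^ m\<bar> \<le> K * ((\<epsilon> * \<rho>) ^ m / fact m)" for m
    proof -
      have "\<bar>bessel_coeff \<nu> m * (\<rho> * y) ^ m\<bar> \<le> \<bar>bessel_coeff \<nu> m * (\<rho> * 1) ^ m\<bar>"
        unfolding abs_mult using \<rho> y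
        by (intro mult_left_mono) (auto simp: power_abs abs_mult intro!: power_mono mult_left_le)
      thus ?thesis
        using K(2)[OF \<rho>, of m] by linarith
    qed
    moreover have "\<bar>bessel_E \<nu> (\<rho> * y)\<bar> \<le> (\<Sum>m. \<bar>bessel_coeff \<nu> m * (\<rho> * y) ^ m\<bar>)"
      unfolding bessel_E_def by (rule summable_rabs[OF bessel_series_summable[OF assms(1)]])
    moreover have "(\<Sum>m. \<bar>bessel_coeff \<nu> m * (\<rho> * y) ^ m\<bar>) \<le> (\<Sum>m. K * ((\<epsilon> * \<rho>) ^ m / fact m))"
      using calculation by (intro suminf_le bessel_series_summable assms(1)) (auto simp: sums_iff)
    ultimately show ?thesis
      by (simp add: sums_iff)
  qed
  thus ?thesis
    using K(1) by blast
qed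

text \<open>The exponential weight makes the double family absolutely summable, with majorant
  \<open>g\<close>. Hence summing first over \<open>k\<close>, which gives the coefficients
  \<open>h\<close>, and first over \<open>m\<close>, which gives the values of
  \<open>bessel_E\<close>, agree.\<close>

lemma bessel_superposition:
  fixes b \<rho> :: "nat \<Rightarrow> real"
  assumes nu: "-1 < \<nu>" and \<epsilon>: "0 < \<epsilon>" and \<rho>: "\<And>k. 0 \<le> \<rho> k"
    and b: "summable (\<lambda>k. \<bar>b k\<bar> * exp (\<epsilon> * \<rho> k))"
  defines "h \<equiv> \<lambda>m. \<Sum>k. b k * (bessel_coeff \<nu> m * \<rho> k ^ m)"
  shows "(\<lambda>m. h m * y ^ m) sums (\<Sum>k. b k * bessel_E \<nu> (\<rho> k * y))"
proof -
  obtain K where K: "0 < K" "\<And>r m. 0 \<le> r \<Longrightarrow> \<bar>bessel_coeff \<nu> m * (r * y) ^ m\<bar> \<le> K * ((\<epsilon> * r) ^ m / fact m)"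
    using bessel_coeff_majorant[OF nu \<epsilon>, of y] by blast
  define f where "f k m = b k * (bessel_coeff \<nu> m * (\<rho> k * y) ^ m)" for k m
  define g where "g = (\<lambda>(k, m). \<bar>b k\<bar> * (K * ((\<epsilon> * \<rho> k) ^ m / fact m)))"
  have gsum: "(\<lambda>m. g (k, m)) sums (\<bar>b k\<bar> * (K * exp (\<epsilon> * \<rho> k)))" for k
    unfolding g_def using exp_converges[of "\<epsilon> * \<rho> k"]
    by (auto intro!: sums_mult simp: divide_inverse mult.commute)
  have g0: "0 \<le> g (k, m)" for k m
    using K(1) \<epsilon> \<rho>[of k] by (simp add: g_def)
  have "g summable_on UNIV \<times> UNIV"
  proof (rule summable_on_SigmaI)
    show "((\<lambda>m. g (k, m)) has_sum \<bar>b k\<bar> * (K * exp (\<epsilon> * \<rho> k))) UNIV" for k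
      using gsum[of k] g0 by (intro norm_summable_imp_has_sum) (auto simp: sums_iff)
    have "summable (\<lambda>k. K * (\<bar>b k\<bar> * exp (\<epsilon> * \<rho> k)))"
      using b by (rule summable_mult)
    thus "(\<lambda>k. \<bar>b k\<bar> * (K * exp (\<epsilon> * \<rho> k))) summable_on UNIV"
      using K(1) by (subst summable_on_UNIV_nonneg_real_iff) (auto simp: mult_ac)
  qed (use g0 in auto)
  moreover have "norm ((\<lambda>(k, m). f k m) x) \<le> g x" for x
  proof (cases x)
    case (Pair k m)
    show ?thesis
      unfolding Pair f_def g_def using K(2)[OF \<rho>[of k], of m]
      by (simp only: prod.case real_norm_def abs_mult[of "b k"]) (rule mult_left_mono; simp)
  qed
  ultimately have "(\<lambda>x. norm ((\<lambda>(k, m). f k m) x)) summable_on UNIV \<times> UNIV"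
    by (intro Infinite_Sum.abs_summable_on_comparison_test'[where g = g])
  hence fs: "(\<lambda>(k, m). f k m) summable_on UNIV \<times> UNIV"
    by (rule abs_summable_summable)
  hence fs': "(\<lambda>(m, k). f k m) summable_on UNIV \<times> UNIV"
    by (subst (asm) summable_on_swap) (simp add: case_prod_unfold)
  have to_suminf: "infsum u UNIV = suminf u" if "u summable_on UNIV" for u :: "nat \<Rightarrow> real"
    using has_sum_imp_sums[OF has_sum_infsum[OF that]] by (simp add: sums_iff)
  have row: "infsum (f k) UNIV = b k * bessel_E \<nu> (\<rho> k * y)" for k
  proof -
    have "infsum (f k) UNIV = suminf (f k)"
      by (rule to_suminf[OF summable_on_SigmaD1[OF fs UNIV_I]])
    also have "f k sums (b k * bessel_E \<nu> (\<rho> k * y))"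
      unfolding f_def[abs_def] by (intro sums_mult bessel_series_sums nu)
    hence "suminf (f k) = b k * bessel_E \<nu> (\<rho> k * y)"
      by (simp add: sums_iff)
    finally show ?thesis .
  qed
  have col: "infsum (\<lambda>k. f k m) UNIV = h m * y ^ m" for m
  proof -
    have sm: "(\<lambda>k. f k m) summable_on UNIV"
      by (rule summable_on_SigmaD1[OF fs' UNIV_I])
    have eq: "f k m = b k * (bessel_coeff \<nu> m * \<rho> k ^ m) * y ^ m" for k
      by (simp add: f_def power_mult_distrib)
    show ?thesis
    proof (cases "y ^ m = 0")
      \<comment> \<open>Here \<open>y ^ m\<close> cannot be cancelled to recover convergence of the
        series for \<open>h m\<close>, but both sides vanish.\<close>
      case True
      show ?thesis
        unfolding eq True by simp
    next
      case False
      have "summable (\<lambda>k. b k * (bessel_coeff \<nu> m * \<rho> k ^ m) * y ^ m)"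
        using summable_on_imp_summable[OF sm] unfolding eq .
      hence "summable (\<lambda>k. y ^ m * (b k * (bessel_coeff \<nu> m * \<rho> k ^ m)))"
        by (simp only: mult.commute[of "y ^ m"])
      hence "summable (\<lambda>k. b k * (bessel_coeff \<nu> m * \<rho> k ^ m))"
        using False by (rule summable_mult_D)
      hence "(\<Sum>k. f k m) = h m * y ^ m"
        unfolding eq h_def by (rule suminf_mult2[symmetric])
      thus ?thesis
        using to_suminf[OF sm] by simp
    qed
  qed
  have "(\<lambda>m. infsum (\<lambda>k. f k m) UNIV) summable_on UNIV"
    using summable_on_Sigma_banach[OF fs'] by simp
  from has_sum_imp_sums[OF has_sum_infsum[OF this]]
  have "(\<lambda>m. infsum (\<lambda>k. f k m) UNIV) sums (infsum (\<lambda>m. infsum (\<lambda>k. f k m) UNIV) UNIV)" .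
  also have "infsum (\<lambda>m. infsum (\<lambda>k. f k m) UNIV) UNIV = infsum (\<lambda>k. infsum (f k) UNIV) UNIV"
    using infsum_swap_banach[OF fs] by simp
  also have "\<dots> = (\<Sum>k. infsum (f k) UNIV)"
    using summable_on_Sigma_banach[OF fs] by (intro to_suminf) simp
  finally show ?thesis
    unfolding row col .
qed

section \<open>The semigroup\<close>

lemma L2_dominated:
  assumes f: "f \<in> borel_measurable M" and g: "g \<in> L2 M" and le: "\<And>x. x \<in> space M \<Longrightarrow> \<bar>f x\<bar> \<le> \<bar>g x\<bar>"
  shows "f \<in> L2 M" "L2_norm M f \<le> L2_norm M g"
proof -
  have sq: "(f x)\<^sup>2 \<le> (g x)\<^sup>2" if "x \<in> space M" for x
    using le[OF that] by (simp add: abs_le_square_iff)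
  have "integrable M (\<lambda>x. (f x)\<^sup>2)"
  proof (rule Bochner_Integration.integrable_bound[OF L2_square_integrable[OF g]])
    show "(\<lambda>x. (f x)\<^sup>2) \<in> borel_measurable M"
      using f by measurable
    show "AE x in M. norm ((f x)\<^sup>2) \<le> norm ((g x)\<^sup>2)"
      using sq by (intro AE_I2) simp
  qed
  thus "f \<in> L2 M"
    using f by (simp add: L2_def)
  have "(LINT x|M. (f x)\<^sup>2) \<le> (LINT x|M. (g x)\<^sup>2)"
    by (rule integral_mono[OF \<open>integrable M (\<lambda>x. (f x)\<^sup>2)\<close> L2_square_integrable[OF g] sq])
  thus "L2_norm M f \<le> L2_norm M g"
    by (simp add: L2_norm_def L2_inner_def power2_eq_square)
qed

context bessel_heat
begin

text \<open>Since \<open>lam k\<close> is the square of \<open>\<kappa>\<close> times the zero, this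
  is \<open>bessel_norming_summable\<close> up to a constant. The hypothesis
  \<open>\<nu> < s\<close> enters here, and the trace and control estimates below reduce to this
  series.\<close>

lemma amp_summable: "summable (\<lambda>k. (amp k)\<^sup>2 * lam k powr (- 1 - s))"
proof -
  let ?j = "bessel_zero \<nu>"
  have "(amp k)\<^sup>2 * lam k powr (- 1 - s) = (8 * \<kappa> * \<kappa> powr (- 2 - 2 * s))
      * (?j k powr (- 2 - 2 * s) / ((?j k)\<^sup>2 * (bessel_E (\<nu> + 1) ((?j k)\<^sup>2 / 4))\<^sup>2))" for k
  proof -
    have j: "0 < ?j k"
      by (rule bessel_zero_pos[OF nu_gt])
    have "lam k = (\<kappa> * ?j k) powr 2"
      using j kappa_pos by (simp add: eigval_eq rho_def power_mult_distrib)
    hence "lam k powr (- 1 - s) = (\<kappa> * ?j k) powr (- 2 - 2 * s)"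
      by (simp add: powr_powr algebra_simps)
    also have "\<dots> = \<kappa> powr (- 2 - 2 * s) * ?j k powr (- 2 - 2 * s)"
      using j kappa_pos by (simp add: powr_mult)
    finally show ?thesis
      by (simp add: amp_square rho_def)
  qed
  thus ?thesis
    using bessel_norming_summable[OF nu_gt s] by (simp only: summable_mult)
qed

text \<open>The bound \<open>exp (- x) \<le> 1 / x\<close> at \<open>x = 2 * lam k * t\<close>
  supplies the power of \<open>lam k\<close> missing for \<open>amp_summable\<close>, at the price
  of a factor \<open>1 / (2 * t)\<close>.\<close>

lemma amp_exp_summable:
  assumes "0 < t"
  shows "summable (\<lambda>k. (amp k * exp (- lam k * t))\<^sup>2 * lam k powr - s)"
proof (rule summable_comparison_test'[where N = 0])
  show "summable (\<lambda>k. 1 / (2 * t) * ((amp k)\<^sup>2 * lam k powr (- 1 - s)))"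
    by (intro summable_mult amp_summable)
  fix k
  have l: "0 < lam k"
    by (rule eigval_pos)
  have "2 * lam k * t \<le> exp (2 * lam k * t)"
    using exp_ge_add_one_self[of "2 * lam k * t"] by linarith
  hence "exp (- (2 * lam k * t)) \<le> 1 / (2 * lam k * t)"
    using l assms by (simp add: exp_minus field_simps)
  hence "(amp k)\<^sup>2 * lam k powr - s * exp (- (2 * lam k * t)) \<le> (amp k)\<^sup>2 * lam k powr - s * (1 / (2 * lam k * t))"
    by (rule mult_left_mono) simp
  moreover have "lam k powr (- 1 - s) = lam k powr - s / lam k"
    using l powr_diff[of "lam k" "- s" 1] by (simp add: minus_diff_commute)
  moreover have "(exp (- lam k * t))\<^sup>2 = exp (- (2 * lam k * t))"
    by (simp add: power2_eq_square flip: exp_add)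
  ultimately show "norm ((amp k * exp (- lam k * t))\<^sup>2 * lam k powr - s)
      \<le> 1 / (2 * t) * ((amp k)\<^sup>2 * lam k powr (- 1 - s))"
    by (simp add: power_mult_distrib mult_ac)
qed

text \<open>The trace of \<open>\<Phi> k\<close> itself: leading exponent times leading coefficient,
  with \<open>bessel_E \<nu> 0 = 1 / Gamma (\<nu> + 1)\<close>.\<close>

definition trace_coeff :: "nat \<Rightarrow> real" where
  "trace_coeff k = pexp / Gamma (\<nu> + 1) * amp k"

lemma powr_pexp_L2: "(\<lambda>x. x powr pexp) \<in> L2 (weighted \<beta>)"
proof (rule L2_weightedI)
  show "continuous_on {0<..<1} (\<lambda>x::real. x powr pexp)"
    by (intro continuous_intros) auto
  have "-1 < \<beta> + 2 * pexp"
    unfolding weight_exponent using kappa_pos nu_pos by (simp add: add_pos_pos)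
  hence "(\<lambda>x. x powr (\<beta> + 2 * pexp)) integrable_on {0<..<1}"
    using integrable_on_powr_from_0[of "\<beta> + 2 * pexp" 1] by (simp add: integrable_on_open_interval_real)
  thus "(\<lambda>x. x powr \<beta> * (x powr pexp)\<^sup>2) integrable_on {0<..<1}"
    by (simp only: mult_2 powr_add power2_eq_square)
qed

text \<open>Half of the decay of \<open>exp (- lam k * t)\<close> pays for the growth of
  \<open>bessel_E\<close>, the other half for summability. The remainder after \<open>n\<close>
  terms is then at most \<open>K * R n * x powr pexp\<close> on the whole interval, which gives
  \<open>L2\<close> convergence.\<close>

lemma semigroup_representative:
  assumes z: "z \<in> H" and t: "0 < t"
  shows "\<exists>h. (\<forall>y. summable (\<lambda>m. h m * y ^ m))
    \<and> L2_sums W (\<lambda>k x. exp (- lam k * t) * cf z k * \<Phi> k x) (power_series_fun h pexp (2 * \<kappa>))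
    \<and> pexp * h 0 = (\<Sum>k. (trace_coeff k * exp (- lam k * t)) * cf z k)"
proof -
  \<comment> \<open>Chosen so that \<open>\<epsilon> * rho k = lam k * t / 2\<close>.\<close>
  define \<epsilon> where "\<epsilon> = 2 * \<kappa>\<^sup>2 * t"
  have \<epsilon>: "0 < \<epsilon>"
    using kappa_pos t by (simp add: \<epsilon>_def)
  define b where "b k = exp (- lam k * t) * cf z k * amp k" for k
  define a where "a k = \<bar>b k\<bar> * exp (\<epsilon> * rho k)" for k
  have a_eq: "a k = \<bar>(amp k * exp (- lam k * (t / 2))) * cf z k\<bar>" for k
  proof -
    have "exp (- lam k * t) * exp (\<epsilon> * rho k) = exp (- lam k * (t / 2))"
      by (simp add: \<epsilon>_def eigval_eq field_simps flip: exp_add)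
    thus ?thesis
      by (simp add: a_def b_def abs_mult mult_ac)
  qed
  have a: "summable a"
    unfolding a_eq[abs_def] using t by (intro dual_of_summable(1) amp_exp_summable z) simp
  define h where "h m = (\<Sum>k. b k * (bessel_coeff \<nu> m * rho k ^ m))" for m
  have h: "(\<lambda>m. h m * y ^ m) sums (\<Sum>k. b k * bessel_E \<nu> (rho k * y))" for y
    unfolding h_def using a by (intro bessel_superposition[OF nu_gt \<epsilon>]) (auto simp: a_def[abs_def] rho_pos less_imp_le)
  have h_sm: "summable (\<lambda>m. h m * y ^ m)" for y
    using h by (rule sums_summable)
  define w where "w = power_series_fun h pexp (2 * \<kappa>)"
  obtain K where K: "0 < K" "\<And>r y. 0 \<le> r \<Longrightarrow> y \<in> {0..1} \<Longrightarrow> \<bar>bessel_E \<nu> (r * y)\<bar> \<le> K * exp (\<epsilon> * r)"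
    using bessel_E_exp_bound[OF nu_gt \<epsilon>] by blast
  define S where "S n x = (\<Sum>k<n. exp (- lam k * t) * cf z k * \<Phi> k x)" for n x
  define R where "R n = suminf a - (\<Sum>k<n. a k)" for n
  have bound: "\<bar>w x - S n x\<bar> \<le> \<bar>K * R n * x powr pexp\<bar>" if x: "x \<in> {0<..<1}" for n x
  proof -
    let ?y = "x powr (2 * \<kappa>)"
    have y: "?y \<in> {0..1}"
      using x kappa_pos powr_mono2[of "2 * \<kappa>" x 1] by simp
    have bE: "\<bar>b k * bessel_E \<nu> (rho k * ?y)\<bar> \<le> K * a k" for k
    proof -
      have "\<bar>b k\<bar> * \<bar>bessel_E \<nu> (rho k * ?y)\<bar> \<le> \<bar>b k\<bar> * (K * exp (\<epsilon> * rho k))"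
        using K(2)[OF less_imp_le[OF rho_pos] y] by (intro mult_left_mono) auto
      thus ?thesis
        by (simp add: abs_mult a_def mult_ac)
    qed
    have Ka: "summable (\<lambda>k. K * a k)"
      using a by (rule summable_mult)
    have bsm: "summable (\<lambda>k. \<bar>b k * bessel_E \<nu> (rho k * ?y)\<bar>)"
      by (rule summable_comparison_test'[OF Ka, where N = 0]) (use bE in simp)
    have Seq: "S n x = x powr pexp * (\<Sum>k<n. b k * bessel_E \<nu> (rho k * ?y))"
      unfolding S_def sum_distrib_left using x by (intro sum.cong) (auto simp: Phi_eq b_def)
    have "w x = x powr pexp * (\<Sum>k. b k * bessel_E \<nu> (rho k * ?y))"
      using h[of ?y] by (simp add: w_def power_series_fun_def sums_iff)
    hence "w x - S n x = x powr pexp * ((\<Sum>k. b k * bessel_E \<nu> (rho k * ?y)) - (\<Sum>k<n. b k * bessel_E \<nu> (rho k * ?y)))"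
      unfolding Seq by (simp add: right_diff_distrib)
    also have "(\<Sum>k. b k * bessel_E \<nu> (rho k * ?y)) - (\<Sum>k<n. b k * bessel_E \<nu> (rho k * ?y))
        = (\<Sum>k. b (k + n) * bessel_E \<nu> (rho (k + n) * ?y))"
      by (rule suminf_minus_initial_segment[symmetric, OF summable_rabs_cancel[OF bsm]])
    finally have diff: "\<bar>w x - S n x\<bar> = x powr pexp * \<bar>\<Sum>k. b (k + n) * bessel_E \<nu> (rho (k + n) * ?y)\<bar>"
      by (simp add: abs_mult)
    have "\<bar>\<Sum>k. b (k + n) * bessel_E \<nu> (rho (k + n) * ?y)\<bar> \<le> (\<Sum>k. \<bar>b (k + n) * bessel_E \<nu> (rho (k + n) * ?y)\<bar>)"
      by (rule summable_rabs[OF summable_ignore_initial_segment[OF bsm]])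
    also have "\<dots> \<le> (\<Sum>k. K * a (k + n))"
      by (rule suminf_le[OF bE summable_ignore_initial_segment[OF bsm] summable_ignore_initial_segment[OF Ka]])
    also have "\<dots> = K * (\<Sum>k. a (k + n))"
      by (rule suminf_mult[OF summable_ignore_initial_segment[OF a]])
    also have "(\<Sum>k. a (k + n)) = R n"
      unfolding R_def by (rule suminf_minus_initial_segment[OF a])
    finally have "\<bar>w x - S n x\<bar> \<le> x powr pexp * (K * R n)"
      unfolding diff by (rule mult_left_mono) simp
    thus ?thesis
      by (simp add: mult.commute)
  qed
  have space: "space W = {0<..<1}"
    by (simp add: weighted_def)
  have "continuous_on {0<..<1} w"
  proof (rule continuous_at_imp_continuous_on, rule ballI)
    fix x :: real assume "x \<in> {0<..<1}"
    thus "isCont w x"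
      unfolding w_def by (intro DERIV_isCont[OF power_series_fun_deriv(1)[OF h_sm]]) simp
  qed
  hence w_meas: "w \<in> borel_measurable W"
    unfolding measurable_weighted by (rule continuous_imp_measurable_on_sets_lebesgue) simp
  have S_L2: "S n \<in> L2 W" for n
    unfolding S_def by (intro L2_sum L2_scale Phi_L2)
  have dom: "(\<lambda>x. w x - S n x) \<in> L2 W" "L2_norm W (\<lambda>x. w x - S n x) \<le> \<bar>K * R n\<bar> * L2_norm W (\<lambda>x. x powr pexp)" for n
  proof -
    have "(\<lambda>x. w x - S n x) \<in> borel_measurable W"
      using w_meas L2_measurable[OF S_L2] by (rule borel_measurable_diff)
    from L2_dominated[OF this L2_scale[OF powr_pexp_L2, of "K * R n"]]
    show "(\<lambda>x. w x - S n x) \<in> L2 W" "L2_norm W (\<lambda>x. w x - S n x) \<le> \<bar>K * R n\<bar> * L2_norm W (\<lambda>x. x powr pexp)"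
      using bound by (simp_all add: space L2_norm_scale)
  qed
  \<comment> \<open>\<open>S 0\<close> is the zero function, so the remainder at
    \<open>n = 0\<close> is \<open>w\<close> itself.\<close>
  have "w \<in> L2 W"
    using dom(1)[of 0] by (simp add: S_def)
  moreover have "(\<lambda>n. L2_norm W (\<lambda>x. w x - S n x)) \<longlonglongrightarrow> 0"
  proof (rule Lim_null_comparison)
    show "\<forall>\<^sub>F n in sequentially. norm (L2_norm W (\<lambda>x. w x - S n x)) \<le> \<bar>K * R n\<bar> * L2_norm W (\<lambda>x. x powr pexp)"
      unfolding real_norm_def abs_of_nonneg[OF L2_norm_nonneg] by (intro always_eventually allI dom(2))
    have "R \<longlonglongrightarrow> suminf a - suminf a"
      unfolding R_def[abs_def] by (intro tendsto_diff tendsto_const summable_LIMSEQ a)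
    hence "(\<lambda>n. \<bar>K * R n\<bar> * L2_norm W (\<lambda>x. x powr pexp)) \<longlonglongrightarrow> \<bar>K * 0\<bar> * L2_norm W (\<lambda>x. x powr pexp)"
      by (intro tendsto_mult tendsto_rabs tendsto_const) simp
    thus "(\<lambda>n. \<bar>K * R n\<bar> * L2_norm W (\<lambda>x. x powr pexp)) \<longlonglongrightarrow> 0"
      by simp
  qed
  ultimately have "L2_sums W (\<lambda>k x. exp (- lam k * t) * cf z k * \<Phi> k x) w"
    unfolding L2_sums_def S_def by blast
  moreover have "pexp * h 0 = (\<Sum>k. (trace_coeff k * exp (- lam k * t)) * cf z k)"
  proof -
    have "summable (\<lambda>k. \<bar>(amp k * exp (- lam k * t)) * cf z k\<bar>)"
      by (rule dual_of_summable(1)[OF amp_exp_summable[OF t] z])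
    hence "summable (\<lambda>k. (amp k * exp (- lam k * t)) * cf z k)"
      by (rule summable_rabs_cancel)
    hence sm: "summable (\<lambda>k. b k * (1 / Gamma (\<nu> + 1)))"
      by (intro summable_mult2) (simp add: b_def mult_ac)
    have "h 0 = (\<Sum>k. b k * (1 / Gamma (\<nu> + 1)))"
      by (simp add: h_def bessel_coeff_def)
    hence "pexp * h 0 = (\<Sum>k. pexp * (b k * (1 / Gamma (\<nu> + 1))))"
      using sm by (simp only: suminf_mult)
    also have "\<dots> = (\<Sum>k. (trace_coeff k * exp (- lam k * t)) * cf z k)"
      by (simp add: b_def trace_coeff_def mult_ac)
    finally show ?thesis .
  qed
  ultimately show ?thesis
    unfolding w_def using h_sm by blast
qed

text \<open>The \<open>SOME\<close> in \<open>heat_semigroup\<close> needs a witness: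
  \<open>z\<close> itself for \<open>t = 0\<close>, the power series form for
  \<open>t > 0\<close>.\<close>

lemma heat_semigroup_L2_sums:
  assumes "z \<in> H" "0 \<le> t"
  shows "L2_sums W (\<lambda>k x. exp (- lam k * t) * cf z k * \<Phi> k x) (heat_semigroup \<alpha> \<beta> \<mu> t z)"
proof -
  have "\<exists>v. L2_sums W (\<lambda>k x. exp (- lam k * t) * cf z k * \<Phi> k x) v"
  proof (cases "t = 0")
    case True
    thus ?thesis
      using H_space_expansion(1)[OF assms(1)] by auto
  next
    case False
    thus ?thesis
      using semigroup_representative[OF assms(1), of t] assms(2) by force
  qed
  thus ?thesis
    unfolding heat_semigroup_def by (rule someI_ex)
qed

lemma coeff_heat_semigroup:
  assumes "z \<in> H" "0 \<le> t"
  shows "cf (heat_semigroup \<alpha> \<beta> \<mu> t z) k = exp (- lam k * t) * cf z k"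
  by (rule coeff_of_L2_sums[OF heat_semigroup_L2_sums[OF assms]])

lemma heat_semigroup_mem:
  assumes "z \<in> H" "0 \<le> t"
  shows "heat_semigroup \<alpha> \<beta> \<mu> t z \<in> H"
proof (rule H_spaceI[OF heat_semigroup_L2_sums[OF assms]])
  show "summable (\<lambda>k. (exp (- lam k * t) * cf z k)\<^sup>2 * lam k powr s)"
  proof (rule summable_comparison_test'[OF H_space_expansion(2)[OF assms(1)], where N = 0])
    fix k
    have "exp (- lam k * t) \<le> 1"
      using eigval_pos[of k] assms(2) by simp
    hence "(exp (- lam k * t))\<^sup>2 \<le> 1"
      by (simp add: power_le_one)
    hence "(exp (- lam k * t))\<^sup>2 * ((cf z k)\<^sup>2 * lam k powr s) \<le> 1 * ((cf z k)\<^sup>2 * lam k powr s)"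
      by (rule mult_right_mono) simp
    thus "norm ((exp (- lam k * t) * cf z k)\<^sup>2 * lam k powr s) \<le> (cf z k)\<^sup>2 * lam k powr s"
      by (simp add: power_mult_distrib mult.assoc)
  qed
qed

text \<open>The chosen representative need not be smooth; it equals the power series form almost
  everywhere, and that form is the smooth function \<open>has_trace\<close> asks for.\<close>

lemma heat_semigroup_has_trace:
  assumes "z \<in> H" "0 < t"
  shows "has_trace (\<alpha> + \<beta> + gam \<alpha> \<beta> \<mu>) (heat_semigroup \<alpha> \<beta> \<mu> t z)
    (\<Sum>k. (trace_coeff k * exp (- lam k * t)) * cf z k)"
proof -
  obtain h where h: "\<And>y. summable (\<lambda>m. h m * y ^ m)"
    "L2_sums W (\<lambda>k x. exp (- lam k * t) * cf z k * \<Phi> k x) (power_series_fun h pexp (2 * \<kappa>))"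
    "pexp * h 0 = (\<Sum>k. (trace_coeff k * exp (- lam k * t)) * cf z k)"
    using semigroup_representative[OF assms] by blast
  have "AE x in W. power_series_fun h pexp (2 * \<kappa>) x = heat_semigroup \<alpha> \<beta> \<mu> t z x"
    by (rule L2_sums_unique_AE[OF h(2) heat_semigroup_L2_sums[OF assms(1) less_imp_le[OF assms(2)]] L2_scale[OF Phi_L2]])
  moreover have "((\<lambda>x. x powr (1 - pexp) * deriv (power_series_fun h pexp (2 * \<kappa>)) x) \<longlongrightarrow> pexp * h 0) (at_right 0)"
    using kappa_pos by (intro power_series_fun_trace h(1)) simp
  ultimately show ?thesis
    unfolding has_trace_def trace_exponent h(3)[symmetric] AE_weighted
    using smooth_power_series_fun[OF h(1)] by blast
qed

text \<open>In coefficients the adjoint of the semigroup is again multiplication by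
  \<open>exp (- lam k * t)\<close>; with \<open>heat_semigroup_dual_eq\<close> this moves the
  semigroup from \<open>z\<close> to the functional.\<close>

lemma heat_semigroup_pairing:
  assumes "\<phi> \<in> Hd" "z \<in> H" "0 \<le> t"
  shows "\<phi> (heat_semigroup \<alpha> \<beta> \<mu> t z) = dual_of (\<lambda>k. exp (- lam k * t) * \<phi> (\<Phi> k)) z"
proof -
  have "\<phi> (heat_semigroup \<alpha> \<beta> \<mu> t z) = (\<Sum>k. \<phi> (\<Phi> k) * cf (heat_semigroup \<alpha> \<beta> \<mu> t z) k)"
    using H_dual_expansion[OF assms(1) heat_semigroup_mem[OF assms(2,3)]] by (simp only: sums_iff)
  thus ?thesis
    using assms(2) by (simp add: coeff_heat_semigroup[OF assms(2,3)] dual_of_def mult_ac)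
qed

lemma heat_semigroup_dual_eq:
  "heat_semigroup_dual \<alpha> \<beta> \<mu> s t \<phi> = dual_of (\<lambda>k. exp (- lam k * t) * \<phi> (\<Phi> k))"
  unfolding heat_semigroup_dual_def[abs_def] dual_of_def[abs_def] coeff_def
  by (simp only: L2_inner_commute[of W "\<Phi> _"])

end

section \<open>The control operator\<close>

lemma continuous_in_dual_cong:
  assumes u: "continuous_in_dual \<alpha> \<beta> \<mu> s T u" and eq: "\<And>t. t \<in> {0..T} \<Longrightarrow> u t = v t"
  shows "continuous_in_dual \<alpha> \<beta> \<mu> s T v"
  unfolding continuous_in_dual_def
proof (intro conjI ballI)
  fix t assume t: "t \<in> {0..T}"
  show "v t \<in> H_dual \<alpha> \<beta> \<mu> s"
    using u t eq[OF t] unfolding continuous_in_dual_def by metis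
  have "((\<lambda>r. H_dual_norm \<alpha> \<beta> \<mu> s (\<lambda>z. u r z - u t z)) \<longlongrightarrow> 0) (at t within {0..T})"
    using u t unfolding continuous_in_dual_def by blast
  thus "((\<lambda>r. H_dual_norm \<alpha> \<beta> \<mu> s (\<lambda>z. v r z - v t z)) \<longlongrightarrow> 0) (at t within {0..T})"
    by (rule Lim_transform_eventually) (simp add: eventually_at_filter eq eq[OF t])
qed

lemma L2_restrict_space:
  assumes f: "f \<in> L2 M" and \<Omega>: "\<Omega> \<in> sets M"
  shows "f \<in> L2 (restrict_space M \<Omega>)" "L2_norm (restrict_space M \<Omega>) f \<le> L2_norm M f"
proof -
  have \<Omega>': "\<Omega> \<inter> space M \<in> sets M"
    using \<Omega> by auto
  have i: "integrable M (\<lambda>x. indicator \<Omega> x *\<^sub>R (f x)\<^sup>2)"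
    by (rule integrable_mult_indicator[OF \<Omega> L2_square_integrable[OF f]])
  show "f \<in> L2 (restrict_space M \<Omega>)"
    using i f by (simp add: L2_def integrable_restrict_space[OF \<Omega>'] measurable_restrict_space1)
  have "(LINT x|restrict_space M \<Omega>. (f x)\<^sup>2) = (LINT x|M. indicator \<Omega> x *\<^sub>R (f x)\<^sup>2)"
    by (rule integral_restrict_space[OF \<Omega>'])
  also have "\<dots> \<le> (LINT x|M. (f x)\<^sup>2)"
    by (rule integral_mono[OF i L2_square_integrable[OF f]]) (simp add: indicator_def)
  finally show "L2_norm (restrict_space M \<Omega>) f \<le> L2_norm M f"
    by (simp add: L2_norm_def L2_inner_def power2_eq_square)
qed

lemma L2_lebesgue_on_subinterval:
  fixes f :: "real \<Rightarrow> real"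
  assumes "f \<in> L2 (lebesgue_on {0<..<T})" "\<tau> \<le> T"
  shows "f \<in> L2 (lebesgue_on {0<..<\<tau>})" "L2_norm (lebesgue_on {0<..<\<tau>}) f \<le> L2_norm (lebesgue_on {0<..<T}) f"
proof -
  have "restrict_space (lebesgue_on {0<..<T}) {0<..<\<tau>} = lebesgue_on ({0<..<T} \<inter> {0<..<\<tau>})"
    by (rule restrict_restrict_space) auto
  also have "{0<..<T} \<inter> {0<..<\<tau>} = {0<..<\<tau>}"
    using assms(2) by auto
  finally have eq: "restrict_space (lebesgue_on {0<..<T}) {0<..<\<tau>} = lebesgue_on {0<..<\<tau>}" .
  have "{0<..<\<tau>} \<in> sets (lebesgue_on {0<..<T})"
    using assms(2) by (subst sets_restrict_space_iff) auto
  from L2_restrict_space[OF assms(1) this]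
  show "f \<in> L2 (lebesgue_on {0<..<\<tau>})" "L2_norm (lebesgue_on {0<..<\<tau>}) f \<le> L2_norm (lebesgue_on {0<..<T}) f"
    unfolding eq by auto
qed

text \<open>The integral of \<open>exp (- 2 * l * (\<tau> - t))\<close> is at most
  \<open>1 / (2 * l)\<close> whatever \<open>\<tau>\<close> is; this uniform gain of half a power of
  \<open>l\<close> drives the control estimate.\<close>

lemma exp_decay_L2:
  fixes l \<tau> :: real
  assumes "0 < l" "0 \<le> \<tau>"
  shows "(\<lambda>t. exp (- l * (\<tau> - t))) \<in> L2 (lebesgue_on {0<..<\<tau>})"
    and "L2_norm (lebesgue_on {0<..<\<tau>}) (\<lambda>t. exp (- l * (\<tau> - t))) \<le> 1 / sqrt (2 * l)"
proof -
  let ?e = "\<lambda>t. exp (- l * (\<tau> - t))" and ?M = "lebesgue_on {0<..<\<tau>}"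
  have sq: "(?e t)\<^sup>2 = exp (- (2 * l) * (\<tau> - t))" for t
    by (simp add: power2_eq_square algebra_simps flip: exp_add)
  have "((\<lambda>t. (?e t)\<^sup>2) has_integral (exp (- (2 * l) * (\<tau> - \<tau>)) / (2 * l) - exp (- (2 * l) * (\<tau> - 0)) / (2 * l))) {0..\<tau>}"
    unfolding sq
  proof (rule fundamental_theorem_of_calculus[OF assms(2)])
    fix t
    have "((\<lambda>t. exp (- (2 * l) * (\<tau> - t)) / (2 * l)) has_real_derivative exp (- (2 * l) * (\<tau> - t))) (at t within {0..\<tau>})"
      using assms(1) by (auto intro!: derivative_eq_intros)
    thus "((\<lambda>t. exp (- (2 * l) * (\<tau> - t)) / (2 * l)) has_vector_derivative exp (- (2 * l) * (\<tau> - t))) (at t within {0..\<tau>})"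
      by (simp add: has_real_derivative_iff_has_vector_derivative)
  qed
  hence I: "((\<lambda>t. (?e t)\<^sup>2) has_integral (1 - exp (- (2 * l) * \<tau>)) / (2 * l)) {0<..<\<tau>}"
    by (simp add: has_integral_Icc_iff_Ioo diff_divide_distrib)
  have "(\<lambda>t. (?e t)\<^sup>2) absolutely_integrable_on {0<..<\<tau>}"
    by (rule nonnegative_absolutely_integrable_1[OF has_integral_integrable[OF I]]) simp
  hence int: "integrable ?M (\<lambda>t. (?e t)\<^sup>2)"
    by (rule absolutely_integrable_imp_integrable) simp
  moreover have "?e \<in> borel_measurable ?M"
    by (rule continuous_imp_measurable_on_sets_lebesgue) (auto intro!: continuous_intros)
  ultimately show "?e \<in> L2 ?M"
    by (simp add: L2_def)
  have "(LINT t|?M. (?e t)\<^sup>2) = (1 - exp (- (2 * l) * \<tau>)) / (2 * l)"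
    using lebesgue_integral_eq_integral[OF int] integral_unique[OF I] by simp
  also have "\<dots> \<le> 1 / (2 * l)"
    using assms(1) by (intro divide_right_mono) auto
  finally have "sqrt (LINT t|?M. (?e t)\<^sup>2) \<le> sqrt (1 / (2 * l))"
    by (rule real_sqrt_le_mono)
  thus "L2_norm ?M ?e \<le> 1 / sqrt (2 * l)"
    by (simp only: L2_norm_def L2_inner_def real_sqrt_divide real_sqrt_one power2_eq_square)
qed

section \<open>Modal Duhamel integrals and the control operator\<close>

context bessel_heat
begin

text \<open>Up to the factor \<open>trace_coeff k\<close>, the coefficient of index \<open>k\<close>
  of the control contribution at time \<open>\<tau>\<close>.\<close>

definition duhamel :: "(real \<Rightarrow> real) \<Rightarrow> real \<Rightarrow> nat \<Rightarrow> real" where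
  "duhamel f \<tau> k = (LINT t|lebesgue_on {0<..<\<tau>}. f t * exp (- lam k * (\<tau> - t)))"

text \<open>Bound for \<open>trace_coeff k * duhamel f \<tau> k\<close> per unit norm of
  \<open>f\<close>, uniform in \<open>\<tau>\<close>; the denominator comes from
  \<open>exp_decay_L2\<close>.\<close>

definition control_weight :: "nat \<Rightarrow> real" where
  "control_weight k = trace_coeff k / sqrt (2 * lam k)"

definition control_const :: real where
  "control_const = sqrt (\<Sum>k. (control_weight k)\<^sup>2 * lam k powr - s)"

lemma trace_coeff_pos: "0 < trace_coeff k"
  using pexp_pos nu_pos amp_pos by (simp add: trace_coeff_def)

text \<open>The squared denominator supplies one power of \<open>lam k\<close>, which makes the
  series a multiple of the one in \<open>amp_summable\<close>.\<close>

lemma control_weight_summable: "summable (\<lambda>k. (control_weight k)\<^sup>2 * lam k powr - s)"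
proof -
  have "(control_weight k)\<^sup>2 * lam k powr - s
      = (pexp / Gamma (\<nu> + 1))\<^sup>2 / 2 * ((amp k)\<^sup>2 * lam k powr (- 1 - s))" for k
  proof -
    have "lam k powr (- 1 - s) = lam k powr - s / lam k"
      using eigval_pos[of k] powr_diff[of "lam k" "- s" 1] by (simp add: minus_diff_commute)
    thus ?thesis
      using eigval_pos[of k]
      by (simp add: control_weight_def trace_coeff_def power_divide power_mult_distrib)
  qed
  thus ?thesis
    using amp_summable by (simp only: summable_mult)
qed

lemma integral_exp_bound:
  assumes f: "f \<in> L2 (lebesgue_on {0<..<T})" and \<tau>: "0 \<le> \<tau>" "\<tau> \<le> T"
  shows "integrable (lebesgue_on {0<..<\<tau>}) (\<lambda>t. f t * exp (- lam k * (\<tau> - t)))"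
    and "\<bar>LINT t|lebesgue_on {0<..<\<tau>}. f t * exp (- lam k * (\<tau> - t))\<bar> \<le> L2_norm (lebesgue_on {0<..<T}) f / sqrt (2 * lam k)"
proof -
  let ?M = "lebesgue_on {0<..<\<tau>}" and ?e = "\<lambda>t. exp (- lam k * (\<tau> - t))"
  note f' = L2_lebesgue_on_subinterval[OF f \<tau>(2)]
  note e = exp_decay_L2[OF eigval_pos[of k] \<tau>(1)]
  show "integrable ?M (\<lambda>t. f t * ?e t)"
    by (rule L2_mult_integrable[OF f'(1) e(1)])
  have "\<bar>LINT t|?M. f t * ?e t\<bar> \<le> L2_norm ?M f * L2_norm ?M ?e"
    using L2_Cauchy_Schwarz[OF f'(1) e(1)] by (simp only: L2_inner_def)
  also have "\<dots> \<le> L2_norm (lebesgue_on {0<..<T}) f * (1 / sqrt (2 * lam k))"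
    by (intro mult_mono f' e L2_norm_nonneg)
  finally show "\<bar>LINT t|?M. f t * ?e t\<bar> \<le> L2_norm (lebesgue_on {0<..<T}) f / sqrt (2 * lam k)"
    by simp
qed

lemma trace_duhamel_bound:
  assumes "f \<in> L2 (lebesgue_on {0<..<T})" "\<tau> \<in> {0..T}"
  shows "\<bar>trace_coeff k * duhamel f \<tau> k\<bar> \<le> L2_norm (lebesgue_on {0<..<T}) f * control_weight k"
proof -
  have "\<bar>duhamel f \<tau> k\<bar> \<le> L2_norm (lebesgue_on {0<..<T}) f / sqrt (2 * lam k)"
    unfolding duhamel_def using assms by (intro integral_exp_bound(2)) auto
  hence "trace_coeff k * \<bar>duhamel f \<tau> k\<bar> \<le> trace_coeff k * (L2_norm (lebesgue_on {0<..<T}) f / sqrt (2 * lam k))"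
    using trace_coeff_pos[of k] by (intro mult_left_mono) auto
  thus ?thesis
    using trace_coeff_pos[of k] by (simp add: abs_mult control_weight_def mult_ac)
qed

lemma trace_duhamel_summable:
  assumes "f \<in> L2 (lebesgue_on {0<..<T})" "\<tau> \<in> {0..T}"
  shows "summable (\<lambda>k. (trace_coeff k * duhamel f \<tau> k)\<^sup>2 * lam k powr - s)"
    and "sqrt (\<Sum>k. (trace_coeff k * duhamel f \<tau> k)\<^sup>2 * lam k powr - s) \<le> control_const * L2_norm (lebesgue_on {0<..<T}) f"
proof -
  let ?N = "L2_norm (lebesgue_on {0<..<T}) f"
  have le: "(trace_coeff k * duhamel f \<tau> k)\<^sup>2 * lam k powr - s \<le> ?N\<^sup>2 * ((control_weight k)\<^sup>2 * lam k powr - s)" for k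
  proof -
    have "(trace_coeff k * duhamel f \<tau> k)\<^sup>2 \<le> (?N * control_weight k)\<^sup>2"
      using trace_duhamel_bound[OF assms, of k] by (rule abs_le_square_iff[THEN iffD1, OF order_trans]) simp
    hence "(trace_coeff k * duhamel f \<tau> k)\<^sup>2 * lam k powr - s \<le> (?N * control_weight k)\<^sup>2 * lam k powr - s"
      by (rule mult_right_mono) simp
    thus ?thesis
      by (simp add: power_mult_distrib mult.assoc)
  qed
  have B: "summable (\<lambda>k. ?N\<^sup>2 * ((control_weight k)\<^sup>2 * lam k powr - s))"
    by (rule summable_mult[OF control_weight_summable])
  show sm: "summable (\<lambda>k. (trace_coeff k * duhamel f \<tau> k)\<^sup>2 * lam k powr - s)"
    by (rule summable_comparison_test'[OF B, where N = 0]) (use le in simp)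
  have "(\<Sum>k. (trace_coeff k * duhamel f \<tau> k)\<^sup>2 * lam k powr - s) \<le> (\<Sum>k. ?N\<^sup>2 * ((control_weight k)\<^sup>2 * lam k powr - s))"
    by (rule suminf_le[OF le sm B])
  also have "\<dots> = ?N\<^sup>2 * (\<Sum>k. (control_weight k)\<^sup>2 * lam k powr - s)"
    by (rule suminf_mult[OF control_weight_summable])
  finally have "sqrt (\<Sum>k. (trace_coeff k * duhamel f \<tau> k)\<^sup>2 * lam k powr - s)
      \<le> sqrt (?N\<^sup>2 * (\<Sum>k. (control_weight k)\<^sup>2 * lam k powr - s))"
    by (rule real_sqrt_le_mono)
  thus "sqrt (\<Sum>k. (trace_coeff k * duhamel f \<tau> k)\<^sup>2 * lam k powr - s) \<le> control_const * ?N"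
    by (simp add: control_const_def real_sqrt_mult mult.commute)
qed

lemma duhamel_lincomb:
  assumes "f \<in> L2 (lebesgue_on {0<..<T})" "g \<in> L2 (lebesgue_on {0<..<T})" "\<tau> \<in> {0..T}"
  shows "duhamel (\<lambda>t. a * f t + b * g t) \<tau> k = a * duhamel f \<tau> k + b * duhamel g \<tau> k"
proof -
  have \<tau>: "0 \<le> \<tau>" "\<tau> \<le> T"
    using assms(3) by auto
  show ?thesis
    using L2_inner_lincomb[OF L2_lebesgue_on_subinterval(1)[OF assms(1) \<tau>(2)]
        L2_lebesgue_on_subinterval(1)[OF assms(2) \<tau>(2)] exp_decay_L2(1)[OF eigval_pos[of k] \<tau>(1)], of a b]
    unfolding duhamel_def L2_inner_def .
qed

text \<open>The parameter sits both in the domain and in the integrand; pulling out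
  \<open>exp (lam k * (T - \<tau>))\<close> leaves a fixed integrand and so an indefinite
  integral.\<close>

lemma duhamel_continuous:
  assumes f: "f \<in> L2 (lebesgue_on {0<..<T})" and T: "0 \<le> T"
  shows "continuous_on {0..T} (\<lambda>\<tau>. duhamel f \<tau> k)"
proof -
  let ?g = "\<lambda>t. f t * exp (- lam k * (T - t))"
  have gi: "integrable (lebesgue_on {0<..<\<tau>}) ?g" if "\<tau> \<le> T" for \<tau>
  proof -
    show ?thesis
    proof (cases "0 \<le> \<tau>")
      case True
      have "integrable (lebesgue_on {0<..<\<tau>}) (\<lambda>t. exp (- lam k * (T - \<tau>)) * (f t * exp (- lam k * (\<tau> - t))))"
        by (intro integrable_mult_right impI integral_exp_bound(1)[OF f True that])
      moreover have "(\<lambda>t. exp (- lam k * (T - \<tau>)) * (f t * exp (- lam k * (\<tau> - t)))) = ?g"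
        by (rule ext) (simp add: mult.left_commute algebra_simps flip: exp_add)
      ultimately show ?thesis
        by (simp only:)
    qed simp
  qed
  have "?g integrable_on {0<..<T}"
    using gi[of T] by (intro integrable_on_lebesgue_on) auto
  hence "?g integrable_on {0..T}"
    by (simp add: integrable_on_open_interval_real)
  hence "continuous_on {0..T} (\<lambda>\<tau>. exp (lam k * (T - \<tau>)) * integral {0..\<tau>} ?g)"
    by (intro continuous_on_mult indefinite_integral_continuous_1) (auto intro!: continuous_intros)
  moreover have "exp (lam k * (T - \<tau>)) * integral {0..\<tau>} ?g = duhamel f \<tau> k" if "\<tau> \<in> {0..T}" for \<tau>
  proof -
    have "integral {0..\<tau>} ?g = (LINT t|lebesgue_on {0<..<\<tau>}. ?g t)"
      using gi[of \<tau>] that by (subst lebesgue_integral_eq_integral) (auto simp: integral_open_interval_real)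
    hence "exp (lam k * (T - \<tau>)) * integral {0..\<tau>} ?g = (LINT t|lebesgue_on {0<..<\<tau>}. exp (lam k * (T - \<tau>)) * ?g t)"
      by simp
    also have "(\<lambda>t. exp (lam k * (T - \<tau>)) * ?g t) = (\<lambda>t. f t * exp (- lam k * (\<tau> - t)))"
      by (simp add: mult.left_commute algebra_simps flip: exp_add)
    finally show ?thesis
      by (simp only: duhamel_def)
  qed
  ultimately show ?thesis
    by (rule continuous_on_eq)
qed

text \<open>Sum and integral are exchanged because the integrals of \<open>norm (g k t)\<close> are
  summable: each is at most the norm of \<open>f\<close> times
  \<open>\<bar>control_weight k * cf z k\<bar>\<close>, and \<open>dual_of_summable\<close> applies
  to that product.\<close>

lemma control_integral:
  assumes f: "f \<in> L2 (lebesgue_on {0<..<T})" and \<tau>: "\<tau> \<in> {0..T}" and z: "z \<in> H"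
  shows "integrable (lebesgue_on {0<..<\<tau>}) (control_integrand \<alpha> \<beta> \<mu> \<tau> f z)"
    and "(LINT t|lebesgue_on {0<..<\<tau>}. control_integrand \<alpha> \<beta> \<mu> \<tau> f z t) = dual_of (\<lambda>k. trace_coeff k * duhamel f \<tau> k) z"
proof -
  let ?M = "lebesgue_on {0<..<\<tau>}"
  have \<tau>': "0 \<le> \<tau>" "\<tau> \<le> T"
    using \<tau> by auto
  define g where "g k t = trace_coeff k * cf z k * (f t * exp (- lam k * (\<tau> - t)))" for k t
  \<comment> \<open>On the open interval \<open>\<tau> - t\<close> is positive, so the semigroup has
    a trace and its series converges absolutely at every such \<open>t\<close>.\<close>
  have eq: "control_integrand \<alpha> \<beta> \<mu> \<tau> f z t = (\<Sum>k. g k t)" and sm: "summable (\<lambda>k. norm (g k t))" if t: "t \<in> space ?M" for t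
  proof -
    have t': "0 < \<tau> - t"
      using t by simp
    have "summable (\<lambda>k. \<bar>(amp k * exp (- lam k * (\<tau> - t))) * cf z k\<bar>)"
      by (rule dual_of_summable(1)[OF amp_exp_summable[OF t'] z])
    hence "summable (\<lambda>k. (pexp / Gamma (\<nu> + 1) * \<bar>f t\<bar>) * \<bar>(amp k * exp (- lam k * (\<tau> - t))) * cf z k\<bar>)"
      by (rule summable_mult)
    also have "(\<lambda>k. (pexp / Gamma (\<nu> + 1) * \<bar>f t\<bar>) * \<bar>(amp k * exp (- lam k * (\<tau> - t))) * cf z k\<bar>) = (\<lambda>k. norm (g k t))"
      using pexp_pos nu_pos by (simp add: g_def trace_coeff_def abs_mult mult_ac)
    finally show "summable (\<lambda>k. norm (g k t))" .
    have "summable (\<lambda>k. \<bar>(amp k * exp (- lam k * (\<tau> - t))) * cf z k\<bar>)"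
      by (rule dual_of_summable(1)[OF amp_exp_summable[OF t'] z])
    hence "summable (\<lambda>k. (amp k * exp (- lam k * (\<tau> - t))) * cf z k)"
      by (rule summable_rabs_cancel)
    hence "summable (\<lambda>k. pexp / Gamma (\<nu> + 1) * ((amp k * exp (- lam k * (\<tau> - t))) * cf z k))"
      by (rule summable_mult)
    also have "(\<lambda>k. pexp / Gamma (\<nu> + 1) * ((amp k * exp (- lam k * (\<tau> - t))) * cf z k))
        = (\<lambda>k. (trace_coeff k * exp (- lam k * (\<tau> - t))) * cf z k)"
      by (simp add: trace_coeff_def mult_ac)
    finally have "f t * (\<Sum>k. (trace_coeff k * exp (- lam k * (\<tau> - t))) * cf z k)
        = (\<Sum>k. f t * ((trace_coeff k * exp (- lam k * (\<tau> - t))) * cf z k))"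
      by (rule suminf_mult[symmetric])
    thus "control_integrand \<alpha> \<beta> \<mu> \<tau> f z t = (\<Sum>k. g k t)"
      unfolding control_integrand_def boundary_trace_eq[OF heat_semigroup_has_trace[OF z t']]
      by (simp add: g_def mult_ac)
  qed
  have gi: "integrable ?M (g k)" for k
    unfolding g_def[abs_def] by (intro integrable_mult_right impI integral_exp_bound(1)[OF f \<tau>'])
  have AE: "AE t in ?M. summable (\<lambda>k. norm (g k t))"
    using sm by (rule AE_I2)
  have norms: "summable (\<lambda>k. LINT t|?M. norm (g k t))"
  proof (rule summable_comparison_test'[where N = 0])
    \<comment> \<open>The exponential is positive, so the absolute value falls on \<open>f\<close>
      alone, and the integral bound is applied to \<open>\<bar>f t\<bar>\<close>.\<close>
    let ?N = "L2_norm (lebesgue_on {0<..<T}) (\<lambda>t. \<bar>f t\<bar>)"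
    have f': "(\<lambda>t. \<bar>f t\<bar>) \<in> L2 (lebesgue_on {0<..<T})"
      using f by (auto simp: L2_def)
    show "summable (\<lambda>k. ?N * \<bar>control_weight k * cf z k\<bar>)"
      by (intro summable_mult dual_of_summable(1)[OF control_weight_summable z])
    fix k
    have "norm (g k t) = \<bar>trace_coeff k * cf z k\<bar> * (\<bar>f t\<bar> * exp (- lam k * (\<tau> - t)))" for t
      by (simp add: g_def abs_mult)
    hence "norm (LINT t|?M. norm (g k t)) = \<bar>trace_coeff k * cf z k\<bar> * \<bar>LINT t|?M. \<bar>f t\<bar> * exp (- lam k * (\<tau> - t))\<bar>"
      by (simp add: abs_mult)
    also have "\<dots> \<le> \<bar>trace_coeff k * cf z k\<bar> * (?N / sqrt (2 * lam k))"
      by (intro mult_left_mono integral_exp_bound(2)[OF f' \<tau>'] abs_ge_zero)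
    also have "\<dots> = ?N * \<bar>control_weight k * cf z k\<bar>"
      using eigval_pos[of k] by (simp add: control_weight_def abs_mult)
    finally show "norm (LINT t|?M. norm (g k t)) \<le> ?N * \<bar>control_weight k * cf z k\<bar>" .
  qed
  have "integrable ?M (\<lambda>t. \<Sum>k. g k t)"
    by (rule integrable_suminf[OF gi AE norms])
  thus "integrable ?M (control_integrand \<alpha> \<beta> \<mu> \<tau> f z)"
    using eq Bochner_Integration.integrable_cong[of ?M ?M "control_integrand \<alpha> \<beta> \<mu> \<tau> f z" "\<lambda>t. \<Sum>k. g k t"] by blast
  have "(LINT t|?M. control_integrand \<alpha> \<beta> \<mu> \<tau> f z t) = (LINT t|?M. (\<Sum>k. g k t))"
    by (rule Bochner_Integration.integral_cong[OF refl eq])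
  also have "\<dots> = (\<Sum>k. LINT t|?M. g k t)"
    by (rule integral_suminf[OF gi AE norms])
  also have "\<dots> = (\<Sum>k. (trace_coeff k * duhamel f \<tau> k) * cf z k)"
  proof -
    have "(LINT t|?M. g k t) = (trace_coeff k * cf z k) * duhamel f \<tau> k" for k
      unfolding g_def duhamel_def by (rule integral_mult_right_zero)
    thus ?thesis
      by (simp add: mult_ac)
  qed
  finally show "(LINT t|?M. control_integrand \<alpha> \<beta> \<mu> \<tau> f z t) = dual_of (\<lambda>k. trace_coeff k * duhamel f \<tau> k) z"
    using z by (simp add: dual_of_def)
qed

lemma control_op_eq:
  assumes "f \<in> L2 (lebesgue_on {0<..<T})" "\<tau> \<in> {0..T}"
  shows "control_op \<alpha> \<beta> \<mu> s \<tau> f = dual_of (\<lambda>k. trace_coeff k * duhamel f \<tau> k)"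
proof
  fix z
  show "control_op \<alpha> \<beta> \<mu> s \<tau> f z = dual_of (\<lambda>k. trace_coeff k * duhamel f \<tau> k) z"
    using control_integral(2)[OF assms] by (cases "z \<in> H") (simp_all add: control_op_def dual_of_def)
qed

lemma control_op_norm:
  assumes "f \<in> L2 (lebesgue_on {0<..<T})" "\<tau> \<in> {0..T}"
  shows "control_op \<alpha> \<beta> \<mu> s \<tau> f \<in> Hd"
    and "dnrm (control_op \<alpha> \<beta> \<mu> s \<tau> f) \<le> control_const * L2_norm (lebesgue_on {0<..<T}) f"
  unfolding control_op_eq[OF assms]
  using dual_of_mem[OF trace_duhamel_summable(1)[OF assms]]
    order_trans[OF dual_of_norm_le[OF trace_duhamel_summable(1)[OF assms]] trace_duhamel_summable(2)[OF assms]]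
  by simp_all

lemma bounded_control_control_op:
  assumes "\<tau> \<in> {0..T}"
  shows "bounded_control \<alpha> \<beta> \<mu> s T (control_op \<alpha> \<beta> \<mu> s \<tau>)"
  unfolding bounded_control_def
proof (intro conjI ballI allI exI)
  fix f g a b assume fg: "f \<in> L2 (lebesgue_on {0<..<T})" "g \<in> L2 (lebesgue_on {0<..<T})"
  have "control_op \<alpha> \<beta> \<mu> s \<tau> (\<lambda>t. a * f t + b * g t)
      = dual_of (\<lambda>k. a * (trace_coeff k * duhamel f \<tau> k) + b * (trace_coeff k * duhamel g \<tau> k))"
    unfolding control_op_eq[OF L2_lincomb[OF fg] assms] duhamel_lincomb[OF fg assms]
    by (simp add: algebra_simps)
  also have "\<dots> = (\<lambda>z. a * control_op \<alpha> \<beta> \<mu> s \<tau> f z + b * control_op \<alpha> \<beta> \<mu> s \<tau> g z)"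
    unfolding control_op_eq[OF fg(1) assms] control_op_eq[OF fg(2) assms]
    by (rule dual_of_lincomb[OF trace_duhamel_summable(1)[OF fg(1) assms] trace_duhamel_summable(1)[OF fg(2) assms]])
  finally show "control_op \<alpha> \<beta> \<mu> s \<tau> (\<lambda>t. a * f t + b * g t)
      = (\<lambda>z. a * control_op \<alpha> \<beta> \<mu> s \<tau> f z + b * control_op \<alpha> \<beta> \<mu> s \<tau> g z)" .
qed (rule control_op_norm[OF _ assms], assumption)+

lemma control_op_continuous:
  assumes "f \<in> L2 (lebesgue_on {0<..<T})" "0 \<le> T"
  shows "continuous_in_dual \<alpha> \<beta> \<mu> s T (\<lambda>\<tau>. control_op \<alpha> \<beta> \<mu> s \<tau> f)"
proof -
  have "continuous_in_dual \<alpha> \<beta> \<mu> s T (\<lambda>\<tau>. dual_of (\<lambda>k. trace_coeff k * duhamel f \<tau> k))"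
  proof (rule continuous_in_dual_dual_of)
    show "continuous_on {0..T} (\<lambda>\<tau>. trace_coeff k * duhamel f \<tau> k)" for k
      by (intro continuous_on_mult continuous_on_const duhamel_continuous assms)
    show "summable (\<lambda>k. (L2_norm (lebesgue_on {0<..<T}) f * control_weight k)\<^sup>2 * lam k powr - s)"
      using ell2_weighted_lincomb[OF control_weight_summable control_weight_summable, of _ 0] by simp
  qed (rule trace_duhamel_bound[OF assms(1)])
  thus ?thesis
    by (rule continuous_in_dual_cong) (simp add: control_op_eq[OF assms(1)])
qed

section \<open>The weak solution in coefficients\<close>

definition weak_sol :: "(real \<Rightarrow> real) \<Rightarrow> ((real \<Rightarrow> real) \<Rightarrow> real) \<Rightarrow> real \<Rightarrow> (real \<Rightarrow> real) \<Rightarrow> real" where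
  "weak_sol f u0 \<tau> = dual_of (\<lambda>k. exp (- lam k * \<tau>) * u0 (\<Phi> k) + trace_coeff k * duhamel f \<tau> k)"

lemma semigroup_coeff_le:
  assumes "0 \<le> \<tau>"
  shows "\<bar>exp (- lam k * \<tau>) * b\<bar> \<le> \<bar>b\<bar>"
proof -
  have "exp (- lam k * \<tau>) \<le> 1"
    using eigval_pos[of k] assms by simp
  thus ?thesis
    using mult_right_mono[of "exp (- lam k * \<tau>)" 1 "\<bar>b\<bar>"] by (simp add: abs_mult)
qed

lemma semigroup_coeff_summable:
  assumes "u0 \<in> Hd" "0 \<le> \<tau>"
  shows "summable (\<lambda>k. (exp (- lam k * \<tau>) * u0 (\<Phi> k))\<^sup>2 * lam k powr - s)"
    and "sqrt (\<Sum>k. (exp (- lam k * \<tau>) * u0 (\<Phi> k))\<^sup>2 * lam k powr - s) \<le> dnrm u0"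
proof -
  have le: "(exp (- lam k * \<tau>) * u0 (\<Phi> k))\<^sup>2 * lam k powr - s \<le> (u0 (\<Phi> k))\<^sup>2 * lam k powr - s" for k
    using semigroup_coeff_le[OF assms(2), of k "u0 (\<Phi> k)"]
    by (intro mult_right_mono abs_le_square_iff[THEN iffD1]) auto
  show sm: "summable (\<lambda>k. (exp (- lam k * \<tau>) * u0 (\<Phi> k))\<^sup>2 * lam k powr - s)"
    by (rule summable_comparison_test'[OF H_dual_coeffs(1)[OF assms(1)], where N = 0]) (use le in simp)
  have "sqrt (\<Sum>k. (exp (- lam k * \<tau>) * u0 (\<Phi> k))\<^sup>2 * lam k powr - s) \<le> sqrt (\<Sum>k. (u0 (\<Phi> k))\<^sup>2 * lam k powr - s)"
    by (rule real_sqrt_le_mono[OF suminf_le[OF le sm H_dual_coeffs(1)[OF assms(1)]]])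
  also have "\<dots> \<le> dnrm u0"
    by (rule H_dual_coeffs(2)[OF assms(1)])
  finally show "sqrt (\<Sum>k. (exp (- lam k * \<tau>) * u0 (\<Phi> k))\<^sup>2 * lam k powr - s) \<le> dnrm u0" .
qed

context
  fixes T :: real and f u0
  assumes f: "f \<in> L2 (lebesgue_on {0<..<T})" and u0: "u0 \<in> Hd"
begin

lemma weak_sol_eq:
  assumes "\<tau> \<in> {0..T}"
  shows "weak_sol f u0 \<tau> = (\<lambda>z. heat_semigroup_dual \<alpha> \<beta> \<mu> s \<tau> u0 z + control_op \<alpha> \<beta> \<mu> s \<tau> f z)"
  unfolding weak_sol_def heat_semigroup_dual_eq control_op_eq[OF f assms]
  using dual_of_lincomb[OF semigroup_coeff_summable(1)[OF u0, of \<tau>] trace_duhamel_summable(1)[OF f assms], of 1 1] assms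
  by simp

lemma weak_sol_mem:
  assumes "\<tau> \<in> {0..T}"
  shows "weak_sol f u0 \<tau> \<in> Hd"
  unfolding weak_sol_def
  using dual_of_mem[OF ell2_weighted_lincomb[OF semigroup_coeff_summable(1)[OF u0, of \<tau>] trace_duhamel_summable(1)[OF f assms], of 1 1]] assms
  by simp

lemma weak_sol_transposition:
  assumes "\<tau> \<in> {0..T}"
  shows "transposition_identity \<alpha> \<beta> \<mu> s f u0 \<tau> (weak_sol f u0 \<tau>)"
  unfolding transposition_identity_def
proof
  fix z assume z: "z \<in> H"
  have "0 \<le> \<tau>"
    using assms by simp
  thus "weak_sol f u0 \<tau> z = (LINT t|lebesgue_on {0<..<\<tau>}. control_integrand \<alpha> \<beta> \<mu> \<tau> f z t)
      + u0 (heat_semigroup \<alpha> \<beta> \<mu> \<tau> z)"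
    by (simp add: weak_sol_eq[OF assms] heat_semigroup_dual_eq control_op_eq[OF f assms]
        control_integral(2)[OF f assms z] heat_semigroup_pairing[OF u0 z])
qed

text \<open>The identity fixes the functional on \<open>H\<close>, and elements of the dual vanish
  elsewhere.\<close>

lemma transposition_unique:
  assumes "\<tau> \<in> {0..T}" "U \<in> Hd" "transposition_identity \<alpha> \<beta> \<mu> s f u0 \<tau> U"
  shows "U = weak_sol f u0 \<tau>"
proof
  fix z
  show "U z = weak_sol f u0 \<tau> z"
  proof (cases "z \<in> H")
    case True
    thus ?thesis
      using assms(3) weak_sol_transposition[OF assms(1)] by (simp add: transposition_identity_def)
  next
    case False
    thus ?thesis
      using assms(2) weak_sol_mem[OF assms(1)] by (simp add: H_dual_def)
  qed
qed

text \<open>Both parts have majorants independent of time: the semigroup does not enlarge the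
  coefficients of \<open>u0\<close>, and \<open>control_weight\<close> bounds the Duhamel
  part.\<close>

lemma weak_sol_continuous:
  assumes "0 \<le> T"
  shows "continuous_in_dual \<alpha> \<beta> \<mu> s T (weak_sol f u0)"
proof -
  let ?N = "L2_norm (lebesgue_on {0<..<T}) f"
  have "continuous_in_dual \<alpha> \<beta> \<mu> s T (\<lambda>\<tau>. dual_of (\<lambda>k. exp (- lam k * \<tau>) * u0 (\<Phi> k) + trace_coeff k * duhamel f \<tau> k))"
  proof (rule continuous_in_dual_dual_of)
    show "continuous_on {0..T} (\<lambda>\<tau>. exp (- lam k * \<tau>) * u0 (\<Phi> k) + trace_coeff k * duhamel f \<tau> k)" for k
      by (intro continuous_intros duhamel_continuous f assms)
    show "\<bar>exp (- lam k * \<tau>) * u0 (\<Phi> k) + trace_coeff k * duhamel f \<tau> k\<bar> \<le> \<bar>u0 (\<Phi> k)\<bar> + ?N * control_weight k"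
      if "\<tau> \<in> {0..T}" for \<tau> k
    proof -
      have "0 \<le> \<tau>"
        using that by simp
      thus ?thesis
        using trace_duhamel_bound[OF f that, of k] semigroup_coeff_le[of \<tau> k "u0 (\<Phi> k)"] by linarith
    qed
    have "summable (\<lambda>k. \<bar>u0 (\<Phi> k)\<bar>\<^sup>2 * lam k powr - s)"
      using H_dual_coeffs(1)[OF u0] by simp
    from ell2_weighted_lincomb[OF this control_weight_summable, of 1 ?N]
    show "summable (\<lambda>k. (\<bar>u0 (\<Phi> k)\<bar> + ?N * control_weight k)\<^sup>2 * lam k powr - s)"
      by simp
  qed
  thus ?thesis
    by (simp only: weak_sol_def[abs_def])
qed

lemma weak_sol_norm:
  assumes "\<tau> \<in> {0..T}"
  shows "dnrm (weak_sol f u0 \<tau>) \<le> dnrm u0 + control_const * L2_norm (lebesgue_on {0<..<T}) f"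
proof -
  have \<tau>: "0 \<le> \<tau>"
    using assms by simp
  let ?S = "heat_semigroup_dual \<alpha> \<beta> \<mu> s \<tau> u0"
  have S: "?S \<in> Hd" "dnrm ?S \<le> dnrm u0"
    unfolding heat_semigroup_dual_eq
    using dual_of_mem[OF semigroup_coeff_summable(1)[OF u0 \<tau>]]
      order_trans[OF dual_of_norm_le[OF semigroup_coeff_summable(1)[OF u0 \<tau>]] semigroup_coeff_summable(2)[OF u0 \<tau>]]
    by simp_all
  show ?thesis
    unfolding weak_sol_eq[OF assms]
    using H_dual_norm_triangle[OF S(1) control_op_norm(1)[OF f assms]] S(2) control_op_norm(2)[OF f assms] by linarith
qed

end

section \<open>Norms and pairings along continuous curves in the dual\<close>

lemma H_dual_norm_diff_commute: "dnrm (\<lambda>z. \<phi> z - \<psi> z) = dnrm (\<lambda>z. \<psi> z - \<phi> z)"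
  unfolding H_dual_norm_def by (simp only: abs_minus_commute)

lemma H_dual_norm_diff_le:
  assumes "\<phi> \<in> Hd" "\<psi> \<in> Hd"
  shows "\<bar>dnrm \<phi> - dnrm \<psi>\<bar> \<le> dnrm (\<lambda>z. \<phi> z - \<psi> z)"
proof -
  have diff: "(\<lambda>z. \<phi> z - \<psi> z) \<in> Hd" "(\<lambda>z. \<psi> z - \<phi> z) \<in> Hd"
    using H_dual_lincomb[OF assms, of 1 "-1"] H_dual_lincomb[OF assms(2,1), of 1 "-1"] by simp_all
  have "dnrm \<phi> \<le> dnrm \<psi> + dnrm (\<lambda>z. \<phi> z - \<psi> z)"
    using H_dual_norm_triangle[OF assms(2) diff(1)] by simp
  moreover have "dnrm \<psi> \<le> dnrm \<phi> + dnrm (\<lambda>z. \<phi> z - \<psi> z)"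
    using H_dual_norm_triangle[OF assms(1) diff(2)] H_dual_norm_diff_commute[of \<phi> \<psi>] by simp
  ultimately show ?thesis
    by linarith
qed

text \<open>Supplies the measurability of the norm that \<open>esssup_I\<close> requires.\<close>

lemma continuous_in_dual_norm:
  assumes u: "continuous_in_dual \<alpha> \<beta> \<mu> s T u"
  shows "continuous_on {0..T} (\<lambda>t. dnrm (u t))"
  unfolding continuous_on_def
proof
  fix t assume t: "t \<in> {0..T}"
  have mem: "u r \<in> Hd" if "r \<in> {0..T}" for r
    using u that unfolding continuous_in_dual_def by blast
  have lim: "((\<lambda>r. dnrm (\<lambda>z. u r z - u t z)) \<longlongrightarrow> 0) (at t within {0..T})"
    using u t unfolding continuous_in_dual_def by blast
  have "norm (dnrm (u r) - dnrm (u t)) \<le> dnrm (\<lambda>z. u r z - u t z)" if "r \<in> {0..T}" for r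
    using H_dual_norm_diff_le[OF mem[OF that] mem[OF t]] by simp
  hence "((\<lambda>r. dnrm (u r) - dnrm (u t)) \<longlongrightarrow> 0) (at t within {0..T})"
    by (intro Lim_null_comparison[OF _ lim]) (simp add: eventually_at_filter)
  thus "((\<lambda>t. dnrm (u t)) \<longlongrightarrow> dnrm (u t)) (at t within {0..T})"
    by (rule LIM_zero_cancel)
qed

lemma continuous_in_dual_pointwise:
  assumes u: "continuous_in_dual \<alpha> \<beta> \<mu> s T u" and z: "z \<in> H" and t: "t \<in> {0..T}"
  shows "((\<lambda>r. u r z) \<longlongrightarrow> u t z) (at t within {0..T})"
proof -
  have mem: "u r \<in> Hd" if "r \<in> {0..T}" for r
    using u that unfolding continuous_in_dual_def by blast
  have "((\<lambda>r. dnrm (\<lambda>z. u r z - u t z)) \<longlongrightarrow> 0) (at t within {0..T})"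
    using u t unfolding continuous_in_dual_def by blast
  hence lim: "((\<lambda>r. dnrm (\<lambda>z. u r z - u t z) * nrm z) \<longlongrightarrow> 0) (at t within {0..T})"
    by (rule tendsto_mult_left_zero)
  have "norm (u r z - u t z) \<le> dnrm (\<lambda>z. u r z - u t z) * nrm z" if r: "r \<in> {0..T}" for r
    using H_dual_norm_bound[OF H_dual_lincomb[OF mem[OF r] mem[OF t], of 1 "-1"] z] by simp
  hence "((\<lambda>r. u r z - u t z) \<longlongrightarrow> 0) (at t within {0..T})"
    by (intro Lim_null_comparison[OF _ lim]) (simp add: eventually_at_filter)
  thus ?thesis
    by (rule LIM_zero_cancel)
qed

text \<open>\<open>weak_solution\<close> imposes the identity at positive times only; since
  \<open>0\<close> is a limit point of \<open>{0..T}\<close>, continuity carries uniqueness to time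
  \<open>0\<close>.\<close>

lemma continuous_in_dual_eq_at_0:
  assumes T: "0 < T" and u: "continuous_in_dual \<alpha> \<beta> \<mu> s T u" and v: "continuous_in_dual \<alpha> \<beta> \<mu> s T v"
    and eq: "\<And>t. t \<in> {0<..T} \<Longrightarrow> u t = v t"
  shows "u 0 = v 0"
proof
  fix z
  have 0: "0 \<in> {0..T}"
    using T by simp
  show "u 0 z = v 0 z"
  proof (cases "z \<in> H")
    case True
    have "((\<lambda>r. v r z) \<longlongrightarrow> u 0 z) (at 0 within {0..T})"
      using continuous_in_dual_pointwise[OF u True 0]
      by (rule Lim_transform_eventually) (simp add: eventually_at_filter eq)
    moreover have "at 0 within {0..T} \<noteq> bot"
      using T by (simp add: trivial_limit_within islimpt_Icc)
    ultimately show ?thesis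
      using continuous_in_dual_pointwise[OF v True 0] tendsto_unique by blast
  next
    case False
    have "u 0 \<in> Hd" "v 0 \<in> Hd"
      using u v 0 unfolding continuous_in_dual_def by auto
    thus ?thesis
      using False by (simp add: H_dual_def)
  qed
qed

end

theorem proposition10:
  fixes \<alpha> \<beta> \<mu> T s :: real
  assumes "0 < T" and "0 \<le> \<alpha>" and "\<alpha> < 2" and "\<alpha> + \<beta> < 1"
    and "\<mu> < mu_crit (\<alpha> + \<beta>)" and "nu \<alpha> \<beta> \<mu> < s"
  shows
    "(\<forall>z\<in>H_space \<alpha> \<beta> \<mu> s. \<forall>t>0. \<exists>l.
        has_trace (\<alpha> + \<beta> + gam \<alpha> \<beta> \<mu>) (heat_semigroup \<alpha> \<beta> \<mu> t z) l) \<and>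
     (\<forall>f\<in>L2 (lebesgue_on {0<..<T}). \<forall>\<tau>\<in>{0..T}. \<forall>z\<in>H_space \<alpha> \<beta> \<mu> s.
        integrable (lebesgue_on {0<..<\<tau>}) (control_integrand \<alpha> \<beta> \<mu> \<tau> f z)) \<and>
     (\<forall>f\<in>L2 (lebesgue_on {0<..<T}). \<forall>u0\<in>H_dual \<alpha> \<beta> \<mu> s.
        (\<forall>\<tau>\<in>{0..T}. \<exists>!U. U \<in> H_dual \<alpha> \<beta> \<mu> s \<and>
           transposition_identity \<alpha> \<beta> \<mu> s f u0 \<tau> U) \<and>
        (\<forall>\<tau>\<in>{0<..T}. \<forall>U\<in>H_dual \<alpha> \<beta> \<mu> s.
           transposition_identity \<alpha> \<beta> \<mu> s f u0 \<tau> U \<longrightarrow>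
           U = (\<lambda>z. heat_semigroup_dual \<alpha> \<beta> \<mu> s \<tau> u0 z + control_op \<alpha> \<beta> \<mu> s \<tau> f z))) \<and>
     (\<forall>\<tau>\<in>{0..T}. bounded_control \<alpha> \<beta> \<mu> s T (control_op \<alpha> \<beta> \<mu> s \<tau>)) \<and>
     (\<forall>f\<in>L2 (lebesgue_on {0<..<T}).
        continuous_in_dual \<alpha> \<beta> \<mu> s T (\<lambda>\<tau>. control_op \<alpha> \<beta> \<mu> s \<tau> f)) \<and>
     (\<exists>C>0. \<forall>f\<in>L2 (lebesgue_on {0<..<T}). \<forall>u0\<in>H_dual \<alpha> \<beta> \<mu> s. \<exists>u.
        weak_solution \<alpha> \<beta> \<mu> s T f u0 u \<and>
        (\<forall>v. weak_solution \<alpha> \<beta> \<mu> s T f u0 v \<longrightarrow> (\<forall>t\<in>{0..T}. v t = u t)) \<and>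
        (\<forall>\<tau>\<in>{0..T}. transposition_identity \<alpha> \<beta> \<mu> s f u0 \<tau> (u \<tau>)) \<and>
        esssup (lebesgue_on {0..T}) (\<lambda>t. ereal (H_dual_norm \<alpha> \<beta> \<mu> s (u t)))
          \<le> ereal (C * (H_dual_norm \<alpha> \<beta> \<mu> s u0 + L2_norm (lebesgue_on {0<..<T}) f)))"
proof (intro conjI ballI allI impI)
  interpret bessel_heat \<alpha> \<beta> \<mu> s
    by unfold_locales (use assms in auto)
  have T: "0 \<le> T"
    using assms(1) by simp
  let ?L = "L2 (lebesgue_on {0<..<T})" and ?S = "heat_semigroup \<alpha> \<beta> \<mu>"
  show "\<exists>l. has_trace (\<alpha> + \<beta> + gam \<alpha> \<beta> \<mu>) (?S t z) l" if "z \<in> H" "0 < t" for z t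
    using heat_semigroup_has_trace[OF that] by blast
  show "integrable (lebesgue_on {0<..<\<tau>}) (control_integrand \<alpha> \<beta> \<mu> \<tau> f z)"
    if "f \<in> ?L" "\<tau> \<in> {0..T}" "z \<in> H" for f \<tau> z
    using that by (rule control_integral(1))
  show "\<exists>!U. U \<in> Hd \<and> transposition_identity \<alpha> \<beta> \<mu> s f u0 \<tau> U"
    if "f \<in> ?L" "u0 \<in> Hd" "\<tau> \<in> {0..T}" for f u0 \<tau>
    using weak_sol_mem[OF that] weak_sol_transposition[OF that] transposition_unique[OF that] by blast
  show "U = (\<lambda>z. heat_semigroup_dual \<alpha> \<beta> \<mu> s \<tau> u0 z + control_op \<alpha> \<beta> \<mu> s \<tau> f z)"
    if "f \<in> ?L" "u0 \<in> Hd" "\<tau> \<in> {0<..T}" "U \<in> Hd" "transposition_identity \<alpha> \<beta> \<mu> s f u0 \<tau> U" for f u0 \<tau> U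
  proof -
    have \<tau>: "\<tau> \<in> {0..T}"
      using that(3) by auto
    show ?thesis
      unfolding transposition_unique[OF that(1,2) \<tau> that(4,5)] by (rule weak_sol_eq[OF that(1,2) \<tau>])
  qed
  show "bounded_control \<alpha> \<beta> \<mu> s T (control_op \<alpha> \<beta> \<mu> s \<tau>)" if "\<tau> \<in> {0..T}" for \<tau>
    using that by (rule bounded_control_control_op)
  show "continuous_in_dual \<alpha> \<beta> \<mu> s T (\<lambda>\<tau>. control_op \<alpha> \<beta> \<mu> s \<tau> f)" if "f \<in> ?L" for f
    using that T by (rule control_op_continuous)
  show "\<exists>C>0. \<forall>f\<in>?L. \<forall>u0\<in>Hd. \<exists>u.
      weak_solution \<alpha> \<beta> \<mu> s T f u0 u \<and>
      (\<forall>v. weak_solution \<alpha> \<beta> \<mu> s T f u0 v \<longrightarrow> (\<forall>t\<in>{0..T}. v t = u t)) \<and>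
      (\<forall>\<tau>\<in>{0..T}. transposition_identity \<alpha> \<beta> \<mu> s f u0 \<tau> (u \<tau>)) \<and>
      esssup (lebesgue_on {0..T}) (\<lambda>t. ereal (dnrm (u t)))
        \<le> ereal (C * (dnrm u0 + L2_norm (lebesgue_on {0<..<T}) f))"
  \<comment> \<open>The norm estimate has coefficient \<open>1\<close> at the initial datum and
    \<open>control_const\<close> at \<open>f\<close>; the maximum dominates both and is
    positive.\<close>
  proof (intro exI[of _ "max 1 control_const"] conjI ballI)
    fix f u0 assume f: "f \<in> ?L" and u0: "u0 \<in> Hd"
    let ?u = "weak_sol f u0" and ?N = "L2_norm (lebesgue_on {0<..<T}) f"
    note cont = weak_sol_continuous[OF f u0 T]
    have sol: "weak_solution \<alpha> \<beta> \<mu> s T f u0 ?u"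
      using cont weak_sol_transposition[OF f u0] by (simp add: weak_solution_def)
    have unique: "v t = ?u t" if v: "weak_solution \<alpha> \<beta> \<mu> s T f u0 v" and t: "t \<in> {0..T}" for v t
    proof -
      have vc: "continuous_in_dual \<alpha> \<beta> \<mu> s T v"
        and vt: "\<And>r. r \<in> {0<..T} \<Longrightarrow> transposition_identity \<alpha> \<beta> \<mu> s f u0 r (v r)"
        using v by (auto simp: weak_solution_def)
      have pos: "v r = ?u r" if r: "r \<in> {0<..T}" for r
      proof (rule transposition_unique[OF f u0 _ _ vt[OF r]])
        show "r \<in> {0..T}"
          using r by simp
        thus "v r \<in> Hd"
          using vc unfolding continuous_in_dual_def by blast
      qed
      show ?thesis
      proof (cases "t = 0")
        case True
        thus ?thesis
          using continuous_in_dual_eq_at_0[OF assms(1) vc cont pos] by simp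
      next
        case False
        thus ?thesis
          using pos[of t] t by simp
      qed
    qed
    have "esssup (lebesgue_on {0..T}) (\<lambda>t. ereal (dnrm (?u t))) \<le> ereal (max 1 control_const * (dnrm u0 + ?N))"
    proof (rule esssup_I)
      have "(\<lambda>t. dnrm (?u t)) \<in> borel_measurable (lebesgue_on {0..T})"
        by (rule continuous_imp_measurable_on_sets_lebesgue[OF continuous_in_dual_norm[OF cont]]) simp
      thus "(\<lambda>t. ereal (dnrm (?u t))) \<in> borel_measurable (lebesgue_on {0..T})"
        by measurable
      show "AE t in lebesgue_on {0..T}. ereal (dnrm (?u t)) \<le> ereal (max 1 control_const * (dnrm u0 + ?N))"
      proof (rule AE_I2)
        fix t assume "t \<in> space (lebesgue_on {0..T})"
        hence "dnrm (?u t) \<le> 1 * dnrm u0 + control_const * ?N"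
          using weak_sol_norm[OF f u0, of t] by simp
        also have "\<dots> \<le> max 1 control_const * dnrm u0 + max 1 control_const * ?N"
          by (intro add_mono mult_right_mono H_dual_norm_nonneg u0 L2_norm_nonneg) auto
        finally show "ereal (dnrm (?u t)) \<le> ereal (max 1 control_const * (dnrm u0 + ?N))"
          by (simp add: distrib_left)
      qed
    qed
    with sol unique weak_sol_transposition[OF f u0]
    show "\<exists>u. weak_solution \<alpha> \<beta> \<mu> s T f u0 u \<and>
      (\<forall>v. weak_solution \<alpha> \<beta> \<mu> s T f u0 v \<longrightarrow> (\<forall>t\<in>{0..T}. v t = u t)) \<and>
      (\<forall>\<tau>\<in>{0..T}. transposition_identity \<alpha> \<beta> \<mu> s f u0 \<tau> (u \<tau>)) \<and>
      esssup (lebesgue_on {0..T}) (\<lambda>t. ereal (dnrm (u t)))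
        \<le> ereal (max 1 control_const * (dnrm u0 + ?N))"
      by blast
  qed simp
qed

end
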